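(* Consider the reallocation problem restricted to instances with $c(w)=+\infty$ for all $w\in W$ (no warehouse capacity constraint). Then: (i) if moreover $d^-\equiv+\infty$ (or $d^+\equiv+\infty$) and the product size is uniform, a feasible schedule of minimum completion time can be computed in ${\mathrm O}(n+m\log m)$ time; (ii) if moreover $d^-\equiv+\infty$ (or $d^+\equiv+\infty$) and the transit time $\tau$ is uniform, the problem is $3/2$-approximable; (iii) if moreover $d^-\equiv+\infty$ (or $d^+\equiv+\infty$), the problem is $7/4$-approximable; (iv) if moreover the product size is uniform, the problem is $4$-approximable; (v) in general (only $c\equiv+\infty$), the problem is $6$-approximable.
   Context: Reallocation problem. An instance consists of a finite set $W$ of warehouses ($n=|W|$) and a finite set $P$ of products ($m=|P|$). Each product $p$ has a size ${\it size}(p)\ge0$, source $s(p)\in W$, sink $t(p)\in W$ with $s(p)\ne t(p)$, transit time $\tau(p)\in\mathbb{Z}_{>0}$. Each warehouse $w$ has warehouse capacity $c(w)$, carry-out capacity $d^+(w)$, carry-in capacity $d^-(w)$, each a nonnegative real or $+\infty$ (constraint vacuous); $d^-\equiv+\infty$ means $d^-(w)=+\infty$ for all $w$. $P^+(w)=\{p:s(p)=w\}$, $P^-(w)=\{p:t(p)=w\}$. Standing assumptions: ${\it size}(p)\le d^+(w)$ for $p\in P^+(w)$, ${\it size}(p)\le d^-(w)$ for $p\in P^-(w)$. A schedule $\varphi:P\to\mathbb{Z}_{\ge0}$ is feasible if for all $\theta\in\mathbb{Z}_{\ge0}$, $w\in W$: (i) $\sum_{p\in P^+(w):\varphi(p)=\theta}{\it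 size}(p)\le d^+(w)$; (ii) $\sum_{p\in P^-(w):\varphi(p)=\theta-\tau(p)}{\it size}(p)\le d^-(w)$; (iii) $\sum_{p\in P^+(w):\varphi(p)\ge\theta}{\it size}(p)+\sum_{p\in P^-(w):\varphi(p)\le\theta-\tau(p)}{\it size}(p)\le c(w)$. Completion time: $\max_p(\varphi(p)+\tau(p))$. "Uniform" means constant over $P$. The problem is $\alpha$-approximable if a polynomial-time algorithm outputs a feasible schedule with completion time at most $\alpha$ times the minimum completion time of a feasible schedule. *)

theory Defs
  imports Complex_Main
    "HOL-Library.Extended_Real"
    "HOL-Library.Log_Nat"
    "HOL-Computational_Algebra.Polynomial"
begin

section \<open>The reallocation problem\<close>

text \<open>Algorithms take labelled inputs, so the warehouses are the numbers below \<open>nW\<close> and the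
  products the numbers below \<open>nP\<close>; values of the other fields outside these ranges are
  irrelevant. Capacities range over the nonnegative reals and \<open>\<infinity>\<close>.\<close>

record inst =
  nW :: nat
  nP :: nat
  psize :: "nat \<Rightarrow> real"
  src :: "nat \<Rightarrow> nat"
  snk :: "nat \<Rightarrow> nat"
  transit :: "nat \<Rightarrow> nat"
  cap :: "nat \<Rightarrow> ereal"
  carry_out :: "nat \<Rightarrow> ereal"
  carry_in :: "nat \<Rightarrow> ereal"

definition warehouses :: "inst \<Rightarrow> nat set" where
  "warehouses I = {..<nW I}"

definition products :: "inst \<Rightarrow> nat set" where
  "products I = {..<nP I}"

definition P_out :: "inst \<Rightarrow> nat \<Rightarrow> nat set" where
  "P_out I w = {p \<in> products I. src I p = w}"

definition P_in :: "inst \<Rightarrow> nat \<Rightarrow> nat set" where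
  "P_in I w = {p \<in> products I. snk I p = w}"

definition valid_inst :: "inst \<Rightarrow> bool" where
  "valid_inst I \<longleftrightarrow>
     (\<forall>p \<in> products I. psize I p \<ge> 0 \<and> src I p \<in> warehouses I \<and> snk I p \<in> warehouses I
        \<and> src I p \<noteq> snk I p \<and> transit I p > 0) \<and>
     (\<forall>w \<in> warehouses I. cap I w \<ge> 0 \<and> carry_out I w \<ge> 0 \<and> carry_in I w \<ge> 0) \<and>
     (\<forall>w \<in> warehouses I. \<forall>p \<in> P_out I w. ereal (psize I p) \<le> carry_out I w) \<and>
     (\<forall>w \<in> warehouses I. \<forall>p \<in> P_in I w. ereal (psize I p) \<le> carry_in I w)"

text \<open>Arrival conditions are written with \<open>\<phi> p + transit I p\<close> rather than \<open>\<theta> - transit I p\<close>,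
  since subtraction on \<open>nat\<close> truncates.\<close>

definition feasible :: "inst \<Rightarrow> (nat \<Rightarrow> nat) \<Rightarrow> bool" where
  "feasible I \<phi> \<longleftrightarrow> (\<forall>\<theta>. \<forall>w \<in> warehouses I.
     ereal (\<Sum>p | p \<in> P_out I w \<and> \<phi> p = \<theta>. psize I p) \<le> carry_out I w \<and>
     ereal (\<Sum>p | p \<in> P_in I w \<and> \<phi> p + transit I p = \<theta>. psize I p) \<le> carry_in I w \<and>
     ereal ((\<Sum>p | p \<in> P_out I w \<and> \<phi> p \<ge> \<theta>. psize I p) +
            (\<Sum>p | p \<in> P_in I w \<and> \<phi> p + transit I p \<le> \<theta>. psize I p)) \<le> cap I w)"

text \<open>Inserting \<open>0\<close> only matters without products, where the maximum would be over the empty set.\<close>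

definition completion_time :: "inst \<Rightarrow> (nat \<Rightarrow> nat) \<Rightarrow> nat" where
  "completion_time I \<phi> = Max (insert 0 ((\<lambda>p. \<phi> p + transit I p) ` products I))"

definition min_completion_time :: "inst \<Rightarrow> nat" where
  "min_completion_time I = (LEAST T. \<exists>\<phi>. feasible I \<phi> \<and> completion_time I \<phi> = T)"

definition no_cap :: "inst \<Rightarrow> bool" where
  "no_cap I \<longleftrightarrow> (\<forall>w \<in> warehouses I. cap I w = \<infinity>)"

definition no_carry_out :: "inst \<Rightarrow> bool" where
  "no_carry_out I \<longleftrightarrow> (\<forall>w \<in> warehouses I. carry_out I w = \<infinity>)"

definition no_carry_in :: "inst \<Rightarrow> bool" where
  "no_carry_in I \<longleftrightarrow> (\<forall>w \<in> warehouses I. carry_in I w = \<infinity>)"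

definition uniform_size :: "inst \<Rightarrow> bool" where
  "uniform_size I \<longleftrightarrow> (\<exists>a. \<forall>p \<in> products I. psize I p = a)"

definition uniform_transit :: "inst \<Rightarrow> bool" where
  "uniform_transit I \<longleftrightarrow> (\<exists>a. \<forall>p \<in> products I. transit I p = a)"


section \<open>Machine model\<close>

text \<open>Algorithms are structured programs for a random access machine with integer arrays and real
  arrays (a scalar is an array used at index 0 only). Every assignment and every test costs one
  step; a program is a fixed finite object, so charging for each operator inside an expression
  would change running times by at most a constant factor.

  The restrictions on the operations keep unit cost meaningful. There is no multiplication,
  division or rounding, so \<open>t\<close> steps lengthen the binary representation of a number by \<open>O(t)\<close> bits
  only, and on rational data polynomially many steps can be simulated by a Turing machine in
  polynomial time. The constants in real expressions are integers, since an arbitrary real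
  constant could carry an infinite amount of advice.\<close>

datatype iexp =
    IConst int
  | IRead string iexp
  | IAdd iexp iexp
  | ISub iexp iexp

datatype rexp =
    RConst int
  | RRead string iexp
  | RAdd rexp rexp
  | RSub rexp rexp

datatype bexp =
    ILess iexp iexp
  | RLess rexp rexp
  | BNot bexp
  | BAnd bexp bexp

datatype com =
    Skip
  | IWrite string iexp iexp
  | RWrite string iexp rexp
  | Seq com com
  | If bexp com com
  | While bexp com

record state =
  imem :: "string \<Rightarrow> int \<Rightarrow> int"
  rmem :: "string \<Rightarrow> int \<Rightarrow> real"

primrec ival :: "iexp \<Rightarrow> state \<Rightarrow> int" where
  "ival (IConst k) s = k"
| "ival (IRead x i) s = imem s x (ival i s)"
| "ival (IAdd a b) s = ival a s + ival b s"
| "ival (ISub a b) s = ival a s - ival b s"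

primrec rval :: "rexp \<Rightarrow> state \<Rightarrow> real" where
  "rval (RConst k) s = of_int k"
| "rval (RRead x i) s = rmem s x (ival i s)"
| "rval (RAdd a b) s = rval a s + rval b s"
| "rval (RSub a b) s = rval a s - rval b s"

primrec bval :: "bexp \<Rightarrow> state \<Rightarrow> bool" where
  "bval (ILess a b) s = (ival a s < ival b s)"
| "bval (RLess a b) s = (rval a s < rval b s)"
| "bval (BNot b) s = (\<not> bval b s)"
| "bval (BAnd b c) s = (bval b s \<and> bval c s)"

definition iwrite :: "string \<Rightarrow> int \<Rightarrow> int \<Rightarrow> state \<Rightarrow> state" where
  "iwrite x i v s = s\<lparr>imem := (imem s)(x := (imem s x)(i := v))\<rparr>"

definition rwrite :: "string \<Rightarrow> int \<Rightarrow> real \<Rightarrow> state \<Rightarrow> state" where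
  "rwrite x i v s = s\<lparr>rmem := (rmem s)(x := (rmem s x)(i := v))\<rparr>"

text \<open>\<open>exec c s t s'\<close>: started in \<open>s\<close>, the program \<open>c\<close> halts in \<open>s'\<close> after exactly \<open>t\<close> steps.\<close>

inductive exec :: "com \<Rightarrow> state \<Rightarrow> nat \<Rightarrow> state \<Rightarrow> bool" where
  Skip: "exec Skip s 1 s"
| IWrite: "exec (IWrite x i e) s 1 (iwrite x (ival i s) (ival e s) s)"
| RWrite: "exec (RWrite x i e) s 1 (rwrite x (ival i s) (rval e s) s)"
| Seq: "exec c1 s t1 s' \<Longrightarrow> exec c2 s' t2 s'' \<Longrightarrow> exec (Seq c1 c2) s (t1 + t2) s''"
| IfTrue: "bval b s \<Longrightarrow> exec c1 s t s' \<Longrightarrow> exec (If b c1 c2) s (1 + t) s'"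
| IfFalse: "\<not> bval b s \<Longrightarrow> exec c2 s t s' \<Longrightarrow> exec (If b c1 c2) s (1 + t) s'"
| WhileFalse: "\<not> bval b s \<Longrightarrow> exec (While b c) s 1 s"
| WhileTrue: "bval b s \<Longrightarrow> exec c s t1 s' \<Longrightarrow> exec (While b c) s' t2 s'' \<Longrightarrow>
    exec (While b c) s (1 + t1 + t2) s''"

inductive_cases exec_SkipE: "exec Skip s t s'"
inductive_cases exec_IWriteE: "exec (IWrite x i e) s t s'"
inductive_cases exec_RWriteE: "exec (RWrite x i e) s t s'"
inductive_cases exec_SeqE: "exec (Seq c1 c2) s t s'"
inductive_cases exec_IfE: "exec (If b c1 c2) s t s'"
inductive_cases exec_WhileE: "exec (While b c) s t s'"

lemma exec_deterministic:
  "exec c s t s' \<Longrightarrow> exec c s u s'' \<Longrightarrow> t = u \<and> s' = s''"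
proof (induction arbitrary: u s'' rule: exec.induct)
  case (Seq c1 s t1 s' c2 t2 s2)
  from Seq.prems obtain v1 v2 r where
    "exec c1 s v1 r" "exec c2 r v2 s''" "u = v1 + v2" by (rule exec_SeqE)
  with Seq.IH show ?case by metis
next
  case (WhileTrue b s c t1 s' t2 s2)
  from WhileTrue.prems obtain v1 v2 r where
    "exec c s v1 r" "exec (While b c) r v2 s''" "u = 1 + v1 + v2" by (rule exec_WhileE) (use WhileTrue.hyps in auto)
  with WhileTrue.IH show ?case by metis
next
  case (IfTrue b s c1 t s' c2)
  from IfTrue.prems obtain v where
    "exec c1 s v s''" "u = 1 + v" by (rule exec_IfE) (use IfTrue.hyps in auto)
  with IfTrue.IH show ?case by metis
next
  case (IfFalse b s c2 t s' c1)
  from IfFalse.prems obtain v where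
    "exec c2 s v s''" "u = 1 + v" by (rule exec_IfE) (use IfFalse.hyps in auto)
  with IfFalse.IH show ?case by metis
qed (auto elim: exec_SkipE exec_IWriteE exec_RWriteE exec_WhileE)


section \<open>Input, output and running time\<close>

definition input_array :: "nat \<Rightarrow> (nat \<Rightarrow> 'a::zero) \<Rightarrow> int \<Rightarrow> 'a" where
  "input_array k f i = (if 0 \<le> i \<and> i < int k then f (nat i) else 0)"

text \<open>Finite capacities are nonnegative, so \<open>-1\<close> is free to stand for \<open>\<infinity>\<close>.\<close>

definition enc_cap :: "ereal \<Rightarrow> real" where
  "enc_cap x = (if x = \<infinity> then -1 else real_of_ereal x)"

definition input_state :: "inst \<Rightarrow> state" where
  "input_state I = \<lparr>
     imem = (\<lambda>_ _. 0)
       (''n'' := input_array 1 (\<lambda>_. int (nW I)),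
        ''m'' := input_array 1 (\<lambda>_. int (nP I)),
        ''s'' := input_array (nP I) (\<lambda>p. int (src I p)),
        ''t'' := input_array (nP I) (\<lambda>p. int (snk I p)),
        ''tau'' := input_array (nP I) (\<lambda>p. int (transit I p))),
     rmem = (\<lambda>_ _. 0)
       (''size'' := input_array (nP I) (psize I),
        ''c'' := input_array (nW I) (\<lambda>w. enc_cap (cap I w)),
        ''d+'' := input_array (nW I) (\<lambda>w. enc_cap (carry_out I w)),
        ''d-'' := input_array (nW I) (\<lambda>w. enc_cap (carry_in I w)))\<rparr>"

text \<open>\<open>outputs c I t \<phi>\<close>: on input \<open>I\<close> the program halts after \<open>t\<close> steps with \<open>\<phi>\<close> in the array
  \<open>phi\<close>.\<close>

definition outputs :: "com \<Rightarrow> inst \<Rightarrow> nat \<Rightarrow> (nat \<Rightarrow> nat) \<Rightarrow> bool" where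
  "outputs c I t \<phi> \<longleftrightarrow> (\<exists>s. exec c (input_state I) t s \<and>
     (\<forall>p \<in> products I. imem s ''phi'' (int p) = int (\<phi> p)))"

text \<open>Length of the input, with transit times written in binary and each real number counted as one
  symbol. The sources and sinks have values below \<open>nW I\<close>, so counting their bits as well would
  not affect polynomial bounds.\<close>

definition input_length :: "inst \<Rightarrow> nat" where
  "input_length I = nW I + nP I + (\<Sum>p \<in> products I. floorlog 2 (transit I p))"

text \<open>The summand \<open>1\<close> only matters for the empty instance, on which a bound such as
  \<open>n + m log m\<close> is \<open>0\<close>.\<close>

definition optimally_solvable_in_time :: "(real \<Rightarrow> real \<Rightarrow> real) \<Rightarrow> (inst \<Rightarrow> bool) \<Rightarrow> bool" where
  "optimally_solvable_in_time f K \<longleftrightarrow> (\<exists>c. \<exists>C::real. \<forall>I. valid_inst I \<longrightarrow> K I \<longrightarrow>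
     (\<exists>t \<phi>. outputs c I t \<phi> \<and> real t \<le> C * (1 + f (real (nW I)) (real (nP I))) \<and>
        feasible I \<phi> \<and> completion_time I \<phi> = min_completion_time I))"

definition approximable :: "real \<Rightarrow> (inst \<Rightarrow> bool) \<Rightarrow> bool" where
  "approximable \<alpha> K \<longleftrightarrow> (\<exists>c. \<exists>q :: nat poly. \<forall>I. valid_inst I \<longrightarrow> K I \<longrightarrow>
     (\<exists>t \<phi>. outputs c I t \<phi> \<and> t \<le> poly q (input_length I) \<and>
        feasible I \<phi> \<and> real (completion_time I \<phi>) \<le> \<alpha> * real (min_completion_time I)))"

end

theory Submission
  imports Defs "HOL-Library.Multiset"
begin

text \<open>All algorithms sort the products and then give each product in turn the earliest starting
  time at which both carry constraints leave room for it. Each starting time that is skipped is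
  blocked by a nearly full slot, and slots of any feasible schedule have the same capacity, so
  counting blocked slots bounds the delay in terms of the optimum \<open>T\<close>.

  With both carry constraints and products in decreasing size, a blocked slot is more than half
  full, so fewer than \<open>2 T\<close> slots are blocked on each side; with uniform sizes a blocked
  slot holds as many products as any slot can, so fewer than \<open>T\<close> are. Without carry-in
  constraints the rule is first fit bin packing at each source. In decreasing order of transit time
  only the products starting by \<open>T - \<tau>(p)\<close> in an optimal schedule precede \<open>p\<close>,
  so the bin packing ratio \<open>7/4\<close> of first fit carries over, and for uniform sizes the rule is
  optimal. For uniform transit times the ratio \<open>3/2\<close> of first fit decreasing is available.
  Reversing time interchanges the two carry constraints.\<close>

text \<open>The optimum \<open>T\<close> is unknown to the programs; it enters only through an
  arbitrary feasible schedule, read as a packing of products into time slots. In the one-sided cases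
  the relevant slots are \<open>0\<close> to \<open>T - \<tau>(p)\<close>, one more than the time
  left. Hence the bin packing ratios have to be absolute, without additive constant, and even then
  the extra slot costs \<open>3/4\<close> or \<open>1/2\<close> of a time unit. It is paid for by
  the \<open>3/4 \<tau>(p)\<close> or \<open>1/2 \<tau>(p)\<close> that the ratio grants on the
  transit time without its being needed, since \<open>\<tau>(p) \<ge> 1\<close>.

  Running time is a separate obstacle: transit times are written in binary, so \<open>T\<close> may
  be exponential in the input length. The other products occupy at most \<open>2 m\<close> starting
  times of a given product, so probing slots one by one stays polynomial. For the bound with
  \<open>m log m\<close> even this is too slow; there a slot that is full for one product is full
  for all later ones of the same source, so one current slot per source suffices.\<close>

section \<open>First fit bin packing\<close>

text \<open>At most one index has \<open>L i \<le> r\<close>, because any other index must have a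
  positive surplus. The deficit of that one is smaller than \<open>k\<close> times the surplus of
  each other index, and there are at least \<open>k\<close> others, so the average stays above
  \<open>r\<close>. Needed with \<open>k = 1\<close>, \<open>r = d / 2\<close> and with
  \<open>k = 2\<close>, \<open>r = 2 * d / 3\<close>.\<close>

lemma sum_gt_of_one_small:
  fixes L :: "'a \<Rightarrow> real"
  assumes "finite K" "k \<ge> 1" "k < card K"
    and small: "\<And>i j. i \<in> K \<Longrightarrow> j \<in> K \<Longrightarrow> i \<noteq> j \<Longrightarrow> L i \<le> r \<Longrightarrow> r - L i < real k * (L j - r)"
  shows "r * real (card K) < sum L K"
proof (cases "\<exists>i\<in>K. L i \<le> r")
  case False
  have "K \<noteq> {}" using assms by auto
  with False have "sum (\<lambda>_. r) K < sum L K"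
    by (intro sum_strict_mono assms) auto
  then show ?thesis by (simp add: mult.commute)
next
  case True
  then obtain i where i: "i \<in> K" "L i \<le> r" by blast
  define e where "e = (r - L i) / real k"
  have "e \<ge> 0" using i assms by (simp add: e_def)
  have ek: "real k * e = r - L i" using assms by (simp add: e_def)
  have ge: "r + e < L j" if "j \<in> K - {i}" for j
  proof -
    have "real k * e < real k * (L j - r)" using small[of i j] i that ek by auto
    then show ?thesis using assms by (simp add: mult_less_cancel_left)
  qed
  have card: "card (K - {i}) = card K - 1" using i by simp
  have "K - {i} \<noteq> {}" using assms card by (metis One_nat_def card.empty diff_is_0_eq
    le_less_trans not_le)
  then have "sum (\<lambda>_. r + e) (K - {i}) < sum L (K - {i})"
    using ge assms by (intro sum_strict_mono) auto
  then have "real (card K - 1) * (r + e) < sum L (K - {i})" by (simp add: card)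
  moreover have "real k * e \<le> real (card K - 1) * e"
    using assms \<open>e \<ge> 0\<close> by (intro mult_right_mono) auto
  moreover have "sum L K = L i + sum L (K - {i})" using i assms by (simp add: sum.remove)
  moreover have "real (card K - 1) = real (card K) - 1" using assms by auto
  ultimately show ?thesis using ek by (simp add: algebra_simps)
qed

section \<open>Volume and conflict bounds for an arbitrary packing\<close>

definition load :: "('a \<Rightarrow> real) \<Rightarrow> 'a set \<Rightarrow> ('a \<Rightarrow> nat) \<Rightarrow> nat \<Rightarrow> real" where
  "load s A f \<theta> = (\<Sum>q | q \<in> A \<and> f q = \<theta>. s q)"

lemma sum_load:
  assumes "finite A" "finite X"
  shows "(\<Sum>\<theta>\<in>X. load s A f \<theta>) = (\<Sum>q | q \<in> A \<and> f q \<in> X. s q)"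
proof -
  have "(\<Sum>\<theta>\<in>X. load s A f \<theta>) = sum s (\<Union>\<theta>\<in>X. {q \<in> A. f q = \<theta>})"
    unfolding load_def using assms by (subst sum.UNION_disjoint) auto
  also have "(\<Union>\<theta>\<in>X. {q \<in> A. f q = \<theta>}) = {q \<in> A. f q \<in> X}" by auto
  finally show ?thesis .
qed

text \<open>\<open>g\<close> stands for a feasible schedule, in the end an optimal one, whose slots
  are the bins in \<open>G\<close>. It yields two lower bounds on \<open>card G\<close>: by total
  size (\<open>total_le\<close>) and by items no two of which can share a bin
  (\<open>card_le_if_conflicting\<close>). The assignment compared with \<open>g\<close> stays
  outside the locale, so the same facts serve for starting times and for arrival times.\<close>

locale packing =
  fixes A :: "'a set" and s :: "'a \<Rightarrow> real" and d :: real and g :: "'a \<Rightarrow> nat" and G :: "nat set"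
  assumes fin_A: "finite A" and size_nonneg: "\<And>q. q \<in> A \<Longrightarrow> 0 \<le> s q"
    and size_le: "\<And>q. q \<in> A \<Longrightarrow> s q \<le> d"
    and fin_G: "finite G" and packs_into: "g ` A \<subseteq> G"
    and load_le: "\<And>\<theta>. load s A g \<theta> \<le> d"
begin

lemma load_nonneg: "X \<subseteq> A \<Longrightarrow> 0 \<le> load s X f \<theta>"
  unfolding load_def by (intro sum_nonneg) (use size_nonneg in auto)

lemma load_mono: "X \<subseteq> A \<Longrightarrow> load s X f \<theta> \<le> load s A f \<theta>"
  unfolding load_def by (intro sum_mono2) (use size_nonneg fin_A in auto)

lemma total_le: "sum s A \<le> d * real (card G)"
proof -
  have "sum s A = (\<Sum>\<theta>\<in>G. load s A g \<theta>)"
    using packs_into by (subst sum_load) (auto intro: sum.cong simp: fin_A fin_G)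
  also have "\<dots> \<le> (\<Sum>\<theta>\<in>G. d)" by (intro sum_mono load_le)
  finally show ?thesis by (simp add: mult.commute)
qed

lemma sum_load_le_total: "finite X \<Longrightarrow> (\<Sum>\<theta>\<in>X. load s A f \<theta>) \<le> sum s A"
  by (subst sum_load) (auto simp: fin_A size_nonneg intro!: sum_mono2)

lemma card_le_if_conflicting:
  assumes "X \<subseteq> A" and confl: "\<And>p q. p \<in> X \<Longrightarrow> q \<in> X \<Longrightarrow> p \<noteq> q \<Longrightarrow> d < s p + s q"
  shows "card X \<le> card G"
proof (rule card_inj_on_le[OF _ _ fin_G])
  show "g ` X \<subseteq> G" using assms(1) packs_into by blast
  show "inj_on g X"
  proof (rule inj_onI, rule ccontr)
    fix p q assume pq: "p \<in> X" "q \<in> X" "g p = g q" "p \<noteq> q"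
    have "s p + s q = sum s {p, q}" using pq by simp
    also have "\<dots> \<le> load s A g (g p)"
      unfolding load_def using assms(1) pq fin_A size_nonneg by (intro sum_mono2) auto
    finally show False using confl[of p q] pq load_le[of "g p"] by simp
  qed
qed

text \<open>A blocked slot is nonempty, since \<open>p\<close> alone would fit, and it contains an
  item at least as large as \<open>p\<close>. So its load exceeds \<open>d - s p\<close> and is at
  least \<open>s p\<close>; adding the two shows that it exceeds \<open>d / 2\<close>. The volume is
  at most \<open>d * card G\<close>, which gives the factor 2.\<close>

lemma half_full:
  assumes "p \<in> A" "finite X" and B: "B \<subseteq> A" and "\<And>q. q \<in> B \<Longrightarrow> s p \<le> s q"
    and blocked: "\<And>\<theta>. \<theta> \<in> X \<Longrightarrow> d < load s B f \<theta> + s p"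
  shows "card X < 2 * card G"
proof (cases "X = {}")
  case True
  have "G \<noteq> {}" using packs_into \<open>p \<in> A\<close> by auto
  then show ?thesis using True fin_G by (simp add: card_gt_0_iff)
next
  case False
  have half: "d / 2 < load s A f \<theta>" if "\<theta> \<in> X" for \<theta>
  proof -
    have b: "d < load s B f \<theta> + s p" using blocked that .
    have "load s B f \<theta> > 0" using b size_le[OF \<open>p \<in> A\<close>] by simp
    then obtain q where q: "q \<in> B" "f q = \<theta>"
      unfolding load_def by (metis (mono_tags, lifting) less_irrefl mem_Collect_eq sum.neutral)
    have "s q \<le> load s B f \<theta>" unfolding load_def
      using q B size_nonneg finite_subset[OF B fin_A] by (intro member_le_sum) auto
    then have "s p \<le> load s B f \<theta>" using assms(4)[OF q(1)] by simp
    then show ?thesis using b load_mono[OF B, of f \<theta>] by simp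
  qed
  have "(\<Sum>\<theta>\<in>X. d / 2) < (\<Sum>\<theta>\<in>X. load s A f \<theta>)"
    using half False \<open>finite X\<close> by (intro sum_strict_mono) auto
  also have "\<dots> \<le> d * real (card G)" using sum_load_le_total[OF \<open>finite X\<close>] total_le by (rule order_trans)
  finally have *: "d * real (card X) < d * (2 * real (card G))" by (simp add: mult.commute)
  have "0 \<le> d" using size_nonneg[OF \<open>p \<in> A\<close>] size_le[OF \<open>p \<in> A\<close>] by simp
  with * have "real (card X) < 2 * real (card G)" by (simp add: mult_less_cancel_left)
  then show ?thesis by linarith
qed

text \<open>Let \<open>k\<close> be the least number of items in a blocked slot. Since
  \<open>k + 1\<close> items of the common size exceed \<open>d\<close>, no bin of \<open>g\<close>
  holds more than \<open>k\<close>, so \<open>A\<close> has at most \<open>k * card G\<close> items.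
  The blocked slots hold at least \<open>k * card X\<close> items of \<open>B\<close>, which misses
  \<open>p\<close>; with \<open>card G \<le> card X\<close> this would give
  \<open>card A \<le> card B\<close>.\<close>

lemma uniform_full:
  assumes "p \<in> A" "finite X" and B: "B \<subseteq> A" "p \<notin> B" and unif: "\<And>q. q \<in> A \<Longrightarrow> s q = s p"
    and blocked: "\<And>\<theta>. \<theta> \<in> X \<Longrightarrow> d < load s B f \<theta> + s p"
  shows "card X < card G"
proof (rule ccontr)
  assume "\<not> ?thesis"
  then have KX: "card G \<le> card X" by simp
  have "G \<noteq> {}" using packs_into \<open>p \<in> A\<close> by auto
  then have "card G > 0" using fin_G by (simp add: card_gt_0_iff)
  with KX have "X \<noteq> {}" by auto
  have finB: "finite B" using B fin_A finite_subset by auto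
  define c where "c \<theta> = card {q \<in> B. f q = \<theta>}" for \<theta>
  define e where "e \<theta> = card {q \<in> A. g q = \<theta>}" for \<theta>
  have lc: "load s B f \<theta> = real (c \<theta>) * s p" for \<theta>
    unfolding load_def c_def using unif B by (subst sum.cong[OF refl, of _ _ "\<lambda>_. s p"]) auto
  have le: "load s A g \<theta> = real (e \<theta>) * s p" for \<theta>
    unfolding load_def e_def using unif by (subst sum.cong[OF refl, of _ _ "\<lambda>_. s p"]) auto
  define k where "k = Min (c ` X)"
  have kc: "k \<le> c \<theta>" if "\<theta> \<in> X" for \<theta> unfolding k_def using that \<open>finite X\<close> by simp
  obtain x where x: "x \<in> X" "k = c x"
    using Min_in[of "c ` X"] \<open>X \<noteq> {}\<close> \<open>finite X\<close> unfolding k_def by fastforce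
  have "e \<theta> \<le> k" for \<theta>
  proof -
    have "real (e \<theta>) * s p < real (Suc k) * s p"
      using load_le[of \<theta>] blocked[OF x(1)] x(2) by (simp add: le lc algebra_simps)
    then have "e \<theta> < Suc k" using size_nonneg[OF \<open>p \<in> A\<close>]
      by (metis mult_right_mono not_le of_nat_mono)
    then show ?thesis by simp
  qed
  then have "(\<Sum>\<theta>\<in>G. e \<theta>) \<le> card G * k" using sum_bounded_above[of G e k] by simp
  moreover have "(\<Sum>\<theta>\<in>G. e \<theta>) = card A"
  proof -
    have "(\<Union>\<theta>\<in>G. {q \<in> A. g q = \<theta>}) = A" using packs_into by auto
    then show ?thesis unfolding e_def using fin_A fin_G
      by (subst card_UN_disjoint[symmetric]) auto
  qed
  moreover have "card X * k \<le> (\<Sum>\<theta>\<in>X. c \<theta>)" using sum_bounded_below[of X k c] kc by simp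
  moreover have "(\<Sum>\<theta>\<in>X. c \<theta>) \<le> card B"
  proof -
    have "(\<Sum>\<theta>\<in>X. c \<theta>) = card (\<Union>\<theta>\<in>X. {q \<in> B. f q = \<theta>})"
      unfolding c_def using finB \<open>finite X\<close> by (subst card_UN_disjoint) auto
    also have "\<dots> \<le> card B" using finB by (intro card_mono) auto
    finally show ?thesis .
  qed
  moreover have "card B < card A" using B \<open>p \<in> A\<close> fin_A by (intro psubset_card_mono) auto
  moreover have "card G * k \<le> card X * k" using KX by simp
  ultimately show False by linarith
qed

end

section \<open>Absolute ratios of first fit and first fit decreasing\<close>

locale first_fit = packing A s d g G
  for A :: "'a set" and s :: "'a \<Rightarrow> real" and d :: real and g :: "'a \<Rightarrow> nat" and G :: "nat set" +
  fixes f pos :: "'a \<Rightarrow> nat"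
  assumes earlier_full:
    "\<And>q \<theta>. q \<in> A \<Longrightarrow> \<theta> < f q \<Longrightarrow> d < load s {x \<in> A. pos x < pos q} f \<theta> + s q"
begin

abbreviation L :: "nat \<Rightarrow> real" where "L \<equiv> load s A f"

lemma earlier_load: "q \<in> A \<Longrightarrow> \<theta> < f q \<Longrightarrow> d < L \<theta> + s q"
  using earlier_full[of q \<theta>] load_mono[of "{x \<in> A. pos x < pos q}" f \<theta>] by fastforce

text \<open>An empty bin would have taken \<open>q\<close>, whose size is at most \<open>d\<close>.
  Hence no bin before the one of \<open>q\<close> was empty when \<open>q\<close> arrived.\<close>

lemma earlier_item:
  assumes "q \<in> A" "\<theta> < f q"
  obtains x where "x \<in> A" "pos x < pos q" "f x = \<theta>"
proof -
  have "load s {x \<in> A. pos x < pos q} f \<theta> \<noteq> 0"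
    using earlier_full[OF assms] size_le[OF assms(1)] by fastforce
  then obtain x where "x \<in> {x \<in> A. pos x < pos q}" "f x = \<theta>"
    unfolding load_def by (metis (mono_tags, lifting) mem_Collect_eq sum.neutral)
  then show ?thesis using that by blast
qed

lemma size_le_L: "q \<in> A \<Longrightarrow> s q \<le> L (f q)"
  unfolding load_def using fin_A size_nonneg by (intro member_le_sum) auto

lemma bin_nonempty:
  assumes "p \<in> A" "\<theta> \<le> f p"
  obtains q where "q \<in> A" "f q = \<theta>"
  using assms earlier_item[of p \<theta>] by (cases "\<theta> = f p") auto

lemma loads_gt:
  assumes "p \<in> A" "\<theta>' \<le> f p" "\<theta> < \<theta>'"
  shows "d < L \<theta> + L \<theta>'"
proof -
  obtain q where "q \<in> A" "f q = \<theta>'" using bin_nonempty assms by metis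
  then show ?thesis using earlier_load[of q \<theta>] size_le_L[of q] assms by auto
qed

text \<open>Both items were refused by bin \<open>\<theta>\<close>, so each is larger than
  \<open>d - L \<theta>\<close>.\<close>

lemma loads_gt_of_two:
  assumes "q \<in> A" "q' \<in> A" "q \<noteq> q'" "f q = \<theta>'" "f q' = \<theta>'" "\<theta> < \<theta>'"
  shows "2 * d < 2 * L \<theta> + L \<theta>'"
proof -
  have "s q + s q' = sum s {q, q'}" using assms by simp
  also have "\<dots> \<le> L \<theta>'" unfolding load_def using assms fin_A size_nonneg by (intro sum_mono2) auto
  finally show ?thesis using earlier_load[of q \<theta>] earlier_load[of q' \<theta>] assms by auto
qed

text \<open>The \<open>N\<close> bins up to that of \<open>p\<close> are split into
  \<open>N1\<close>, with a single item, and \<open>N2\<close>, with at least two. Single items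
  conflict pairwise, so \<open>card N1 \<le> B\<close>. Bins in \<open>N1\<close> are more than half
  full on average and those in \<open>N2\<close> more than two thirds full, so by volume
  \<open>card N1 / 2 + 2 / 3 * card N2 < B\<close>. Adding \<open>3 / 2\<close> times the volume
  bound and \<open>1 / 4\<close> times the first bound gives \<open>7 / 4 * B\<close>. The averages
  fail for very few bins, which are treated apart.\<close>

theorem first_fit_ratio:
  assumes p: "p \<in> A"
  shows "4 * (f p + 1) \<le> 7 * card G"
proof -
  define N where "N = Suc (f p)"
  define B where "B = card G"
  have "G \<noteq> {}" using packs_into p by auto
  then have "B \<ge> 1" using fin_G by (simp add: card_gt_0_iff B_def Suc_le_eq)
  define bin where "bin \<theta> = {q \<in> A. f q = \<theta>}" for \<theta>
  have finbin: "finite (bin \<theta>)" for \<theta> unfolding bin_def using fin_A by simp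
  have binne: "bin \<theta> \<noteq> {}" if "\<theta> < N" for \<theta>
    using bin_nonempty[OF p, of \<theta>] that unfolding bin_def N_def by fastforce
  define N1 where "N1 = {\<theta> \<in> {..<N}. card (bin \<theta>) = 1}"
  define N2 where "N2 = {..<N} - N1"
  have fin12: "finite N1" "finite N2" unfolding N1_def N2_def by auto
  have sub: "N1 \<subseteq> {..<N}" "N2 \<subseteq> {..<N}" unfolding N1_def N2_def by auto
  have cN: "card N1 + card N2 = N"
  proof -
    have "card (N1 \<union> N2) = card N1 + card N2"
      by (rule card_Un_disjoint) (auto simp: fin12 N2_def)
    moreover have "N1 \<union> N2 = {..<N}" unfolding N1_def N2_def by auto
    ultimately show ?thesis by simp
  qed
  have pair: "d < L \<theta> + L \<theta>'" if "\<theta> < N" "\<theta>' < N" "\<theta> \<noteq> \<theta>'" for \<theta> \<theta>'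
    using loads_gt[OF p, of \<theta>' \<theta>] loads_gt[OF p, of \<theta> \<theta>'] that unfolding N_def
    by (cases "\<theta> < \<theta>'") auto
  have half: "d / 2 * real (card K) < sum L K" if "K \<subseteq> {..<N}" "card K \<ge> 2" for K
  proof (rule sum_gt_of_one_small[of _ 1])
    fix i j assume "i \<in> K" "j \<in> K" "i \<noteq> j" "L i \<le> d / 2"
    then show "d / 2 - L i < real 1 * (L j - d / 2)" using pair[of i j] that(1) by (auto simp: subset_eq)
  qed (use that finite_subset in auto)
  have two: "2 * d < 2 * L \<theta> + L \<theta>'" if "\<theta>' \<in> N2" "\<theta> < \<theta>'" for \<theta> \<theta>'
  proof -
    have "card (bin \<theta>') \<noteq> 1" "\<theta>' < N" using that unfolding N2_def N1_def by auto
    moreover have "card (bin \<theta>') \<noteq> 0" using binne[OF \<open>\<theta>' < N\<close>] finbin by auto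
    ultimately have "2 \<le> card (bin \<theta>')" by linarith
    then obtain q q' where "q \<in> bin \<theta>'" "q' \<in> bin \<theta>'" "q \<noteq> q'"
      by (metis One_nat_def card_le_Suc0_iff_eq finbin not_less_eq_eq numeral_2_eq_2)
    then show ?thesis using loads_gt_of_two[of q q' \<theta>' \<theta>] that unfolding bin_def by auto
  qed
  \<comment> \<open>Let \<open>i\<close> be a bin filled to at most two thirds. If \<open>j\<close>
    comes before \<open>i\<close>, then \<open>2 * d < 2 * L j + L i\<close> says that the deficit
    of \<open>i\<close> is below twice the surplus of \<open>j\<close>; if \<open>j\<close> comes
    later, its surplus is larger still. The factor 2 is why three bins are required.\<close>
  have twothirds: "2 * d / 3 * real (card N2) < sum L N2" if "card N2 \<ge> 3"
  proof (rule sum_gt_of_one_small[of _ 2])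
    fix i j assume ij: "i \<in> N2" "j \<in> N2" "i \<noteq> j" "L i \<le> 2 * d / 3"
    show "2 * d / 3 - L i < real 2 * (L j - 2 * d / 3)"
    proof (cases "i < j")
      case True
      then show ?thesis using two[OF ij(2) True] ij(4) by (simp add: field_simps)
    next
      case False
      then show ?thesis using two[OF ij(1), of j] ij(3) by (simp add: field_simps)
    qed
  qed (use fin12 that in auto)
  have tot: "sum L {..<N} \<le> d * real B"
    unfolding B_def using sum_load_le_total[of "{..<N}" f] total_le by auto
  have split: "sum L {..<N} = sum L N1 + sum L N2"
    unfolding N2_def using sub(1) by (subst sum.subset_diff[of N1]) auto
  have Lnn: "0 \<le> sum L K" for K by (intro sum_nonneg load_nonneg) auto
  \<comment> \<open>If \<open>d = 0\<close>, all sizes vanish and \<open>p\<close> would fit into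
    bin \<open>0\<close>.\<close>
  have dpos: "d > 0" if "N \<ge> 2"
  proof -
    have "0 < f p" using that N_def by simp
    have "s p \<ge> 0" using size_nonneg[OF p] .
    then have "d \<ge> 0" using size_le[OF p] by simp
    moreover have "d \<noteq> 0"
    proof
      assume "d = 0"
      then have "s q = 0" if "q \<in> A" for q using size_nonneg[OF that] size_le[OF that] by simp
      then have "L 0 = 0" "s p = 0" unfolding load_def using p by auto
      then show False using earlier_load[OF p \<open>0 < f p\<close>] \<open>d = 0\<close> by simp
    qed
    ultimately show ?thesis by simp
  qed
  have N1B: "card N1 \<le> B"
  proof -
    define h where "h \<theta> = (SOME q. q \<in> bin \<theta>)" for \<theta>
    have h: "h \<theta> \<in> A" "f (h \<theta>) = \<theta>" "L \<theta> = s (h \<theta>)" if "\<theta> \<in> N1" for \<theta>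
    proof -
      have "card (bin \<theta>) = 1" using that unfolding N1_def by simp
      then obtain q where q: "bin \<theta> = {q}" using card_1_singletonE by blast
      then have "h \<theta> = q" unfolding h_def by simp
      with q show "h \<theta> \<in> A" "f (h \<theta>) = \<theta>" unfolding bin_def by auto
      show "L \<theta> = s (h \<theta>)" using q \<open>h \<theta> = q\<close> unfolding load_def bin_def by simp
    qed
    have "inj_on h N1" using h(2) by (metis inj_onI)
    then have "card N1 = card (h ` N1)" by (simp add: card_image)
    also have "\<dots> \<le> B" unfolding B_def
    proof (rule card_le_if_conflicting)
      fix x y assume "x \<in> h ` N1" "y \<in> h ` N1" "x \<noteq> y"
      then obtain \<theta> \<theta>' where "\<theta> \<in> N1" "\<theta>' \<in> N1" "x = h \<theta>" "y = h \<theta>'" "\<theta> \<noteq> \<theta>'" by blast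
      then show "d < s x + s y" using pair[of \<theta> \<theta>'] h sub by auto
    qed (use h in auto)
    finally show ?thesis .
  qed
  have "N < 2 * B" if "N \<ge> 2"
  proof -
    have "d / 2 * real N < d * real B" using half[of "{..<N}"] that tot by simp
    then show ?thesis using dpos[OF that] by simp
  qed
  then have N2B: "N < 2 * B" using \<open>B \<ge> 1\<close> by linarith
  have "4 * N \<le> 7 * B"
  proof (cases "card N2 \<le> 2")
    case True
    \<comment> \<open>Together with \<open>N \<le> 2 * B - 1\<close> this suffices: one third of the
      first bound and two thirds of the second give \<open>N \<le> 5 / 3 * B\<close>.\<close>
    then have "N \<le> B + 2" using cN N1B by linarith
    then show ?thesis using N2B by linarith
  next
    case False
    then have d: "d > 0" using dpos cN by linarith
    show ?thesis
    proof (cases "card N1 \<ge> 2")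
      case True
      have "d / 2 * real (card N1) + 2 * d / 3 * real (card N2) < d * real B"
        using half[OF sub(1) True] twothirds False split tot by simp
      then have "d * (real (card N1) / 2 + 2 / 3 * real (card N2)) < d * real B"
        by (simp add: algebra_simps)
      then have "real (card N1) / 2 + 2 / 3 * real (card N2) < real B" using d by simp
      then show ?thesis using N1B cN by linarith
    next
      case N1: False
      have "2 * d / 3 * real (card N2) < d * real B"
        using twothirds False split tot Lnn[of N1] by simp
      then have "d * (2 / 3 * real (card N2)) < d * real B"
        by (simp add: algebra_simps)
      then have "2 / 3 * real (card N2) < real B" using d by simp
      then have "2 * card N2 < 3 * B" by linarith
      \<comment> \<open>Here \<open>2 * N \<le> 3 * B + 1\<close>, and adding
        \<open>N \<le> 2 * B - 1\<close> again gives \<open>N \<le> 5 / 3 * B\<close>.\<close>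
      then show ?thesis using N1 cN N2B by linarith
    qed
  qed
  then show ?thesis unfolding N_def B_def by simp
qed

text \<open>The bin with index \<open>B\<close>, the first beyond the number of bins of
  \<open>g\<close>, decides. If it contains an item above \<open>d / 2\<close>, so do all earlier
  bins, which gives \<open>B + 1\<close> pairwise conflicting items. Otherwise all items from there
  on are at most \<open>d / 2\<close>; there are at least \<open>B\<close> of them if the claim
  fails, and each was refused by the least filled of the first \<open>B\<close> bins. Then the
  volume exceeds \<open>B\<close> full bins.\<close>

theorem first_fit_decreasing_ratio:
  assumes p: "p \<in> A"
    and decr: "\<And>x y. x \<in> A \<Longrightarrow> y \<in> A \<Longrightarrow> pos x < pos y \<Longrightarrow> s y \<le> s x"
  shows "2 * (f p + 1) \<le> 3 * card G"
proof (rule ccontr)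
  assume neg: "\<not> ?thesis"
  define B where "B = card G"
  have lt: "3 * B < 2 * (f p + 1)" using neg B_def by simp
  have "G \<noteq> {}" using packs_into p by auto
  then have "B \<ge> 1" using fin_G by (simp add: card_gt_0_iff B_def Suc_le_eq)
  have "B \<le> f p" using lt \<open>B \<ge> 1\<close> by arith
  show False
  proof (cases "\<exists>q\<in>A. f q = B \<and> d / 2 < s q")
    case True
    then obtain q where q: "q \<in> A" "f q = B" "d / 2 < s q" by blast
    \<comment> \<open>The item already in bin \<open>\<theta>\<close> when \<open>q\<close> arrived
      precedes \<open>q\<close>, hence is at least as large.\<close>
    have "\<exists>x. x \<in> A \<and> f x = \<theta> \<and> d / 2 < s x" if le: "\<theta> \<le> B" for \<theta>
    proof (cases "\<theta> = B")
      case False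
      then obtain x where x: "x \<in> A" "pos x < pos q" "f x = \<theta>"
        using earlier_item[of q \<theta>] q le by auto
      then show ?thesis using decr[of x q] q by fastforce
    qed (use q in blast)
    then obtain h where h: "\<And>\<theta>. \<theta> \<le> B \<Longrightarrow> h \<theta> \<in> A \<and> f (h \<theta>) = \<theta> \<and> d / 2 < s (h \<theta>)" by metis
    have "inj_on h {..B}" using h by (metis atMost_iff inj_onI)
    then have "Suc B = card (h ` {..B})" by (simp add: card_image)
    also have "\<dots> \<le> card G"
    proof (rule card_le_if_conflicting)
      fix x y assume "x \<in> h ` {..B}" "y \<in> h ` {..B}"
      then have "d / 2 < s x" "d / 2 < s y" using h by auto
      then show "d < s x + s y" by simp
    qed (use h in auto)
    finally show False using B_def by simp
  next
    case False
    have small: "s q \<le> d / 2" if q: "q \<in> A" "B \<le> f q" for q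
    proof (cases "f q = B")
      case True
      then show ?thesis using False that by force
    next
      case neq: False
      then obtain x where x: "x \<in> A" "pos x < pos q" "f x = B"
        using earlier_item[of q B] q by auto
      then show ?thesis using decr[of x q] False that by force
    qed
    define bin where "bin \<theta> = {q \<in> A. f q = \<theta>}" for \<theta>
    have finbin: "finite (bin \<theta>)" for \<theta> unfolding bin_def using fin_A by simp
    \<comment> \<open>A lone item of size at most \<open>d / 2\<close> would have left room for
      \<open>p\<close>, which is also at most \<open>d / 2\<close>.\<close>
    have two: "2 \<le> card (bin \<theta>)" if th: "B \<le> \<theta>" "\<theta> < f p" for \<theta>
    proof (rule ccontr)
      assume "\<not> ?thesis"
      then have "card (bin \<theta>) \<le> Suc 0" by simp
      moreover obtain x where x: "x \<in> bin \<theta>" using earlier_item[OF p th(2)] unfolding bin_def by blast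
      ultimately have "bin \<theta> = {x}" using finbin by (auto simp: card_le_Suc0_iff_eq)
      then have "L \<theta> = s x" unfolding load_def bin_def by simp
      moreover have "s x \<le> d / 2" using x small[of x] th unfolding bin_def by simp
      moreover have "s p \<le> d / 2" using small[of p] p \<open>B \<le> f p\<close> by simp
      ultimately show False using earlier_load[OF p th(2)] by simp
    qed
    define X where "X = {q \<in> A. B \<le> f q}"
    have finX: "finite X" unfolding X_def using fin_A by simp
    have "2 * (f p - B) \<le> (\<Sum>\<theta>\<in>{B..<f p}. card (bin \<theta>))"
      using sum_bounded_below[of "{B..<f p}" 2 "\<lambda>\<theta>. card (bin \<theta>)"] two by simp
    also have "\<dots> = card (\<Union>\<theta>\<in>{B..<f p}. bin \<theta>)"
      using finbin by (subst card_UN_disjoint) (auto simp: bin_def)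
    also have "\<dots> < card X"
    proof (rule psubset_card_mono[OF finX])
      show "(\<Union>\<theta>\<in>{B..<f p}. bin \<theta>) \<subset> X"
      proof
        show "(\<Union>\<theta>\<in>{B..<f p}. bin \<theta>) \<subseteq> X" unfolding bin_def X_def by auto
        have "p \<in> X" "p \<notin> (\<Union>\<theta>\<in>{B..<f p}. bin \<theta>)" using p \<open>B \<le> f p\<close> unfolding bin_def X_def by auto
        then show "(\<Union>\<theta>\<in>{B..<f p}. bin \<theta>) \<noteq> X" by blast
      qed
    qed
    \<comment> \<open>Two items in each of the \<open>f p - B\<close> bins and \<open>p\<close>
      itself make \<open>2 * (f p - B) + 1\<close> items, which is at least \<open>B\<close> because
      \<open>3 * B < 2 * (f p + 1)\<close>.\<close>
    finally have cX: "B \<le> card X" using lt \<open>B \<le> f p\<close> by arith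
    define l where "l = Min (L ` {..<B})"
    have "{..<B} \<noteq> {}" using \<open>B \<ge> 1\<close> by (simp add: lessThan_empty_iff)
    then have lin: "l \<in> L ` {..<B}" unfolding l_def by (intro Min_in) auto
    have ll: "l \<le> L \<theta>" if "\<theta> < B" for \<theta> unfolding l_def using that by simp
    obtain \<theta> where \<theta>: "\<theta> < B" "l = L \<theta>" using lin by auto
    have sX: "d - l < s q" if "q \<in> X" for q
      using \<theta> earlier_load[of q \<theta>] that unfolding X_def by auto
    have "p \<in> X" unfolding X_def using p \<open>B \<le> f p\<close> by simp
    then have "X \<noteq> {}" by blast
    then have gt: "real (card X) * (d - l) < sum s X"
      using sum_strict_mono[OF finX, of "\<lambda>_. d - l" s] sX by simp
    have "real B * (d - l) < sum s X"
    proof (cases "d - l \<ge> 0")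
      case True
      then have "real B * (d - l) \<le> real (card X) * (d - l)" using cX by (intro mult_right_mono) auto
      then show ?thesis using gt by simp
    next
      \<comment> \<open>The locale bounds only the loads of \<open>g\<close>, so \<open>l\<close>
        may exceed \<open>d\<close>; passing from \<open>card X\<close> to \<open>B\<close> then
        needs a sign argument instead of monotonicity.\<close>
      case False
      then have "real B * (d - l) < 0" using \<open>B \<ge> 1\<close> by (simp add: mult_pos_neg)
      moreover have "0 \<le> sum s X" unfolding X_def using size_nonneg by (intro sum_nonneg) auto
      ultimately show ?thesis by simp
    qed
    moreover have "real B * l \<le> sum L {..<B}"
      using sum_bounded_below[of "{..<B}" l L] ll by simp
    moreover have "sum L {..<B} + sum s X = sum s A"
    proof -
      have "sum L {..<B} = (\<Sum>q | q \<in> A \<and> f q < B. s q)" using sum_load[OF fin_A, of "{..<B}"] by simp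
      also have "\<dots> + sum s X = sum s ({q \<in> A. f q < B} \<union> X)"
        unfolding X_def using fin_A by (subst sum.union_disjoint) auto
      also have "{q \<in> A. f q < B} \<union> X = A" unfolding X_def by auto
      finally show ?thesis .
    qed
    \<comment> \<open>The first \<open>B\<close> bins hold at least \<open>B * l\<close> and the
      other items more than \<open>B * (d - l)\<close>, together more than
      \<open>d * B\<close>.\<close>
    ultimately show False using total_le unfolding B_def[symmetric] by (simp add: algebra_simps)
  qed
qed

end

section \<open>Greedy schedules\<close>

definition before :: "inst \<Rightarrow> (nat \<Rightarrow> nat) \<Rightarrow> nat \<Rightarrow> nat set" where
  "before I pos p = {q \<in> products I. pos q < pos p}"

definition fits_out :: "inst \<Rightarrow> (nat \<Rightarrow> nat) \<Rightarrow> nat set \<Rightarrow> nat \<Rightarrow> nat \<Rightarrow> bool" where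
  "fits_out I \<phi> X p \<theta> \<longleftrightarrow>
     ereal (load (psize I) {q \<in> X. src I q = src I p} \<phi> \<theta> + psize I p) \<le> carry_out I (src I p)"

definition fits_in :: "inst \<Rightarrow> (nat \<Rightarrow> nat) \<Rightarrow> nat set \<Rightarrow> nat \<Rightarrow> nat \<Rightarrow> bool" where
  "fits_in I \<phi> X p \<theta> \<longleftrightarrow>
     ereal (load (psize I) {q \<in> X. snk I q = snk I p} (\<lambda>q. \<phi> q + transit I q) (\<theta> + transit I p)
       + psize I p) \<le> carry_in I (snk I p)"

text \<open>A property of a finished schedule rather than a recursion over the order. It depends on
  \<open>\<phi>\<close> only at \<open>p\<close> and at the products before \<open>p\<close>, so a
  partial schedule can be extended without spoiling it, and two different programs can be verified
  against it.\<close>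

definition greedy_at :: "inst \<Rightarrow> (nat \<Rightarrow> nat) \<Rightarrow> (nat \<Rightarrow> nat) \<Rightarrow> nat \<Rightarrow> bool" where
  "greedy_at I pos \<phi> p \<longleftrightarrow>
     fits_out I \<phi> (before I pos p) p (\<phi> p) \<and> fits_in I \<phi> (before I pos p) p (\<phi> p) \<and>
     (\<forall>\<theta><\<phi> p. \<not> (fits_out I \<phi> (before I pos p) p \<theta> \<and> fits_in I \<phi> (before I pos p) p \<theta>))"

definition greedy :: "inst \<Rightarrow> (nat \<Rightarrow> nat) \<Rightarrow> (nat \<Rightarrow> nat) \<Rightarrow> bool" where
  "greedy I pos \<phi> \<longleftrightarrow> inj_on pos (products I) \<and> (\<forall>p\<in>products I. greedy_at I pos \<phi> p)"

definition decreasing :: "inst \<Rightarrow> (nat \<Rightarrow> real) \<Rightarrow> (nat \<Rightarrow> nat) \<Rightarrow> bool" where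
  "decreasing I key pos \<longleftrightarrow>
     (\<forall>p\<in>products I. \<forall>q\<in>products I. pos p < pos q \<longrightarrow> key q \<le> key p)"

lemma finite_products [simp]: "finite (products I)"
  by (simp add: products_def)

lemma P_out_subset: "P_out I w \<subseteq> products I" and P_in_subset: "P_in I w \<subseteq> products I"
  by (auto simp: P_out_def P_in_def)

lemma finite_P [simp]: "finite (P_out I w)" "finite (P_in I w)"
  using P_out_subset P_in_subset finite_products finite_subset by metis+

lemma valid_instD:
  assumes "valid_inst I" "p \<in> products I"
  shows "0 \<le> psize I p" "src I p \<in> warehouses I" "snk I p \<in> warehouses I" "0 < transit I p"
    "ereal (psize I p) \<le> carry_out I (src I p)" "ereal (psize I p) \<le> carry_in I (snk I p)"
  using assms unfolding valid_inst_def by (auto simp: P_out_def P_in_def)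

text \<open>The test made for the element with the largest position already covers the whole sum.
  This turns the insertion tests of the greedy rule into the slot constraints of
  \<open>feasible\<close>.\<close>

lemma sum_le_by_last:
  fixes pos :: "'a \<Rightarrow> nat"
  assumes "finite X" "inj_on pos X" "(0::ereal) \<le> c"
    and last: "\<And>p. p \<in> X \<Longrightarrow> ereal (sum s {q \<in> X. pos q < pos p} + s p) \<le> c"
  shows "ereal (sum s X) \<le> c"
proof (cases "X = {}")
  case False
  define k where "k = Max (pos ` X)"
  have "k \<in> pos ` X" unfolding k_def using assms False by (intro Max_in) auto
  then obtain p where p: "p \<in> X" "k = pos p" by blast
  have le: "pos q \<le> pos p" if "q \<in> X" for q
    unfolding p(2)[symmetric] k_def using that assms by simp
  have "{q \<in> X. pos q < pos p} = X - {p}"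
    using le p assms(2) by (auto simp: inj_on_def order_le_less)
  then have "sum s {q \<in> X. pos q < pos p} + s p = sum s X"
    using p assms by (simp add: sum.remove)
  then show ?thesis using last[OF p(1)] by simp
qed (use assms in \<open>simp add: zero_ereal_def\<close>)

lemma feasible_greedy:
  assumes valid: "valid_inst I" and nocap: "no_cap I" and gr: "greedy I pos \<phi>"
  shows "feasible I \<phi>"
  unfolding feasible_def
proof (intro allI ballI conjI)
  fix \<theta> w assume w: "w \<in> warehouses I"
  show "ereal (\<Sum>p | p \<in> P_out I w \<and> \<phi> p = \<theta>. psize I p) \<le> carry_out I w"
  proof (rule sum_le_by_last[where pos = pos])
    show "inj_on pos {p \<in> P_out I w. \<phi> p = \<theta>}"
      using gr unfolding greedy_def greedy_at_def by (auto simp: inj_on_def P_out_def)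
    show "0 \<le> carry_out I w" using valid w by (auto simp: valid_inst_def)
    fix p assume p: "p \<in> {p \<in> P_out I w. \<phi> p = \<theta>}"
    then have "fits_out I \<phi> (before I pos p) p (\<phi> p)" using gr by (auto simp: greedy_def greedy_at_def P_out_def)
    moreover have "{q. q \<in> {q \<in> before I pos p. src I q = src I p} \<and> \<phi> q = \<phi> p}
      = {q \<in> {p \<in> P_out I w. \<phi> p = \<theta>}. pos q < pos p}" using p by (auto simp: before_def P_out_def)
    ultimately show "ereal (sum (psize I) {q \<in> {p \<in> P_out I w. \<phi> p = \<theta>}. pos q < pos p} + psize I p)
      \<le> carry_out I w" using p by (simp add: fits_out_def load_def P_out_def)
  qed simp
  show "ereal (\<Sum>p | p \<in> P_in I w \<and> \<phi> p + transit I p = \<theta>. psize I p) \<le> carry_in I w"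
  proof (rule sum_le_by_last[where pos = pos])
    show "inj_on pos {p \<in> P_in I w. \<phi> p + transit I p = \<theta>}"
      using gr unfolding greedy_def greedy_at_def by (auto simp: inj_on_def P_in_def)
    show "0 \<le> carry_in I w" using valid w by (auto simp: valid_inst_def)
    fix p assume p: "p \<in> {p \<in> P_in I w. \<phi> p + transit I p = \<theta>}"
    then have "fits_in I \<phi> (before I pos p) p (\<phi> p)" using gr by (auto simp: greedy_def greedy_at_def P_in_def)
    moreover have "{q. q \<in> {q \<in> before I pos p. snk I q = snk I p} \<and>
        \<phi> q + transit I q = \<phi> p + transit I p}
      = {q \<in> {p \<in> P_in I w. \<phi> p + transit I p = \<theta>}. pos q < pos p}"
      using p by (auto simp: before_def P_in_def)
    ultimately show "ereal (sum (psize I) {q \<in> {p \<in> P_in I w. \<phi> p + transit I p = \<theta>}. pos q < pos p}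
      + psize I p) \<le> carry_in I w" using p by (simp add: fits_in_def load_def P_in_def)
  qed simp
qed (use nocap in \<open>auto simp: no_cap_def\<close>)

lemma le_completion_time: "p \<in> products I \<Longrightarrow> \<phi> p + transit I p \<le> completion_time I \<phi>"
  unfolding completion_time_def by (intro Max_ge) auto

lemma completion_time_le:
  assumes "\<And>p. p \<in> products I \<Longrightarrow> real (\<phi> p + transit I p) \<le> x" "0 \<le> x"
  shows "real (completion_time I \<phi>) \<le> x"
proof -
  have "completion_time I \<phi> \<in> insert 0 ((\<lambda>p. \<phi> p + transit I p) ` products I)"
    unfolding completion_time_def by (intro Max_in) auto
  then show ?thesis using assms by auto
qed

lemma min_completion_time_le: "feasible I \<phi> \<Longrightarrow> min_completion_time I \<le> completion_time I \<phi>"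
  unfolding min_completion_time_def by (rule Least_le) auto

lemma optimal_schedule:
  assumes "feasible I \<phi>"
  obtains \<psi> where "feasible I \<psi>" "completion_time I \<psi> = min_completion_time I"
  using LeastI[of "\<lambda>T. \<exists>\<phi>. feasible I \<phi> \<and> completion_time I \<phi> = T" "completion_time I \<phi>"] assms
  unfolding min_completion_time_def by auto

text \<open>\<open>A\<close> and \<open>G\<close> are left free because the sharp bounds restrict
  attention to the products up to \<open>p\<close> and to the early starting times that these use in
  \<open>\<psi>\<close>.\<close>

lemma packing_out:
  assumes "valid_inst I" "feasible I \<psi>" "w \<in> warehouses I" "carry_out I w = ereal d"
    and A: "A \<subseteq> P_out I w" and "finite G" "\<psi> ` A \<subseteq> G"
  shows "packing A (psize I) d \<psi> G"
proof
  fix q assume "q \<in> A"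
  then have "q \<in> products I" "src I q = w" using A by (auto simp: P_out_def)
  then show "0 \<le> psize I q" "psize I q \<le> d" using valid_instD[OF assms(1), of q] assms(4) by auto
next
  fix \<theta>
  have "load (psize I) A \<psi> \<theta> \<le> load (psize I) (P_out I w) \<psi> \<theta>"
    unfolding load_def using A assms(1)
    by (intro sum_mono2) (auto simp: P_out_def intro: valid_instD)
  moreover have "ereal (load (psize I) (P_out I w) \<psi> \<theta>) \<le> carry_out I w"
    using assms(2,3) unfolding feasible_def load_def by blast
  then have "load (psize I) (P_out I w) \<psi> \<theta> \<le> d" using assms(4) by simp
  ultimately show "load (psize I) A \<psi> \<theta> \<le> d" by linarith
qed (fact finite_subset[OF A finite_P(1)] assms(6) assms(7))+

lemma packing_in:
  assumes "valid_inst I" "feasible I \<psi>" "w \<in> warehouses I" "carry_in I w = ereal d"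
    and A: "A \<subseteq> P_in I w" and "finite G" "(\<lambda>q. \<psi> q + transit I q) ` A \<subseteq> G"
  shows "packing A (psize I) d (\<lambda>q. \<psi> q + transit I q) G"
proof
  fix q assume "q \<in> A"
  then have "q \<in> products I" "snk I q = w" using A by (auto simp: P_in_def)
  then show "0 \<le> psize I q" "psize I q \<le> d" using valid_instD[OF assms(1), of q] assms(4) by auto
next
  fix \<theta>
  have "load (psize I) A (\<lambda>q. \<psi> q + transit I q) \<theta>
      \<le> load (psize I) (P_in I w) (\<lambda>q. \<psi> q + transit I q) \<theta>"
    unfolding load_def using A assms(1)
    by (intro sum_mono2) (auto simp: P_in_def intro: valid_instD)
  moreover have "ereal (load (psize I) (P_in I w) (\<lambda>q. \<psi> q + transit I q) \<theta>) \<le> carry_in I w"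
    using assms(2,3) unfolding feasible_def load_def by blast
  then have "load (psize I) (P_in I w) (\<lambda>q. \<psi> q + transit I q) \<theta> \<le> d" using assms(4) by simp
  ultimately show "load (psize I) A (\<lambda>q. \<psi> q + transit I q) \<theta> \<le> d" by linarith
qed (fact finite_subset[OF A finite_P(2)] assms(6) assms(7))+

text \<open>A refused product shows that the capacity is finite; this is where the real bin size
  \<open>d\<close> of \<open>packing\<close> comes from.\<close>

lemma not_fits_outE:
  assumes "valid_inst I" "p \<in> products I" "\<not> fits_out I \<phi> X p \<theta>"
  obtains d where "carry_out I (src I p) = ereal d"
    "d < load (psize I) {q \<in> X. src I q = src I p} \<phi> \<theta> + psize I p"
  using assms valid_instD(5)[OF assms(1,2)] unfolding fits_out_def
  by (cases "carry_out I (src I p)") auto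

lemma not_fits_inE:
  assumes "valid_inst I" "p \<in> products I" "\<not> fits_in I \<phi> X p \<theta>"
  obtains d where "carry_in I (snk I p) = ereal d"
    "d < load (psize I) {q \<in> X. snk I q = snk I p} (\<lambda>q. \<phi> q + transit I q) (\<theta> + transit I p)
      + psize I p"
  using assms valid_instD(6)[OF assms(1,2)] unfolding fits_in_def
  by (cases "carry_in I (snk I p)") auto

lemma fits_in_if_no_carry_in:
  "valid_inst I \<Longrightarrow> no_carry_in I \<Longrightarrow> p \<in> products I \<Longrightarrow> fits_in I \<phi> X p \<theta>"
  by (simp add: fits_in_def no_carry_in_def valid_instD)

lemma greedy_not_fits_out:
  assumes "valid_inst I" "no_carry_in I" "greedy I pos \<phi>" "p \<in> products I" "\<theta> < \<phi> p"
  shows "\<not> fits_out I \<phi> (before I pos p) p \<theta>"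
  using assms fits_in_if_no_carry_in unfolding greedy_def greedy_at_def by blast

section \<open>Greedy starting times against an arbitrary feasible schedule\<close>

context
  fixes I :: inst and \<phi> \<psi> pos :: "nat \<Rightarrow> nat" and T :: nat
  assumes valid: "valid_inst I" and gr: "greedy I pos \<phi>"
    and fea: "feasible I \<psi>" and T: "completion_time I \<psi> = T"
begin

lemma transit_le: "p \<in> products I \<Longrightarrow> \<psi> p + transit I p \<le> T"
  using le_completion_time T by blast

text \<open>Positive transit times exclude departures at \<open>T\<close> and, in
  \<open>arrival_range\<close>, arrivals at \<open>0\<close>. So both sides have exactly
  \<open>T\<close> slots, without an additional one at an end.\<close>

lemma start_range: "\<psi> ` P_out I w \<subseteq> {..<T}"
proof
  fix x assume "x \<in> \<psi> ` P_out I w"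
  then obtain p where "x = \<psi> p" "p \<in> products I" by (auto simp: P_out_def)
  then show "x \<in> {..<T}" using transit_le[of p] valid_instD(4)[OF valid, of p] by simp
qed

lemma arrival_range: "(\<lambda>q. \<psi> q + transit I q) ` P_in I w \<subseteq> {1..T}"
proof
  fix x assume "x \<in> (\<lambda>q. \<psi> q + transit I q) ` P_in I w"
  then obtain p where "x = \<psi> p + transit I p" "p \<in> products I" by (auto simp: P_in_def)
  then show "x \<in> {1..T}" using transit_le[of p] valid_instD(4)[OF valid, of p] by simp
qed

lemma blocked_out_half:
  assumes p: "p \<in> products I" and decr: "decreasing I (psize I) pos"
  shows "card {\<theta>. \<theta> < \<phi> p \<and> \<not> fits_out I \<phi> (before I pos p) p \<theta>} < 2 * T" (is "card ?X < _")
proof (cases "?X = {}")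
  case True
  then have "card ?X = 0" by (simp only: card.empty)
  then show ?thesis using transit_le[OF p] valid_instD(4)[OF valid p] by linarith
next
  case False
  then obtain d where d: "carry_out I (src I p) = ereal d"
    using not_fits_outE[OF valid p] by blast
  interpret packing "P_out I (src I p)" "psize I" d \<psi> "{..<T}"
    using packing_out[OF valid fea _ d] valid_instD[OF valid p] start_range by auto
  have "card ?X < 2 * card {..<T}"
  proof (rule half_full[of p])
    show "d < load (psize I) {q \<in> before I pos p. src I q = src I p} \<phi> \<theta> + psize I p"
      if "\<theta> \<in> ?X" for \<theta> using not_fits_outE[OF valid p, of \<phi> "before I pos p" \<theta>] that d by auto
  qed (use p decr in \<open>auto simp: P_out_def before_def decreasing_def\<close>)
  then show ?thesis by simp
qed

text \<open>\<open>A\<close> has to contain \<open>p\<close> and everything before it at the same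
  source. It is all of \<open>P_out\<close> with \<open>T\<close> slots in the two-sided case, and
  only the products up to \<open>p\<close>, with the slots up to \<open>T - transit I p\<close>, in
  the proof of optimality.\<close>

lemma blocked_out_uniform:
  assumes p: "p \<in> products I" and unif: "uniform_size I"
    and A: "A \<subseteq> P_out I (src I p)" "p \<in> A" "\<And>q. q \<in> P_out I (src I p) \<Longrightarrow> pos q < pos p \<Longrightarrow> q \<in> A"
    and G: "finite G" "\<psi> ` A \<subseteq> G"
  shows "card {\<theta>. \<theta> < \<phi> p \<and> \<not> fits_out I \<phi> (before I pos p) p \<theta>} < card G" (is "card ?X < _")
proof (cases "?X = {}")
  case True
  then have "card ?X = 0" by (simp only: card.empty)
  moreover have "card G > 0" using G A by (auto simp: card_gt_0_iff)
  ultimately show ?thesis by linarith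
next
  case False
  then obtain d where d: "carry_out I (src I p) = ereal d"
    using not_fits_outE[OF valid p] by blast
  interpret packing A "psize I" d \<psi> G
    using packing_out[OF valid fea _ d] valid_instD[OF valid p] A G by auto
  show ?thesis
  proof (rule uniform_full[of p])
    show "d < load (psize I) {q \<in> before I pos p. src I q = src I p} \<phi> \<theta> + psize I p"
      if "\<theta> \<in> ?X" for \<theta> using not_fits_outE[OF valid p, of \<phi> "before I pos p" \<theta>] that d by auto
    show "psize I q = psize I p" if "q \<in> A" for q
      using that A(1) unif p unfolding uniform_size_def by (auto simp: P_out_def)
  qed (use p A in \<open>auto simp: P_out_def before_def\<close>)
qed

lemma blocked_in_half:
  assumes p: "p \<in> products I" and decr: "decreasing I (psize I) pos"
  shows "card {\<theta>. \<theta> < \<phi> p \<and> \<not> fits_in I \<phi> (before I pos p) p \<theta>} < 2 * T" (is "card ?X < _")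
proof (cases "?X = {}")
  case True
  then have "card ?X = 0" by (simp only: card.empty)
  then show ?thesis using transit_le[OF p] valid_instD(4)[OF valid p] by linarith
next
  case False
  then obtain d where d: "carry_in I (snk I p) = ereal d"
    using not_fits_inE[OF valid p] by blast
  interpret packing "P_in I (snk I p)" "psize I" d "\<lambda>q. \<psi> q + transit I q" "{1..T}"
    using packing_in[OF valid fea _ d] valid_instD[OF valid p] arrival_range by auto
  \<comment> \<open>Blocked starting times are counted as arrival slots; the shift by the transit
    time of \<open>p\<close> is injective and preserves their number.\<close>
  have "card ((\<lambda>\<theta>. \<theta> + transit I p) ` ?X) < 2 * card {1..T}"
  proof (rule half_full[of p])
    show "d < load (psize I) {q \<in> before I pos p. snk I q = snk I p} (\<lambda>q. \<phi> q + transit I q) \<theta>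
        + psize I p" if "\<theta> \<in> (\<lambda>\<theta>. \<theta> + transit I p) ` ?X" for \<theta>
    proof -
      from that obtain \<theta>' where "\<theta> = \<theta>' + transit I p" "\<theta>' \<in> ?X" by blast
      then show ?thesis using not_fits_inE[OF valid p, of \<phi> "before I pos p" \<theta>'] d by auto
    qed
  qed (use p decr in \<open>auto simp: P_in_def before_def decreasing_def\<close>)
  then show ?thesis by (simp add: card_image)
qed

lemma blocked_in_uniform:
  assumes p: "p \<in> products I" and unif: "uniform_size I"
  shows "card {\<theta>. \<theta> < \<phi> p \<and> \<not> fits_in I \<phi> (before I pos p) p \<theta>} < T" (is "card ?X < _")
proof (cases "?X = {}")
  case True
  then have "card ?X = 0" by (simp only: card.empty)
  then show ?thesis using transit_le[OF p] valid_instD(4)[OF valid p] by linarith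
next
  case False
  then obtain d where d: "carry_in I (snk I p) = ereal d"
    using not_fits_inE[OF valid p] by blast
  interpret packing "P_in I (snk I p)" "psize I" d "\<lambda>q. \<psi> q + transit I q" "{1..T}"
    using packing_in[OF valid fea _ d] valid_instD[OF valid p] arrival_range by auto
  have "card ((\<lambda>\<theta>. \<theta> + transit I p) ` ?X) < card {1..T}"
  proof (rule uniform_full[of p])
    show "d < load (psize I) {q \<in> before I pos p. snk I q = snk I p} (\<lambda>q. \<phi> q + transit I q) \<theta>
        + psize I p" if "\<theta> \<in> (\<lambda>\<theta>. \<theta> + transit I p) ` ?X" for \<theta>
    proof -
      from that obtain \<theta>' where "\<theta> = \<theta>' + transit I p" "\<theta>' \<in> ?X" by blast
      then show ?thesis using not_fits_inE[OF valid p, of \<phi> "before I pos p" \<theta>'] d by auto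
    qed
    show "psize I q = psize I p" if "q \<in> P_in I (snk I p)" for q
      using that unif p unfolding uniform_size_def by (auto simp: P_in_def)
  qed (use p in \<open>auto simp: P_in_def before_def\<close>)
  then show ?thesis by (simp add: card_image)
qed

lemma greedy_le_blocked:
  assumes "p \<in> products I"
  shows "\<phi> p \<le> card {\<theta>. \<theta> < \<phi> p \<and> \<not> fits_out I \<phi> (before I pos p) p \<theta>} +
    card {\<theta>. \<theta> < \<phi> p \<and> \<not> fits_in I \<phi> (before I pos p) p \<theta>}" (is "_ \<le> card ?X + card ?Y")
proof -
  have "{..<\<phi> p} \<subseteq> ?X \<union> ?Y" using gr assms by (auto simp: greedy_def greedy_at_def)
  then have "card {..<\<phi> p} \<le> card (?X \<union> ?Y)" by (intro card_mono) auto
  also have "\<dots> \<le> card ?X + card ?Y" by (rule card_Un_le)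
  finally show ?thesis by simp
qed

text \<open>Each skipped slot is blocked at the source or at the sink, so the start is at most
  \<open>4 * T - 2\<close>, and the transit time adds at most \<open>T\<close>; the bound holds with
  room to spare. The same count with fewer than \<open>T\<close> blocked slots on each side proves
  \<open>greedy_ratio_uniform_size\<close>.\<close>

lemma greedy_ratio_general:
  assumes "p \<in> products I" "decreasing I (psize I) pos"
  shows "real (\<phi> p + transit I p) \<le> 6 * real T"
  using greedy_le_blocked[OF assms(1)] blocked_in_half[OF assms] blocked_out_half[OF assms]
    transit_le[OF assms(1)] by linarith

lemma greedy_ratio_uniform_size:
  assumes "p \<in> products I" "uniform_size I"
  shows "real (\<phi> p + transit I p) \<le> 4 * real T"
  using greedy_le_blocked[OF assms(1)] blocked_in_uniform[OF assms] transit_le[OF assms(1)]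
    blocked_out_uniform[OF assms order_refl, of "{..<T}"] start_range assms(1)
  by (simp add: P_out_def)

lemma longer_start_range:
  assumes "p \<in> products I" "decreasing I (\<lambda>q. real (transit I q)) pos"
  shows "\<psi> ` {q \<in> P_out I w. q = p \<or> pos q < pos p} \<subseteq> {..T - transit I p}"
proof
  fix x assume "x \<in> \<psi> ` {q \<in> P_out I w. q = p \<or> pos q < pos p}"
  then obtain q where q: "x = \<psi> q" "q \<in> products I" "q = p \<or> pos q < pos p" by (auto simp: P_out_def)
  then have "transit I p \<le> transit I q" using assms by (auto simp: decreasing_def)
  then show "x \<in> {..T - transit I p}" using transit_le[of q] q by auto
qed

lemma greedy_optimal:
  assumes p: "p \<in> products I" and "no_carry_in I" "uniform_size I"
    and decr: "decreasing I (\<lambda>q. real (transit I q)) pos"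
  shows "\<phi> p + transit I p \<le> T"
proof -
  have "{\<theta>. \<theta> < \<phi> p \<and> \<not> fits_out I \<phi> (before I pos p) p \<theta>} = {..<\<phi> p}"
    using greedy_not_fits_out[OF valid _ gr p] assms by auto
  \<comment> \<open>All slots below \<open>\<phi> p\<close> are blocked at the source. The
    comparison set has \<open>T - transit I p + 1\<close> elements, so the strict inequality is
    exactly what is claimed.\<close>
  then have "\<phi> p < card {..T - transit I p}"
    using blocked_out_uniform[OF p assms(3) _ _ _ _ longer_start_range[OF p decr, of "src I p"]] p
    by (auto simp: P_out_def)
  then show ?thesis using transit_le[OF p] by simp
qed

text \<open>\<open>A\<close> is closed under earlier products of the same source, so the load that
  the greedy rule sees is the load inside \<open>A\<close>. The assumption
  \<open>0 < \<phi> p\<close> provides a refused slot and with it a finite capacity.\<close>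

lemma first_fit_out:
  assumes p: "p \<in> products I" and "no_carry_in I" "0 < \<phi> p"
    and A: "A \<subseteq> P_out I (src I p)"
      "\<And>q x. q \<in> A \<Longrightarrow> x \<in> P_out I (src I p) \<Longrightarrow> pos x < pos q \<Longrightarrow> x \<in> A"
    and G: "finite G" "\<psi> ` A \<subseteq> G"
  obtains d where "first_fit A (psize I) d \<psi> G \<phi> pos"
proof -
  have nf: "\<not> fits_out I \<phi> (before I pos q) q \<theta>" if "q \<in> products I" "\<theta> < \<phi> q" for q \<theta>
    using greedy_not_fits_out[OF valid \<open>no_carry_in I\<close> gr] that .
  obtain d where d: "carry_out I (src I p) = ereal d"
    using not_fits_outE[OF valid p nf[OF p \<open>0 < \<phi> p\<close>]] .
  interpret packing A "psize I" d \<psi> G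
    using packing_out[OF valid fea _ d] valid_instD[OF valid p] A G by auto
  have "first_fit A (psize I) d \<psi> G \<phi> pos"
  proof
    fix q \<theta> assume q: "q \<in> A" "\<theta> < \<phi> q"
    then have q': "q \<in> products I" "src I q = src I p" using A(1) by (auto simp: P_out_def)
    have "{x \<in> A. pos x < pos q} = {x \<in> before I pos q. src I x = src I q}"
      using A q q' by (auto simp: before_def P_out_def)
    then show "d < load (psize I) {x \<in> A. pos x < pos q} \<phi> \<theta> + psize I q"
      using not_fits_outE[OF valid q'(1) nf[OF q'(1) q(2)]] d q' by auto
  qed
  then show ?thesis using that by blast
qed

lemma greedy_ratio_no_carry_in:
  assumes p: "p \<in> products I" and "no_carry_in I" and decr: "decreasing I (\<lambda>q. real (transit I q)) pos"
  shows "real (\<phi> p + transit I p) \<le> 7 / 4 * real T"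
proof (cases "\<phi> p = 0")
  case True
  then show ?thesis using transit_le[OF p] by simp
next
  case False
  define A where "A = {q \<in> P_out I (src I p). q = p \<or> pos q < pos p}"
  obtain d where "first_fit A (psize I) d \<psi> {..T - transit I p} \<phi> pos"
  proof (rule first_fit_out[OF p assms(2)])
    show "\<psi> ` A \<subseteq> {..T - transit I p}" unfolding A_def by (rule longer_start_range[OF p decr])
  qed (use False in \<open>auto simp: A_def\<close>)
  then have "4 * (\<phi> p + 1) \<le> 7 * card {..T - transit I p}"
    by (rule first_fit.first_fit_ratio) (use p in \<open>auto simp: A_def P_out_def\<close>)
  \<comment> \<open>After clearing denominators the surplus constant is \<open>7 - 4 = 3\<close>,
    absorbed by \<open>3 * transit I p \<ge> 3\<close>.\<close>
  then have "4 * (\<phi> p + 1) + 7 * transit I p \<le> 7 * (T + 1)" using transit_le[OF p] by simp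
  then show ?thesis using valid_instD(4)[OF valid p] by simp
qed

text \<open>With a common transit time all products of the source start by
  \<open>T - transit I p\<close> in \<open>\<psi>\<close>. No order by transit time is required for
  this, so the order is free for decreasing sizes.\<close>

lemma greedy_ratio_uniform_transit:
  assumes p: "p \<in> products I" and "no_carry_in I" and unif: "uniform_transit I"
    and decr: "decreasing I (psize I) pos"
  shows "real (\<phi> p + transit I p) \<le> 3 / 2 * real T"
proof (cases "\<phi> p = 0")
  case True
  then show ?thesis using transit_le[OF p] by simp
next
  case False
  define A where "A = P_out I (src I p)"
  have "\<psi> ` A \<subseteq> {..T - transit I p}"
  proof
    fix x assume "x \<in> \<psi> ` A"
    then obtain q where q: "x = \<psi> q" "q \<in> products I" by (auto simp: A_def P_out_def)
    then have "transit I p = transit I q" using unif p by (auto simp: uniform_transit_def)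
    then show "x \<in> {..T - transit I p}" using transit_le[of q] q by auto
  qed
  then obtain d where "first_fit A (psize I) d \<psi> {..T - transit I p} \<phi> pos"
    using first_fit_out[OF p assms(2), of A "{..T - transit I p}"] False unfolding A_def by auto
  then have "2 * (\<phi> p + 1) \<le> 3 * card {..T - transit I p}"
    by (rule first_fit.first_fit_decreasing_ratio)
      (use p decr in \<open>auto simp: A_def decreasing_def P_out_def\<close>)
  \<comment> \<open>The surplus constant \<open>3 - 2 = 1\<close> is absorbed by one further
    multiple of \<open>transit I p\<close>.\<close>
  then have "2 * (\<phi> p + 1) + 3 * transit I p \<le> 3 * (T + 1)" using transit_le[OF p] by simp
  then show ?thesis using valid_instD(4)[OF valid p] by simp
qed

end

text \<open>\<open>ratio\<close> compares with every feasible schedule. An optimal one exists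
  because the greedy schedule itself shows that feasible schedules exist.\<close>

lemma greedy_completion_time:
  assumes "valid_inst I" "no_cap I" "greedy I pos \<phi>" "0 \<le> \<alpha>"
    and ratio: "\<And>\<psi> T p. \<lbrakk>feasible I \<psi>; completion_time I \<psi> = T; p \<in> products I\<rbrakk>
      \<Longrightarrow> real (\<phi> p + transit I p) \<le> \<alpha> * real T"
  shows "feasible I \<phi> \<and> real (completion_time I \<phi>) \<le> \<alpha> * real (min_completion_time I)"
proof
  show fea: "feasible I \<phi>" using feasible_greedy assms by blast
  obtain \<psi> where "feasible I \<psi>" "completion_time I \<psi> = min_completion_time I"
    using optimal_schedule[OF fea] .
  then show "real (completion_time I \<phi>) \<le> \<alpha> * real (min_completion_time I)"
    using ratio \<open>0 \<le> \<alpha>\<close> by (intro completion_time_le) auto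
qed

section \<open>Time reversal\<close>

definition swap_inst :: "inst \<Rightarrow> inst" where
  "swap_inst I = I\<lparr>src := snk I, snk := src I, carry_out := carry_in I, carry_in := carry_out I\<rparr>"

lemma swap_inst_sel [simp]:
  "nW (swap_inst I) = nW I" "nP (swap_inst I) = nP I" "psize (swap_inst I) = psize I"
  "src (swap_inst I) = snk I" "snk (swap_inst I) = src I" "transit (swap_inst I) = transit I"
  "cap (swap_inst I) = cap I" "carry_out (swap_inst I) = carry_in I"
  "carry_in (swap_inst I) = carry_out I"
  "products (swap_inst I) = products I" "warehouses (swap_inst I) = warehouses I"
  "P_out (swap_inst I) w = P_in I w" "P_in (swap_inst I) w = P_out I w"
  "swap_inst (swap_inst I) = I"
  by (auto simp: swap_inst_def products_def warehouses_def P_out_def P_in_def)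

lemma swap_inst_props [simp]:
  "valid_inst (swap_inst I) = valid_inst I" "no_cap (swap_inst I) = no_cap I"
  "no_carry_in (swap_inst I) = no_carry_out I" "no_carry_out (swap_inst I) = no_carry_in I"
  "uniform_size (swap_inst I) = uniform_size I" "uniform_transit (swap_inst I) = uniform_transit I"
  "completion_time (swap_inst I) = completion_time I"
  by (auto simp: valid_inst_def no_cap_def no_carry_in_def no_carry_out_def uniform_size_def
      uniform_transit_def completion_time_def fun_eq_iff)

text \<open>Reflecting time at \<open>T\<close> sends the arrival
  \<open>\<phi> p + transit I p\<close> to a departure and the departure \<open>\<phi> p\<close> to
  an arrival, so the two carry constraints change places. The bound by \<open>T\<close> keeps the
  truncated subtractions exact.\<close>

lemma feasible_reversal:
  assumes valid: "valid_inst I" and "no_cap I" "feasible I \<phi>"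
    and T: "\<And>p. p \<in> products I \<Longrightarrow> \<phi> p + transit I p \<le> T"
  shows "feasible (swap_inst I) (\<lambda>p. T - transit I p - \<phi> p)"
  unfolding feasible_def
proof (intro allI ballI conjI)
  fix \<theta> w assume "w \<in> warehouses (swap_inst I)"
  then have w: "w \<in> warehouses I" by simp
  have T': "\<phi> p + transit I p \<le> T" if "p \<in> P_in I w \<or> p \<in> P_out I w" for p
    using T that by (auto simp: P_in_def P_out_def)
  have nn: "0 \<le> carry_in I w" "0 \<le> carry_out I w" using valid w by (auto simp: valid_inst_def)
  show "ereal (\<Sum>p | p \<in> P_out (swap_inst I) w \<and> T - transit I p - \<phi> p = \<theta>. psize (swap_inst I) p)
    \<le> carry_out (swap_inst I) w"
  \<comment> \<open>Beyond \<open>T\<close> the slot \<open>T - \<theta>\<close> would be truncated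
    to \<open>0\<close>; there the reflected slot is empty.\<close>
  proof (cases "\<theta> \<le> T")
    case True
    then have "{p. p \<in> P_in I w \<and> T - transit I p - \<phi> p = \<theta>}
      = {p. p \<in> P_in I w \<and> \<phi> p + transit I p = T - \<theta>}" using T' by fastforce
    then show ?thesis using assms(3) w unfolding feasible_def by simp
  next
    case False
    then have "{p. p \<in> P_in I w \<and> T - transit I p - \<phi> p = \<theta>} = {}" by auto
    then show ?thesis using nn by (simp only: swap_inst_sel sum.empty zero_ereal_def)
  qed
  show "ereal (\<Sum>p | p \<in> P_in (swap_inst I) w \<and> T - transit I p - \<phi> p + transit (swap_inst I) p = \<theta>.
    psize (swap_inst I) p) \<le> carry_in (swap_inst I) w"
  proof (cases "\<theta> \<le> T")
    case True
    then have "{p. p \<in> P_out I w \<and> T - transit I p - \<phi> p + transit I p = \<theta>}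
      = {p. p \<in> P_out I w \<and> \<phi> p = T - \<theta>}" using T' by fastforce
    then show ?thesis using assms(3) w unfolding feasible_def by simp
  next
    case False
    then have "{p. p \<in> P_out I w \<and> T - transit I p - \<phi> p + transit I p = \<theta>} = {}" using T' by fastforce
    then show ?thesis using nn by (simp only: swap_inst_sel sum.empty zero_ereal_def)
  qed
qed (use assms(2) in \<open>simp add: no_cap_def\<close>)

text \<open>Reflecting an optimal schedule at its own completion time does not make it
  longer.\<close>

lemma min_completion_time_swap:
  assumes "valid_inst I" "no_cap I" "feasible I \<phi>"
  shows "min_completion_time (swap_inst I) \<le> min_completion_time I"
proof -
  obtain \<psi> where \<psi>: "feasible I \<psi>" "completion_time I \<psi> = min_completion_time I"
    using optimal_schedule[OF assms(3)] .
  define T where "T = min_completion_time I"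
  have le: "\<psi> p + transit I p \<le> T" if "p \<in> products I" for p
    using le_completion_time[OF that, of \<psi>] \<psi> T_def by simp
  have "min_completion_time (swap_inst I) \<le> completion_time (swap_inst I) (\<lambda>p. T - transit I p - \<psi> p)"
    by (intro min_completion_time_le feasible_reversal assms \<psi> le)
  also have "real \<dots> \<le> real T"
    by (intro completion_time_le) (use le in fastforce)+
  finally show ?thesis by (simp add: T_def)
qed

text \<open>The reflection point is the length of the schedule that was found, which a program can
  compute, and not the optimum.\<close>

lemma reversal_ratio:
  assumes "valid_inst I" "no_cap I" "0 \<le> \<alpha>" "feasible (swap_inst I) \<phi>"
    "real (completion_time (swap_inst I) \<phi>) \<le> \<alpha> * real (min_completion_time (swap_inst I))"
  defines "T \<equiv> completion_time I \<phi>"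
  shows "feasible I (\<lambda>p. T - transit I p - \<phi> p)"
    "real (completion_time I (\<lambda>p. T - transit I p - \<phi> p)) \<le> \<alpha> * real (min_completion_time I)"
proof -
  have le: "\<phi> p + transit I p \<le> T" if "p \<in> products I" for p
    using le_completion_time[OF that, of \<phi>] T_def by simp
  have "feasible (swap_inst (swap_inst I)) (\<lambda>p. T - transit (swap_inst I) p - \<phi> p)"
    by (rule feasible_reversal) (use assms le in auto)
  then show fea: "feasible I (\<lambda>p. T - transit I p - \<phi> p)" by simp
  have "real (completion_time I (\<lambda>p. T - transit I p - \<phi> p)) \<le> real T"
    by (intro completion_time_le) (use le in fastforce)+
  also have "\<dots> \<le> \<alpha> * real (min_completion_time (swap_inst I))" using assms by simp
  also have "\<dots> \<le> \<alpha> * real (min_completion_time I)"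
    using min_completion_time_swap[OF assms(1,2) fea] \<open>0 \<le> \<alpha>\<close> by (intro mult_left_mono) auto
  finally show "real (completion_time I (\<lambda>p. T - transit I p - \<phi> p)) \<le> \<alpha> * real (min_completion_time I)" .
qed

section \<open>Time-bounded program verification and merge sort\<close>

text \<open>Total correctness with a step count: termination is part of the claim, and
  \<open>Q\<close> also receives the number of steps. As execution is deterministic, the existential
  quantifiers speak about the only run.\<close>

definition wp :: "com \<Rightarrow> (nat \<Rightarrow> state \<Rightarrow> bool) \<Rightarrow> state \<Rightarrow> bool" where
  "wp c Q s \<longleftrightarrow> (\<exists>t s'. exec c s t s' \<and> Q t s')"

lemma wp_Skip [simp]: "wp Skip Q s \<longleftrightarrow> Q 1 s"
  unfolding wp_def by (metis exec.Skip exec_SkipE)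

lemma wp_IWrite [simp]: "wp (IWrite x i e) Q s \<longleftrightarrow> Q 1 (iwrite x (ival i s) (ival e s) s)"
  unfolding wp_def by (metis exec.IWrite exec_IWriteE)

lemma wp_RWrite [simp]: "wp (RWrite x i e) Q s \<longleftrightarrow> Q 1 (rwrite x (ival i s) (rval e s) s)"
  unfolding wp_def by (metis exec.RWrite exec_RWriteE)

lemma wp_Seq [simp]: "wp (Seq c1 c2) Q s \<longleftrightarrow> wp c1 (\<lambda>t1. wp c2 (\<lambda>t2. Q (t1 + t2))) s"
  unfolding wp_def by (blast elim: exec_SeqE intro: exec.Seq)

lemma wp_If [simp]:
  "wp (If b c1 c2) Q s \<longleftrightarrow> (if bval b s then wp c1 (\<lambda>t. Q (1 + t)) s else wp c2 (\<lambda>t. Q (1 + t)) s)"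
proof (cases "bval b s")
  case True
  have "exec (If b c1 c2) s t s' \<longleftrightarrow> (\<exists>t'. t = 1 + t' \<and> exec c1 s t' s')" for t s'
    using True by (auto elim!: exec_IfE simp del: One_nat_def intro: exec.IfTrue)
  then have "wp (If b c1 c2) Q s \<longleftrightarrow> wp c1 (\<lambda>t. Q (1 + t)) s"
    by (auto simp: wp_def)
  then show ?thesis using True by simp
next
  case False
  have "exec (If b c1 c2) s t s' \<longleftrightarrow> (\<exists>t'. t = 1 + t' \<and> exec c2 s t' s')" for t s'
    using False by (auto elim!: exec_IfE simp del: One_nat_def intro: exec.IfFalse)
  then have "wp (If b c1 c2) Q s \<longleftrightarrow> wp c2 (\<lambda>t. Q (1 + t)) s"
    by (auto simp: wp_def)
  then show ?thesis using False by simp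
qed

lemma wp_mono: "wp c P s \<Longrightarrow> (\<And>t s'. P t s' \<Longrightarrow> Q t s') \<Longrightarrow> wp c Q s"
  unfolding wp_def by blast

text \<open>The potential pays for every round including its test, so it decreases strictly and
  yields both termination and the time bound. The final \<open>1\<close> is the failing
  test.\<close>

lemma wp_While:
  assumes "Inv s"
    and step: "\<And>s. Inv s \<Longrightarrow> bval b s \<Longrightarrow> wp c (\<lambda>t s'. Inv s' \<and> pot s' + t + 1 \<le> pot s) s"
  shows "wp (While b c) (\<lambda>t s'. t \<le> pot s + 1 \<and> Inv s' \<and> \<not> bval b s') s"
  using assms(1)
proof (induction "pot s" arbitrary: s rule: less_induct)
  case less
  show ?case
  proof (cases "bval b s")
    case True
    then obtain t s' where 1: "exec c s t s'" "Inv s'" "pot s' + t + 1 \<le> pot s"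
      using step[OF less.prems] unfolding wp_def by blast
    then obtain t' s'' where 2: "exec (While b c) s' t' s''" "t' \<le> pot s' + 1" "Inv s''" "\<not> bval b s''"
      using less.hyps[of s'] unfolding wp_def by auto
    have "exec (While b c) s (1 + t + t') s''" using exec.WhileTrue[OF True 1(1) 2(1)] .
    then show ?thesis using 1 2 unfolding wp_def by fastforce
  next
    case False
    then show ?thesis using exec.WhileFalse[OF False] less.prems unfolding wp_def by fastforce
  qed
qed

abbreviation Var :: "string \<Rightarrow> iexp" where "Var x \<equiv> IRead x (IConst 0)"
abbreviation Assign :: "string \<Rightarrow> iexp \<Rightarrow> com" where "Assign x e \<equiv> IWrite x (IConst 0) e"
abbreviation RVar :: "string \<Rightarrow> rexp" where "RVar x \<equiv> RRead x (IConst 0)"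
abbreviation RAssign :: "string \<Rightarrow> rexp \<Rightarrow> com" where "RAssign x e \<equiv> RWrite x (IConst 0) e"

definition For :: "string \<Rightarrow> iexp \<Rightarrow> com \<Rightarrow> com" where
  "For x e c = Seq (Assign x (IConst 0))
     (While (ILess (Var x) e) (Seq c (Assign x (IAdd (Var x) (IConst 1)))))"

lemma imem_iwrite [simp]: "imem (iwrite x i v s) y = (if y = x then (imem s x)(i := v) else imem s y)"
  and rmem_iwrite [simp]: "rmem (iwrite x i v s) = rmem s"
  and imem_rwrite [simp]: "imem (rwrite x i r s) = imem s"
  and rmem_rwrite [simp]: "rmem (rwrite x i r s) y = (if y = x then (rmem s x)(i := r) else rmem s y)"
  by (simp_all add: iwrite_def rwrite_def)

text \<open>The invariant is required after the counter has been incremented, so it may mention the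
  counter. \<open>B + 2\<close> adds test and increment to the body; the last \<open>2\<close> is
  the initial assignment and the failing test.\<close>

lemma wp_For:
  assumes init: "Inv 0 (iwrite x 0 0 s)"
    and bound: "\<And>i s. Inv i s \<Longrightarrow> ival e s = int n"
    and step: "\<And>i s. \<lbrakk>i < n; imem s x 0 = int i; Inv i s\<rbrakk> \<Longrightarrow>
      wp c (\<lambda>t s'. t \<le> B \<and> imem s' x 0 = int i \<and> Inv (Suc i) (iwrite x 0 (int (Suc i)) s')) s"
  shows "wp (For x e c) (\<lambda>t s'. t \<le> n * (B + 2) + 2 \<and> imem s' x 0 = int n \<and> Inv n s') s"
proof -
  define J where "J s \<longleftrightarrow> (\<exists>i\<le>n. imem s x 0 = int i \<and> Inv i s)" for s
  define pot where "pot s = (n - nat (imem s x 0)) * (B + 2)" for s :: state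
  let ?b = "ILess (Var x) e" and ?c = "Seq c (Assign x (IAdd (Var x) (IConst 1)))"
  have J0: "J (iwrite x 0 0 s)" using init unfolding J_def by (intro exI[of _ 0]) simp
  have "wp (While ?b ?c) (\<lambda>t s'. t \<le> pot (iwrite x 0 0 s) + 1 \<and> J s' \<and> \<not> bval ?b s') (iwrite x 0 0 s)"
  proof (rule wp_While[of J, OF J0])
    fix s assume "J s" "bval ?b s"
    then obtain i where i: "i < n" "imem s x 0 = int i" "Inv i s"
      using bound unfolding J_def by fastforce
    have "n - i = Suc (n - Suc i)" using i by simp
    then have "pot s = (n - Suc i) * (B + 2) + (B + 2)" using i by (simp add: pot_def)
    then show "wp ?c (\<lambda>t s'. J s' \<and> pot s' + t + 1 \<le> pot s) s"
      unfolding wp_Seq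
      by (intro wp_mono[OF step[OF i]]) (use i in \<open>auto simp: J_def pot_def nat_add_distrib add.commute[of "int i"] intro!: exI[of _ "Suc i"]\<close>)
  qed
  then have "wp (While ?b ?c) (\<lambda>t s'. 1 + t \<le> n * (B + 2) + 2 \<and> imem s' x 0 = int n \<and> Inv n s')
    (iwrite x 0 0 s)"
  proof (rule wp_mono)
    fix t s' assume a: "t \<le> pot (iwrite x 0 0 s) + 1 \<and> J s' \<and> \<not> bval ?b s'"
    then obtain i where i: "i \<le> n" "imem s' x 0 = int i" "Inv i s'" unfolding J_def by blast
    then have "i = n" using a bound[OF i(3)] by simp
    then show "1 + t \<le> n * (B + 2) + 2 \<and> imem s' x 0 = int n \<and> Inv n s'"
      using i a by (simp add: pot_def)
  qed
  then show ?thesis by (simp only: For_def wp_Seq wp_IWrite ival.simps)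
qed

text \<open>The index of \<open>Inv\<close> bounds the number of rounds left. At \<open>0\<close>
  the second assumption has no predecessor to offer, so \<open>Inv 0\<close> refutes the
  guard.\<close>

lemma wp_While_count:
  assumes "Inv n s"
    and "\<And>i s. Inv i s \<Longrightarrow> bval b s \<Longrightarrow> \<exists>j. i = Suc j \<and> wp c (\<lambda>t s'. t \<le> B \<and> Inv j s') s"
  shows "wp (While b c) (\<lambda>t s'. t \<le> n * (B + 1) + 1 \<and> (\<exists>i. Inv i s') \<and> \<not> bval b s') s"
  using assms(1)
proof (induction n arbitrary: s)
  case 0
  then have "\<not> bval b s" using assms(2) by blast
  then show ?case using 0 exec.WhileFalse unfolding wp_def by fastforce
next
  case (Suc n)
  show ?case
  proof (cases "bval b s")
    case True
    then obtain t s' where 1: "exec c s t s'" "t \<le> B" "Inv n s'"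
      using assms(2)[OF Suc.prems] unfolding wp_def by blast
    then obtain t' s'' where 2: "exec (While b c) s' t' s''" "t' \<le> n * (B + 1) + 1"
        "\<exists>i. Inv i s''" "\<not> bval b s''"
      using Suc.IH unfolding wp_def by blast
    have "exec (While b c) s (1 + t + t') s''" using exec.WhileTrue[OF True 1(1) 2(1)] .
    then show ?thesis using 1(2) 2(2-) unfolding wp_def by (intro exI[of _ "1 + t + t'"] exI[of _ s'']) simp
  next
    case False
    then show ?thesis using exec.WhileFalse[OF False] Suc.prems unfolding wp_def by fastforce
  qed
qed

definition frame :: "string set \<Rightarrow> state \<Rightarrow> state \<Rightarrow> bool" where
  "frame X s s' \<longleftrightarrow> rmem s' = rmem s \<and> (\<forall>x. x \<notin> X \<longrightarrow> imem s' x = imem s x)"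

lemma frame_refl [simp]: "frame X s s"
  and frame_iwrite [simp]: "x \<in> X \<Longrightarrow> frame X s (iwrite x i v s') \<longleftrightarrow> frame X s s'"
  by (auto simp: frame_def)

section \<open>Bottom-up merge sort of the product indices\<close>

definition sort_vars :: "string set" where
  "sort_vars = {''ord'', ''aux'', ''w'', ''lo'', ''mid'', ''hi'', ''a'', ''b'', ''k''}"

definition merge_prog :: "(iexp \<Rightarrow> iexp \<Rightarrow> bexp) \<Rightarrow> com" where
  "merge_prog cmp =
    Seq (Assign ''a'' (Var ''lo'')) (Seq (Assign ''b'' (Var ''mid'')) (Seq (Assign ''k'' (Var ''lo''))
    (While (ILess (Var ''k'') (Var ''hi''))
      (Seq
        (If (BAnd (ILess (Var ''a'') (Var ''mid''))
              (BNot (BAnd (ILess (Var ''b'') (Var ''hi''))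
                (cmp (IRead ''ord'' (Var ''a'')) (IRead ''ord'' (Var ''b''))))))
          (Seq (IWrite ''aux'' (Var ''k'') (IRead ''ord'' (Var ''a'')))
               (Assign ''a'' (IAdd (Var ''a'') (IConst 1))))
          (Seq (IWrite ''aux'' (Var ''k'') (IRead ''ord'' (Var ''b'')))
               (Assign ''b'' (IAdd (Var ''b'') (IConst 1)))))
        (Assign ''k'' (IAdd (Var ''k'') (IConst 1)))))))"

definition clamp :: "string \<Rightarrow> iexp \<Rightarrow> com" where
  "clamp x e = Seq (Assign x e) (If (ILess (Var ''m'') (Var x)) (Assign x (Var ''m'')) Skip)"

definition pass_prog :: "(iexp \<Rightarrow> iexp \<Rightarrow> bexp) \<Rightarrow> com" where
  "pass_prog cmp =
    Seq (Assign ''lo'' (IConst 0))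
    (Seq
      (While (ILess (Var ''lo'') (Var ''m''))
        (Seq (clamp ''mid'' (IAdd (Var ''lo'') (Var ''w'')))
        (Seq (clamp ''hi'' (IAdd (Var ''mid'') (Var ''w'')))
        (Seq (merge_prog cmp) (Assign ''lo'' (Var ''hi''))))))
      (For ''k'' (Var ''m'') (IWrite ''ord'' (Var ''k'') (IRead ''aux'' (Var ''k'')))))"

text \<open>The language has no procedures, so the recursion is unrolled into passes over runs of
  width \<open>w\<close>. Doubling needs only addition, and no midpoint has to be computed by
  division.\<close>

definition sort_prog :: "(iexp \<Rightarrow> iexp \<Rightarrow> bexp) \<Rightarrow> com" where
  "sort_prog cmp =
    Seq (For ''k'' (Var ''m'') (IWrite ''ord'' (Var ''k'') (Var ''k'')))
    (Seq (Assign ''w'' (IConst 1))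
      (While (ILess (Var ''w'') (Var ''m''))
        (Seq (pass_prog cmp) (Assign ''w'' (IAdd (Var ''w'') (Var ''w''))))))"

lemma wp_clamp:
  assumes "x \<noteq> ''m''"
  shows "wp (clamp x e) (\<lambda>t s'. t = 3 \<and> frame {x} s s' \<and>
    imem s' x 0 = min (imem s ''m'' 0) (ival e s)) s"
  using assms by (simp add: clamp_def)

definition segment :: "(int \<Rightarrow> 'a) \<Rightarrow> int \<Rightarrow> int \<Rightarrow> 'a multiset" where
  "segment f x y = image_mset f (mset_set {x..<y})"

lemma segment_empty [simp]: "y \<le> x \<Longrightarrow> segment f x y = {#}"
  by (simp add: segment_def)

lemma segment_append: "x \<le> y \<Longrightarrow> y \<le> z \<Longrightarrow> segment f x z = segment f x y + segment f y z"
proof -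
  assume "x \<le> y" "y \<le> z"
  then have "{x..<z} = {x..<y} \<union> {y..<z}" by auto
  then show ?thesis unfolding segment_def by (simp add: mset_set_Union)
qed

lemma segment_Suc: "x \<le> y \<Longrightarrow> segment f x (y + 1) = add_mset (f y) (segment f x y)"
proof -
  assume "x \<le> y"
  then have "{x..<y + 1} = insert y {x..<y}" by auto
  then show ?thesis unfolding segment_def by simp
qed

lemma segment_cong: "(\<And>i. x \<le> i \<Longrightarrow> i < y \<Longrightarrow> f i = g i) \<Longrightarrow> segment f x y = segment g x y"
  unfolding segment_def by (intro image_mset_cong) auto

text \<open>\<open>cmp\<close> may read any memory that sorting does not write; under
  \<open>frame\<close> its meaning is the fixed \<open>key\<close>. The key is defined on all
  integers because the merge test also evaluates \<open>cmp\<close> at positions beyond a run, where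
  the result is discarded.\<close>

locale sorting =
  fixes cmp :: "iexp \<Rightarrow> iexp \<Rightarrow> bexp" and key :: "int \<Rightarrow> real" and s0 :: state and m :: nat
  assumes m: "imem s0 ''m'' 0 = int m"
    and cmp: "\<And>s x y. frame sort_vars s0 s \<Longrightarrow>
      bval (cmp x y) s \<longleftrightarrow> key (ival x s) < key (ival y s)"
begin

definition descending :: "(int \<Rightarrow> int) \<Rightarrow> int \<Rightarrow> int \<Rightarrow> bool" where
  "descending f x y \<longleftrightarrow> (\<forall>i j. x \<le> i \<and> i \<le> j \<and> j < y \<longrightarrow> key (f j) \<le> key (f i))"

lemma descending_cong:
  "descending f x y \<Longrightarrow> (\<And>i. x \<le> i \<Longrightarrow> i < y \<Longrightarrow> f i = g i) \<Longrightarrow> descending g x y"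
  unfolding descending_def by (metis order.strict_trans1 order.trans)

text \<open>The merge invariant, with \<open>a\<close> and \<open>b\<close> the heads of the two
  runs and \<open>k\<close> the next output position. The domination clause, that whatever is
  written is at least whatever remains, allows the larger head to be appended.\<close>

definition merged :: "(int \<Rightarrow> int) \<Rightarrow> int \<Rightarrow> int \<Rightarrow> int \<Rightarrow> (int \<Rightarrow> int) \<Rightarrow> int \<Rightarrow> int \<Rightarrow> int \<Rightarrow> bool" where
  "merged f lo mid hi g a b k \<longleftrightarrow> k = a + b - mid \<and>
     lo \<le> a \<and> a \<le> mid \<and> mid \<le> b \<and> b \<le> hi \<and> descending g lo k \<and>
     (\<forall>i j. lo \<le> i \<and> i < k \<and> (a \<le> j \<and> j < mid \<or> b \<le> j \<and> j < hi) \<longrightarrow> key (f j) \<le> key (g i)) \<and>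
     segment g lo k = segment f lo a + segment f mid b"

lemma segment_update: "segment (g(k := v)) lo k = segment g lo k"
  by (intro segment_cong) auto

text \<open>The head at \<open>a\<close> is a maximum of the left run and at least the other head,
  hence at least everything that remains. \<open>merged_right\<close> is the mirror image.\<close>

lemma merged_left:
  assumes "merged f lo mid hi g a b k" "descending f lo mid" "descending f mid hi" "a < mid"
    and "b < hi \<Longrightarrow> key (f b) \<le> key (f a)"
  shows "merged f lo mid hi (g(k := f a)) (a + 1) b (k + 1)"
proof -
  from assms(1) have k: "k = a + b - mid" and inv: "lo \<le> a" "a \<le> mid" "mid \<le> b" "b \<le> hi" "descending g lo k"
    and ge: "\<And>i j. lo \<le> i \<and> i < k \<and> (a \<le> j \<and> j < mid \<or> b \<le> j \<and> j < hi) \<Longrightarrow> key (f j) \<le> key (g i)"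
    and seg: "segment g lo k = segment f lo a + segment f mid b"
    unfolding merged_def by auto
  have rest: "key (f j) \<le> key (f a)" if "a \<le> j \<and> j < mid \<or> b \<le> j \<and> j < hi" for j
    using that assms inv unfolding descending_def by (metis order.refl order.strict_trans1 order.trans)
  have "descending (g(k := f a)) lo (k + 1)"
    using inv(5) ge[of _ a] assms(4) unfolding descending_def by auto
  moreover have "key (f j) \<le> key ((g(k := f a)) i)"
    if "lo \<le> i \<and> i < k + 1 \<and> (a + 1 \<le> j \<and> j < mid \<or> b \<le> j \<and> j < hi)" for i j
    using that ge[of i j] rest[of j] by auto
  moreover have "segment (g(k := f a)) lo (k + 1) = segment f lo (a + 1) + segment f mid b"
    using inv k seg by (simp add: segment_Suc segment_update)
  ultimately show ?thesis unfolding merged_def using inv k assms(4) by auto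
qed

lemma merged_right:
  assumes "merged f lo mid hi g a b k" "descending f lo mid" "descending f mid hi" "b < hi"
    and "a < mid \<Longrightarrow> key (f a) \<le> key (f b)"
  shows "merged f lo mid hi (g(k := f b)) a (b + 1) (k + 1)"
proof -
  from assms(1) have k: "k = a + b - mid" and inv: "lo \<le> a" "a \<le> mid" "mid \<le> b" "b \<le> hi" "descending g lo k"
    and ge: "\<And>i j. lo \<le> i \<and> i < k \<and> (a \<le> j \<and> j < mid \<or> b \<le> j \<and> j < hi) \<Longrightarrow> key (f j) \<le> key (g i)"
    and seg: "segment g lo k = segment f lo a + segment f mid b"
    unfolding merged_def by auto
  have rest: "key (f j) \<le> key (f b)" if "a \<le> j \<and> j < mid \<or> b \<le> j \<and> j < hi" for j
    using that assms inv unfolding descending_def by (metis order.refl order.strict_trans1 order.trans)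
  have "descending (g(k := f b)) lo (k + 1)"
    using inv(5) ge[of _ b] assms(4) unfolding descending_def by auto
  moreover have "key (f j) \<le> key ((g(k := f b)) i)"
    if "lo \<le> i \<and> i < k + 1 \<and> (a \<le> j \<and> j < mid \<or> b + 1 \<le> j \<and> j < hi)" for i j
    using that ge[of i j] rest[of j] by auto
  moreover have "segment (g(k := f b)) lo (k + 1) = segment f lo a + segment f mid (b + 1)"
    using inv k seg by (simp add: segment_Suc segment_update)
  ultimately show ?thesis unfolding merged_def using inv k assms(4) by auto
qed

text \<open>From \<open>k = a + b - mid\<close> and the upper bounds on \<open>a\<close> and
  \<open>b\<close>, reaching \<open>hi\<close> forces both runs to be exhausted.\<close>

lemma merged_done:
  assumes "merged f lo mid hi g a b k" "hi \<le> k"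
  shows "descending g lo hi" "segment g lo hi = segment f lo hi"
proof -
  have "a = mid" "b = hi" "k = hi" using assms unfolding merged_def by auto
  then have "merged f lo mid hi g mid hi hi" using assms(1) by simp
  then show "descending g lo hi" "segment g lo hi = segment f lo hi"
    using segment_append[of lo mid hi f] by (simp_all add: merged_def)
qed

lemma wp_merge:
  assumes fr: "frame sort_vars s0 s" and scal: "imem s ''lo'' 0 = lo" "imem s ''mid'' 0 = mid" "imem s ''hi'' 0 = hi"
    and le: "lo \<le> mid" "mid \<le> hi"
    and desc: "descending (imem s ''ord'') lo mid" "descending (imem s ''ord'') mid hi"
  shows "wp (merge_prog cmp) (\<lambda>t s'. t \<le> 6 * nat (hi - lo) + 4 \<and>
    frame {''aux'', ''a'', ''b'', ''k''} s s' \<and>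
    (\<forall>i. i < lo \<longrightarrow> imem s' ''aux'' i = imem s ''aux'' i) \<and>
    descending (imem s' ''aux'') lo hi \<and>
    segment (imem s' ''aux'') lo hi = segment (imem s ''ord'') lo hi) s"
proof -
  define f where "f = imem s ''ord''"
  define s1 where "s1 = iwrite ''k'' 0 lo (iwrite ''b'' 0 mid (iwrite ''a'' 0 lo s))"
  define Inv where "Inv s' \<longleftrightarrow> frame {''aux'', ''a'', ''b'', ''k''} s s' \<and>
    (\<forall>i. i < lo \<longrightarrow> imem s' ''aux'' i = imem s ''aux'' i) \<and>
    merged f lo mid hi (imem s' ''aux'') (imem s' ''a'' 0) (imem s' ''b'' 0) (imem s' ''k'' 0)" for s'
  define pot where "pot s' = 6 * nat (hi - imem s' ''k'' 0)" for s' :: state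
  let ?b = "ILess (Var ''k'') (Var ''hi'')"
  have eqs: "imem s' ''ord'' = f" "imem s' ''mid'' 0 = mid" "imem s' ''hi'' 0 = hi" "frame sort_vars s0 s'"
    if "Inv s'" for s'
    using that scal fr unfolding Inv_def f_def frame_def sort_vars_def by auto
  have Inv1: "Inv s1" using le unfolding Inv_def s1_def merged_def descending_def by simp
  have "wp (While ?b
      (Seq
        (If (BAnd (ILess (Var ''a'') (Var ''mid''))
              (BNot (BAnd (ILess (Var ''b'') (Var ''hi''))
                (cmp (IRead ''ord'' (Var ''a'')) (IRead ''ord'' (Var ''b''))))))
          (Seq (IWrite ''aux'' (Var ''k'') (IRead ''ord'' (Var ''a'')))
               (Assign ''a'' (IAdd (Var ''a'') (IConst 1))))
          (Seq (IWrite ''aux'' (Var ''k'') (IRead ''ord'' (Var ''b'')))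
               (Assign ''b'' (IAdd (Var ''b'') (IConst 1)))))
        (Assign ''k'' (IAdd (Var ''k'') (IConst 1)))))
     (\<lambda>t s'. t \<le> pot s1 + 1 \<and> Inv s' \<and> \<not> bval ?b s') s1"
  proof (rule wp_While[of Inv, OF Inv1], goal_cases)
    case (1 s')
    note e = eqs[OF 1(1)]
    define a b k where "a = imem s' ''a'' 0" "b = imem s' ''b'' 0" "k = imem s' ''k'' 0"
    note abk = a_b_k_def[symmetric]
    have kh: "k < hi" and mg: "merged f lo mid hi (imem s' ''aux'') a b k"
      using 1 e by (simp_all add: Inv_def abk)
    then have k: "k = a + b - mid" by (simp add: merged_def)
    have fr': "frame {''aux'', ''a'', ''b'', ''k''} s s'" using 1 by (simp add: Inv_def)
    have old: "\<forall>i. i < lo \<longrightarrow> imem s' ''aux'' i = imem s ''aux'' i" using 1 by (simp add: Inv_def)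
    have klo: "lo \<le> k" using mg k unfolding merged_def by simp
    have pot: "nat (hi - k) = Suc (nat (hi - (k + 1)))" using kh by simp
    show ?case
    proof (cases "a < mid \<and> \<not> (b < hi \<and> key (f a) < key (f b))")
      case True
      then have "merged f lo mid hi ((imem s' ''aux'')(k := f a)) (a + 1) b (k + 1)"
        using merged_left[OF mg] desc unfolding f_def by auto
      then show ?thesis using True fr' old k klo pot
        by (simp add: cmp e abk Inv_def pot_def)
    next
      case False
      then have "b < hi" using k kh mg unfolding merged_def by auto
      then have "merged f lo mid hi ((imem s' ''aux'')(k := f b)) a (b + 1) (k + 1)"
        using False merged_right[OF mg] desc unfolding f_def by auto
      then show ?thesis using False fr' old k klo pot
        by (auto simp: cmp e abk Inv_def pot_def)
    qed
  qed
  then have "wp (merge_prog cmp) (\<lambda>t s'. t \<le> pot s1 + 4 \<and> Inv s' \<and> \<not> bval ?b s') s"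
    unfolding merge_prog_def using scal by (simp add: s1_def)
  then show ?thesis
  proof (rule wp_mono)
    fix t s' assume "t \<le> pot s1 + 4 \<and> Inv s' \<and> \<not> bval ?b s'"
    moreover from this have "merged f lo mid hi (imem s' ''aux'') (imem s' ''a'' 0) (imem s' ''b'' 0) (imem s' ''k'' 0)"
      "hi \<le> imem s' ''k'' 0" using eqs[of s'] by (auto simp: Inv_def)
    note merged_done[OF this]
    ultimately show "t \<le> 6 * nat (hi - lo) + 4 \<and> frame {''aux'', ''a'', ''b'', ''k''} s s' \<and>
      (\<forall>i. i < lo \<longrightarrow> imem s' ''aux'' i = imem s ''aux'' i) \<and>
      descending (imem s' ''aux'') lo hi \<and>
      segment (imem s' ''aux'') lo hi = segment (imem s ''ord'') lo hi"
      by (simp add: Inv_def pot_def s1_def f_def)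
  qed
qed

text \<open>Blocks are cut off at \<open>m\<close>; those starting beyond \<open>m\<close> are
  empty, so no bound on \<open>q\<close> has to be maintained.\<close>

definition runs :: "(int \<Rightarrow> int) \<Rightarrow> int \<Rightarrow> bool" where
  "runs f w \<longleftrightarrow> (\<forall>q\<ge>0. descending f (q * w) (min (int m) (q * w + w)))"

lemma wp_pass:
  assumes fr: "frame sort_vars s0 s" and w: "imem s ''w'' 0 = w" "w > 0"
    and runs: "runs (imem s ''ord'') w"
  shows "wp (pass_prog cmp) (\<lambda>t s'. t \<le> 30 * m + 10 \<and> frame (sort_vars - {''w''}) s s' \<and>
    runs (imem s' ''ord'') (w + w) \<and>
    segment (imem s' ''ord'') 0 (int m) = segment (imem s ''ord'') 0 (int m)) s"
proof -
  define f where "f = imem s ''ord''"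
  define X where "X = {''aux'', ''a'', ''b'', ''k'', ''lo'', ''mid'', ''hi''}"
  \<comment> \<open>\<open>q\<close> counts the finished blocks of the doubled width; only the last
    of them can be cut off by \<open>m\<close>.\<close>
  define merged_upto where "merged_upto g lo q \<longleftrightarrow> 0 \<le> q \<and> lo = min (int m) (q * (w + w)) \<and>
    (\<forall>q'. 0 \<le> q' \<and> q' < q \<longrightarrow> descending g (q' * (w + w)) (min (int m) (q' * (w + w) + (w + w)))) \<and>
    segment g 0 lo = segment f 0 lo" for g lo q
  define Inv where "Inv s' \<longleftrightarrow> frame X s s' \<and>
    (\<exists>q. merged_upto (imem s' ''aux'') (imem s' ''lo'' 0) q)" for s'
  \<comment> \<open>A round that merges \<open>l \<ge> 1\<close> entries costs at most
    \<open>6 * l + 12\<close> steps with its test, which \<open>20 * l\<close> covers.\<close>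
  define pot where "pot s' = 20 * nat (int m - imem s' ''lo'' 0)" for s' :: state
  define Copy where "Copy i s' \<longleftrightarrow> frame (sort_vars - {''w''}) s s' \<and>
    runs (imem s' ''aux'') (w + w) \<and> segment (imem s' ''aux'') 0 (int m) = segment f 0 (int m) \<and>
    (\<forall>j. 0 \<le> j \<and> j < int i \<longrightarrow> imem s' ''ord'' j = imem s' ''aux'' j)" for i s'
  have m_s: "imem s' ''m'' 0 = int m" if "frame (sort_vars - {''w''}) s s'" for s'
    using that fr m by (auto simp: frame_def sort_vars_def)
  have Xsub: "frame (sort_vars - {''w''}) s s'" if "frame X s s'" for s'
    using that by (auto simp: frame_def sort_vars_def X_def)
  have Inv0: "Inv (iwrite ''lo'' 0 0 s)"
    unfolding Inv_def merged_upto_def by (auto simp: X_def intro!: exI[of _ 0])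
  have body: "wp
     (Seq (clamp ''mid'' (IAdd (Var ''lo'') (Var ''w'')))
     (Seq (clamp ''hi'' (IAdd (Var ''mid'') (Var ''w'')))
     (Seq (merge_prog cmp) (Assign ''lo'' (Var ''hi'')))))
     (\<lambda>t s'. Inv s' \<and> pot s' + t + 1 \<le> pot s1) s1"
    if "Inv s1" and lt: "bval (ILess (Var ''lo'') (Var ''m'')) s1" for s1
  proof -
    from that(1) obtain q where frX: "frame X s s1" and mq: "merged_upto (imem s1 ''aux'') (imem s1 ''lo'' 0) q"
      unfolding Inv_def by blast
    define lo where "lo = imem s1 ''lo'' 0"
    define mid where "mid = min (int m) (lo + w)"
    define hi where "hi = min (int m) (mid + w)"
    have e1: "imem s1 ''m'' 0 = int m" "imem s1 ''w'' 0 = w" "imem s1 ''ord'' = f"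
      using m_s[OF Xsub[OF frX]] frX w by (auto simp: frame_def X_def f_def)
    have "lo < int m" using lt e1 by (simp add: lo_def)
    then have lo: "lo = q * (w + w)" "0 \<le> q" using mq by (auto simp: merged_upto_def lo_def)
    have lohi: "0 \<le> lo" "lo < mid" "mid \<le> hi" "hi \<le> int m"
      using lo w \<open>lo < int m\<close> by (auto simp: mid_def hi_def)
    have hi_eq: "hi = min (int m) (lo + (w + w))" using w by (simp add: hi_def mid_def)
    have "descending f (2 * q * w) (min (int m) (2 * q * w + w))"
      "descending f ((2 * q + 1) * w) (min (int m) ((2 * q + 1) * w + w))"
      using runs lo(2) unfolding runs_def f_def by auto
    moreover have "2 * q * w = lo" "(2 * q + 1) * w = lo + w" using lo by (simp_all add: algebra_simps)
    ultimately have desc1: "descending f lo mid" and "descending f (lo + w) (min (int m) (lo + w + w))"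
      by (simp_all add: mid_def)
    \<comment> \<open>If \<open>lo + w\<close> lies beyond \<open>m\<close>, then
      \<open>mid = hi = m\<close> and the right run is empty.\<close>
    then have desc2: "descending f mid hi"
      by (cases "lo + w \<le> int m") (auto simp: hi_def mid_def descending_def)
    have fin: "Inv (iwrite ''lo'' 0 hi s4)" if fr4: "frame X s s4"
      and aux: "\<forall>i. i < lo \<longrightarrow> imem s4 ''aux'' i = imem s1 ''aux'' i"
      and d: "descending (imem s4 ''aux'') lo hi"
      and seg: "segment (imem s4 ''aux'') lo hi = segment f lo hi" for s4
    proof -
      let ?g = "imem s1 ''aux''" and ?g' = "imem s4 ''aux''"
      have "descending ?g' (q' * (w + w)) (min (int m) (q' * (w + w) + (w + w)))"
        if "0 \<le> q'" "q' < q + 1" for q'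
      proof (cases "q' = q")
        case True
        then show ?thesis using d lo hi_eq by simp
      next
        case False
        then have "(q' + 1) * (w + w) \<le> q * (w + w)" using that w by (intro mult_right_mono) auto
        then have "q' * (w + w) + (w + w) \<le> lo" using lo by (simp add: algebra_simps)
        moreover have "descending ?g (q' * (w + w)) (min (int m) (q' * (w + w) + (w + w)))"
          using mq False that unfolding merged_upto_def by auto
        ultimately show ?thesis using aux by (elim descending_cong) auto
      qed
      moreover have "hi = min (int m) ((q + 1) * (w + w))" using hi_eq lo by (simp add: algebra_simps)
      moreover have "segment ?g' 0 hi = segment f 0 hi"
      proof -
        have "segment ?g' 0 lo = segment ?g 0 lo" using aux by (intro segment_cong) auto
        also have "\<dots> = segment f 0 lo" using mq unfolding lo_def merged_upto_def by blast
        finally show ?thesis using seg lohi segment_append[of 0 lo hi f] segment_append[of 0 lo hi ?g'] by simp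
      qed
      ultimately have "merged_upto ?g' hi (q + 1)" using lo unfolding merged_upto_def by simp
      then show ?thesis using fr4 unfolding Inv_def by (auto simp: X_def)
    qed
    have pot: "pot s1 = 20 * nat (int m - lo)" by (simp add: pot_def lo_def)
    have nat: "nat (int m - lo) = nat (int m - hi) + nat (hi - lo)" "nat (hi - lo) \<ge> 1"
      using lohi by arith+
    show ?thesis unfolding wp_Seq
    proof (rule wp_mono[OF wp_clamp], simp)
      fix t2 :: nat and s2 assume 2: "t2 = 3 \<and> frame {''mid''} s1 s2 \<and>
        imem s2 ''mid'' 0 = min (imem s1 ''m'' 0) (ival (IAdd (Var ''lo'') (Var ''w'')) s1)"
      then have s2: "imem s2 ''mid'' 0 = mid" "imem s2 ''m'' 0 = int m" "imem s2 ''w'' 0 = w" "frame X s s2"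
        "imem s2 ''aux'' = imem s1 ''aux''" "imem s2 ''lo'' 0 = lo"
        using e1 frX by (auto simp: frame_def X_def mid_def lo_def)
      show "wp (clamp ''hi'' (IAdd (Var ''mid'') (Var ''w''))) (\<lambda>t2a. wp (merge_prog cmp)
        (\<lambda>t1. wp (Assign ''lo'' (Var ''hi'')) (\<lambda>t2b s'. Inv s' \<and> pot s' + (t2 + (t2a + (t1 + t2b))) + 1 \<le> pot s1))) s2"
      proof (rule wp_mono[OF wp_clamp], simp)
        fix t3 :: nat and s3 assume 3: "t3 = 3 \<and> frame {''hi''} s2 s3 \<and>
          imem s3 ''hi'' 0 = min (imem s2 ''m'' 0) (ival (IAdd (Var ''mid'') (Var ''w'')) s2)"
        then have s3: "imem s3 ''mid'' 0 = mid" "imem s3 ''hi'' 0 = hi" "frame X s s3"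
          "imem s3 ''aux'' = imem s1 ''aux''" "imem s3 ''lo'' 0 = lo"
          using s2 by (auto simp: frame_def X_def hi_def)
        then have ord3: "imem s3 ''ord'' = f" by (auto simp: frame_def X_def f_def)
        have "frame sort_vars s0 s3" using fr s3(3) by (auto simp: frame_def X_def sort_vars_def)
        note merge = wp_merge[OF this s3(5,1,2), unfolded ord3, OF less_imp_le[OF lohi(2)] lohi(3) desc1 desc2]
        show "wp (merge_prog cmp) (\<lambda>t1. wp (Assign ''lo'' (Var ''hi''))
          (\<lambda>t2b s'. Inv s' \<and> pot s' + (t2 + (t3 + (t1 + t2b))) + 1 \<le> pot s1)) s3"
        proof (rule wp_mono[OF merge], unfold wp_IWrite)
          fix t4 s4 assume 4: "t4 \<le> 6 * nat (hi - lo) + 4 \<and>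
            frame {''aux'', ''a'', ''b'', ''k''} s3 s4 \<and>
            (\<forall>i. i < lo \<longrightarrow> imem s4 ''aux'' i = imem s3 ''aux'' i) \<and>
            descending (imem s4 ''aux'') lo hi \<and> segment (imem s4 ''aux'') lo hi = segment f lo hi"
          then have s4: "frame X s s4" "imem s4 ''hi'' 0 = hi" using s3 by (auto simp: frame_def X_def)
          have "Inv (iwrite ''lo'' 0 hi s4)" using fin[OF s4(1)] 4 s3 by simp
          then show "Inv (iwrite ''lo'' (ival (IConst 0) s4) (ival (Var ''hi'') s4) s4) \<and>
            pot (iwrite ''lo'' (ival (IConst 0) s4) (ival (Var ''hi'') s4) s4) + (t2 + (t3 + (t4 + 1))) + 1 \<le> pot s1"
            using 2 3 4 s4 nat pot by (simp add: pot_def)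
        qed
      qed
    qed
  qed
  have copy: "wp (For ''k'' (Var ''m'') (IWrite ''ord'' (Var ''k'') (IRead ''aux'' (Var ''k''))))
    (\<lambda>t s'. t \<le> m * (1 + 2) + 2 \<and> imem s' ''k'' 0 = int m \<and> Copy m s') s1"
    if "Inv s1" "\<not> bval (ILess (Var ''lo'') (Var ''m'')) s1" for s1
  proof (rule wp_For)
    from that obtain q where frX: "frame X s s1" and mq: "merged_upto (imem s1 ''aux'') (imem s1 ''lo'' 0) q"
      unfolding Inv_def by blast
    have lom: "imem s1 ''lo'' 0 = int m" "q * (w + w) \<ge> int m"
      using m_s[OF Xsub[OF frX]] mq that(2) by (auto simp: merged_upto_def)
    have "descending (imem s1 ''aux'') (q' * (w + w)) (min (int m) (q' * (w + w) + (w + w)))"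
      if "0 \<le> q'" for q'
    proof (cases "q' < q")
      case True
      then show ?thesis using mq that by (simp add: merged_upto_def)
    next
      case False
      then have "q * (w + w) \<le> q' * (w + w)" using w by (intro mult_right_mono) auto
      then show ?thesis using lom by (auto simp: descending_def)
    qed
    then have "runs (imem s1 ''aux'') (w + w)" by (simp add: runs_def)
    then show "Copy 0 (iwrite ''k'' 0 0 s1)"
      using Xsub[OF frX] mq lom by (simp add: Copy_def merged_upto_def sort_vars_def)
  next
    fix i s' assume "Copy i s'"
    then show "ival (Var ''m'') s' = int m" using m_s by (simp add: Copy_def)
  next
    fix i s' assume i: "i < m" "imem s' ''k'' 0 = int i" "Copy i s'"
    show "wp (IWrite ''ord'' (Var ''k'') (IRead ''aux'' (Var ''k''))) (\<lambda>t s'. t \<le> 1 \<and>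
      imem s' ''k'' 0 = int i \<and> Copy (Suc i) (iwrite ''k'' 0 (int (Suc i)) s')) s'"
      using i by (auto simp: Copy_def sort_vars_def)
  qed
  have "wp (pass_prog cmp) (\<lambda>t s'. t \<le> 30 * m + 10 \<and> Copy m s') s"
    unfolding pass_prog_def wp_Seq wp_IWrite ival.simps
  proof (rule wp_mono[OF wp_While[of Inv, OF Inv0 body]], assumption, assumption)
    fix t s1 assume a: "t \<le> pot (iwrite ''lo'' 0 0 s) + 1 \<and> Inv s1 \<and> \<not> bval (ILess (Var ''lo'') (Var ''m'')) s1"
    show "wp (For ''k'' (Var ''m'') (IWrite ''ord'' (Var ''k'') (IRead ''aux'' (Var ''k''))))
      (\<lambda>t2 s'. 1 + (t + t2) \<le> 30 * m + 10 \<and> Copy m s') s1"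
      by (rule wp_mono[OF copy]) (use a in \<open>auto simp: pot_def\<close>)
  qed
  then show ?thesis
  proof (rule wp_mono)
    fix t s' assume a: "t \<le> 30 * m + 10 \<and> Copy m s'"
    then have eq: "imem s' ''ord'' j = imem s' ''aux'' j" if "0 \<le> j" "j < int m" for j
      using that by (simp add: Copy_def)
    have "descending (imem s' ''ord'') (q * (w + w)) (min (int m) (q * (w + w) + (w + w)))" if "q \<ge> 0" for q
    proof (rule descending_cong)
      show "descending (imem s' ''aux'') (q * (w + w)) (min (int m) (q * (w + w) + (w + w)))"
        using a that by (simp add: Copy_def runs_def)
      fix i assume i: "q * (w + w) \<le> i" "i < min (int m) (q * (w + w) + (w + w))"
      moreover have "0 \<le> q * (w + w)" using that w by simp
      ultimately show "imem s' ''aux'' i = imem s' ''ord'' i" by (intro eq[symmetric]) linarith+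
    qed
    then have "runs (imem s' ''ord'') (w + w)" by (simp add: runs_def)
    moreover have "segment (imem s' ''ord'') 0 (int m) = segment (imem s' ''aux'') 0 (int m)"
      by (intro segment_cong eq)
    ultimately show "t \<le> 30 * m + 10 \<and> frame (sort_vars - {''w''}) s s' \<and> runs (imem s' ''ord'') (w + w) \<and>
      segment (imem s' ''ord'') 0 (int m) = segment (imem s ''ord'') 0 (int m)"
      using a by (simp add: Copy_def f_def)
  qed
qed

text \<open>\<open>K\<close> is any exponent with \<open>m \<le> 2 ^ K\<close>: the rounded
  logarithm where the running time has to be sharp, and \<open>m\<close> itself where a polynomial
  bound is enough.\<close>

lemma wp_sort:
  assumes K: "m \<le> 2 ^ K"
  shows "wp (sort_prog cmp) (\<lambda>t s'. t \<le> (K + 1) * (30 * m + 20) \<and> frame sort_vars s0 s' \<and>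
    descending (imem s' ''ord'') 0 (int m) \<and>
    segment (imem s' ''ord'') 0 (int m) = segment (\<lambda>i. i) 0 (int m)) s0"
proof -
  define Init where "Init i s' \<longleftrightarrow> frame sort_vars s0 s' \<and>
    (\<forall>j. 0 \<le> j \<and> j < int i \<longrightarrow> imem s' ''ord'' j = j)" for i s'
  \<comment> \<open>\<open>j\<close> is the number of passes left. While the guard holds,
    \<open>2 ^ r < m \<le> 2 ^ K\<close>, so \<open>j = K - r\<close> is positive.\<close>
  define Inv where "Inv j s' \<longleftrightarrow> frame sort_vars s0 s' \<and> (\<exists>r. r + j = K \<and> imem s' ''w'' 0 = 2 ^ r) \<and>
    runs (imem s' ''ord'') (imem s' ''w'' 0) \<and>
    segment (imem s' ''ord'') 0 (int m) = segment (\<lambda>i. i) 0 (int m)" for j s'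
  have m_s: "imem s' ''m'' 0 = int m" if "frame sort_vars s0 s'" for s'
    using that m by (auto simp: frame_def sort_vars_def)
  have init: "wp (For ''k'' (Var ''m'') (IWrite ''ord'' (Var ''k'') (Var ''k'')))
    (\<lambda>t s'. t \<le> m * (1 + 2) + 2 \<and> imem s' ''k'' 0 = int m \<and> Init m s') s0"
  proof (rule wp_For)
    fix i s' assume i: "i < m" "imem s' ''k'' 0 = int i" "Init i s'"
    then show "wp (IWrite ''ord'' (Var ''k'') (Var ''k'')) (\<lambda>t s'. t \<le> 1 \<and>
      imem s' ''k'' 0 = int i \<and> Init (Suc i) (iwrite ''k'' 0 (int (Suc i)) s')) s'"
      by (auto simp: Init_def sort_vars_def)
  qed (auto simp: Init_def sort_vars_def m_s[unfolded sort_vars_def])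
  have Inv0: "Inv K (iwrite ''w'' 0 1 s')" if "Init m s'" for s'
  proof -
    have "segment (imem s' ''ord'') 0 (int m) = segment (\<lambda>i. i) 0 (int m)"
      using that by (intro segment_cong) (auto simp: Init_def)
    moreover have "runs g 1" for g
    proof -
      have "key (g j) \<le> key (g i)" if "q \<le> i" "i \<le> j" "j < q + 1" for q i j
        using that by (cases "i = j") auto
      then show ?thesis unfolding runs_def descending_def by simp blast
    qed
    ultimately show ?thesis using that by (simp add: Inv_def Init_def sort_vars_def)
  qed
  have body: "\<exists>j'. j = Suc j' \<and> wp (Seq (pass_prog cmp) (Assign ''w'' (IAdd (Var ''w'') (Var ''w''))))
      (\<lambda>t s'. t \<le> 30 * m + 11 \<and> Inv j' s') s1"
    if inv: "Inv j s1" and lt: "bval (ILess (Var ''w'') (Var ''m'')) s1" for j s1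
  proof -
    have fr: "frame sort_vars s0 s1" using inv by (simp add: Inv_def)
    obtain r where r: "r + j = K" "imem s1 ''w'' 0 = 2 ^ r" using inv by (auto simp: Inv_def)
    have "(2::int) ^ r < int m" using lt r m_s[OF fr] by simp
    also have "\<dots> \<le> 2 ^ K" using K by (metis of_nat_le_iff of_nat_numeral of_nat_power)
    finally have "r < K" by simp
    then obtain j' where j': "j = Suc j'" using r by (cases j) auto
    have pass: "wp (pass_prog cmp) (\<lambda>t s'. t \<le> 30 * m + 10 \<and> frame (sort_vars - {''w''}) s1 s' \<and>
      runs (imem s' ''ord'') (2 ^ r + 2 ^ r) \<and>
      segment (imem s' ''ord'') 0 (int m) = segment (imem s1 ''ord'') 0 (int m)) s1"
      by (rule wp_pass) (use inv r in \<open>auto simp: Inv_def\<close>)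
    have "wp (Seq (pass_prog cmp) (Assign ''w'' (IAdd (Var ''w'') (Var ''w''))))
      (\<lambda>t s'. t \<le> 30 * m + 11 \<and> Inv j' s') s1"
      unfolding wp_Seq
    proof (rule wp_mono[OF pass], unfold wp_IWrite)
      fix t s' assume a: "t \<le> 30 * m + 10 \<and> frame (sort_vars - {''w''}) s1 s' \<and>
        runs (imem s' ''ord'') (2 ^ r + 2 ^ r) \<and>
        segment (imem s' ''ord'') 0 (int m) = segment (imem s1 ''ord'') 0 (int m)"
      then have "frame sort_vars s0 s'" "imem s' ''w'' 0 = 2 ^ r"
        using fr r by (auto simp: frame_def sort_vars_def)
      then show "t + 1 \<le> 30 * m + 11 \<and>
        Inv j' (iwrite ''w'' (ival (IConst 0) s') (ival (IAdd (Var ''w'') (Var ''w'')) s') s')"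
        using a inv r j' by (auto simp: Inv_def sort_vars_def intro!: exI[of _ "Suc r"])
    qed
    then show ?thesis using j' by blast
  qed
  show ?thesis unfolding sort_prog_def wp_Seq
  proof (rule wp_mono[OF init], unfold wp_IWrite, unfold ival.simps)
    fix t1 s1 assume 1: "t1 \<le> m * (1 + 2) + 2 \<and> imem s1 ''k'' 0 = int m \<and> Init m s1"
    show "wp (While (ILess (Var ''w'') (Var ''m'')) (Seq (pass_prog cmp) (Assign ''w'' (IAdd (Var ''w'') (Var ''w'')))))
      (\<lambda>t2 s'. t1 + (1 + t2) \<le> (K + 1) * (30 * m + 20) \<and> frame sort_vars s0 s' \<and>
        descending (imem s' ''ord'') 0 (int m) \<and>
        segment (imem s' ''ord'') 0 (int m) = segment (\<lambda>i. i) 0 (int m)) (iwrite ''w'' 0 1 s1)"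
    proof (rule wp_mono[OF wp_While_count[of Inv, OF Inv0 body]])
      show "Init m s1" using 1 by blast
      fix t s' assume a: "t \<le> K * (30 * m + 11 + 1) + 1 \<and> (\<exists>i. Inv i s') \<and>
        \<not> bval (ILess (Var ''w'') (Var ''m'')) s'"
      then obtain i where i: "Inv i s'" by blast
      then have fr: "frame sort_vars s0 s'" by (simp add: Inv_def)
      have "int m \<le> imem s' ''w'' 0" using a m_s[OF fr] by simp
      moreover have "descending (imem s' ''ord'') (0 * imem s' ''w'' 0)
          (min (int m) (0 * imem s' ''w'' 0 + imem s' ''w'' 0))"
        using i unfolding Inv_def runs_def by blast
      ultimately have "descending (imem s' ''ord'') 0 (int m)" by simp
      moreover have "t1 + (1 + t) \<le> (K + 1) * (30 * m + 20)" using 1 a by (simp add: algebra_simps)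
      ultimately show "t1 + (1 + t) \<le> (K + 1) * (30 * m + 20) \<and> frame sort_vars s0 s' \<and>
        descending (imem s' ''ord'') 0 (int m) \<and>
        segment (imem s' ''ord'') 0 (int m) = segment (\<lambda>i. i) 0 (int m)"
        using i by (simp add: Inv_def)
    qed
  qed
qed

end

section \<open>Scheduling programs\<close>

text \<open>With the flag set, the programs read the roles of sources and sinks and of the two carry
  capacities interchanged, so that they work on \<open>swap_inst I\<close>.\<close>

definition src_name :: "bool \<Rightarrow> string" where "src_name r = (if r then ''t'' else ''s'')"
definition snk_name :: "bool \<Rightarrow> string" where "snk_name r = (if r then ''s'' else ''t'')"
definition out_name :: "bool \<Rightarrow> string" where "out_name r = (if r then ''d-'' else ''d+'')"
definition in_name :: "bool \<Rightarrow> string" where "in_name r = (if r then ''d+'' else ''d-'')"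

lemma input_name_neq [simp]:
  "x \<noteq> ''s'' \<Longrightarrow> x \<noteq> ''t'' \<Longrightarrow> src_name r \<noteq> x" "x \<noteq> ''s'' \<Longrightarrow> x \<noteq> ''t'' \<Longrightarrow> x \<noteq> src_name r"
  "x \<noteq> ''s'' \<Longrightarrow> x \<noteq> ''t'' \<Longrightarrow> snk_name r \<noteq> x" "x \<noteq> ''s'' \<Longrightarrow> x \<noteq> ''t'' \<Longrightarrow> x \<noteq> snk_name r"
  "x \<noteq> ''d+'' \<Longrightarrow> x \<noteq> ''d-'' \<Longrightarrow> out_name r \<noteq> x" "x \<noteq> ''d+'' \<Longrightarrow> x \<noteq> ''d-'' \<Longrightarrow> x \<noteq> out_name r"
  "x \<noteq> ''d+'' \<Longrightarrow> x \<noteq> ''d-'' \<Longrightarrow> in_name r \<noteq> x" "x \<noteq> ''d+'' \<Longrightarrow> x \<noteq> ''d-'' \<Longrightarrow> x \<noteq> in_name r"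
  by (auto simp: src_name_def snk_name_def out_name_def in_name_def)

text \<open>\<open>I\<close> is the instance that the program works on; with \<open>r\<close> set,
  the memory encodes \<open>swap_inst I\<close>. Only entries in range are fixed, and scratch arrays
  do not occur, so the programs preserve the property.\<close>

definition reads :: "bool \<Rightarrow> inst \<Rightarrow> state \<Rightarrow> bool" where
  "reads r I s \<longleftrightarrow> imem s ''m'' 0 = int (nP I) \<and>
    (\<forall>p<nP I. imem s (src_name r) (int p) = int (src I p) \<and> imem s (snk_name r) (int p) = int (snk I p) \<and>
      imem s ''tau'' (int p) = int (transit I p) \<and> rmem s ''size'' (int p) = psize I p) \<and>
    (\<forall>w<nW I. rmem s (out_name r) (int w) = enc_cap (carry_out I w) \<and>
      rmem s (in_name r) (int w) = enc_cap (carry_in I w))"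

lemma reads_iwrite [simp]:
  "x \<notin> {''m'', ''s'', ''t'', ''tau''} \<Longrightarrow> reads r I (iwrite x i v s) = reads r I s"
  by (auto simp: reads_def)

lemma reads_rwrite [simp]:
  "x \<notin> {''size'', ''d+'', ''d-''} \<Longrightarrow> reads r I (rwrite x i v s) = reads r I s"
  by (auto simp: reads_def)

lemma reads_frame: "frame sort_vars s s' \<Longrightarrow> reads r I s \<Longrightarrow> reads r I s'"
  unfolding reads_def by (auto simp: frame_def sort_vars_def src_name_def snk_name_def)

lemma readsD:
  assumes "reads r I s"
  shows "imem s ''m'' 0 = int (nP I)"
    "p < nP I \<Longrightarrow> imem s (src_name r) (int p) = int (src I p)"
    "p < nP I \<Longrightarrow> imem s (snk_name r) (int p) = int (snk I p)"
    "p < nP I \<Longrightarrow> imem s ''tau'' (int p) = int (transit I p)"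
    "p < nP I \<Longrightarrow> rmem s ''size'' (int p) = psize I p"
    "w < nW I \<Longrightarrow> rmem s (out_name r) (int w) = enc_cap (carry_out I w)"
    "w < nW I \<Longrightarrow> rmem s (in_name r) (int w) = enc_cap (carry_in I w)"
  using assms by (auto simp: reads_def)

lemma reads_input_state:
  "reads r (if r then swap_inst I else I) (input_state I)"
  by (auto simp: reads_def input_state_def input_array_def src_name_def snk_name_def out_name_def in_name_def)

definition IEq :: "iexp \<Rightarrow> iexp \<Rightarrow> bexp" where
  "IEq a b = BAnd (BNot (ILess a b)) (BNot (ILess b a))"

lemma bval_IEq [simp]: "bval (IEq a b) s \<longleftrightarrow> ival a s = ival b s"
  by (auto simp: IEq_def)

text \<open>A negative \<open>d\<close> encodes an infinite capacity and passes the test.\<close>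

definition fits_cap :: "rexp \<Rightarrow> rexp \<Rightarrow> bexp" where
  "fits_cap x d = BNot (BAnd (BNot (RLess d (RConst 0))) (RLess d x))"

lemma bval_fits_cap:
  assumes "0 \<le> c" "rval d s = enc_cap c"
  shows "bval (fits_cap x d) s \<longleftrightarrow> ereal (rval x s) \<le> c"
  using assms by (cases c) (auto simp: fits_cap_def enc_cap_def)

text \<open>\<open>pos\<close> is the inverse of the permutation stored in \<open>ord\<close>.
  Surjectivity provides a product at every position a loop visits.\<close>

definition ordered :: "inst \<Rightarrow> (nat \<Rightarrow> nat) \<Rightarrow> state \<Rightarrow> bool" where
  "ordered I pos s \<longleftrightarrow> (\<forall>p<nP I. pos p < nP I \<and> imem s ''ord'' (int (pos p)) = int p) \<and>
    pos ` {..<nP I} = {..<nP I}"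

lemma ordered_iwrite [simp]: "x \<noteq> ''ord'' \<Longrightarrow> ordered I pos (iwrite x i v s) = ordered I pos s"
  and ordered_rwrite [simp]: "ordered I pos (rwrite x i u s) = ordered I pos s"
  by (auto simp: ordered_def)

lemma ordered_inj: "ordered I pos s \<Longrightarrow> inj_on pos (products I)"
  unfolding ordered_def inj_on_def products_def by (metis lessThan_iff of_nat_eq_iff)

lemma orderedE:
  assumes "ordered I pos s" "i < nP I"
  obtains p where "p < nP I" "pos p = i" "imem s ''ord'' (int i) = int p"
  using assms unfolding ordered_def by (metis imageE lessThan_iff)

definition processed :: "inst \<Rightarrow> (nat \<Rightarrow> nat) \<Rightarrow> nat \<Rightarrow> nat set" where
  "processed I pos i = {q \<in> products I. pos q < i}"

lemma processed_0 [simp]: "processed I pos 0 = {}"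
  and before_eq_processed: "before I pos p = processed I pos (pos p)"
  and finite_processed [simp]: "finite (processed I pos i)"
  by (auto simp: processed_def before_def)

lemma processed_Suc:
  "inj_on pos (products I) \<Longrightarrow> p \<in> products I \<Longrightarrow>
    processed I pos (Suc (pos p)) = insert p (processed I pos (pos p))"
  by (auto simp: processed_def inj_on_def less_Suc_eq)

lemma processed_all: "ordered I pos s \<Longrightarrow> processed I pos (nP I) = products I"
  by (auto simp: processed_def ordered_def products_def)

lemma load_cong: "(\<And>q. q \<in> X \<Longrightarrow> f q = g q) \<Longrightarrow> load s X f \<theta> = load s X g \<theta>"
  unfolding load_def by (intro sum.cong) auto

lemma fits_cong:
  assumes "\<And>q. q \<in> X \<Longrightarrow> \<phi> q = \<phi>' q"
  shows "fits_out I \<phi> X p \<theta> = fits_out I \<phi>' X p \<theta>" "fits_in I \<phi> X p \<theta> = fits_in I \<phi>' X p \<theta>"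
proof -
  have "load (psize I) {q \<in> X. src I q = src I p} \<phi> \<theta> = load (psize I) {q \<in> X. src I q = src I p} \<phi>' \<theta>"
    by (rule load_cong) (use assms in auto)
  then show "fits_out I \<phi> X p \<theta> = fits_out I \<phi>' X p \<theta>" by (simp add: fits_out_def)
  have "load (psize I) {q \<in> X. snk I q = snk I p} (\<lambda>q. \<phi> q + transit I q) \<theta>'
    = load (psize I) {q \<in> X. snk I q = snk I p} (\<lambda>q. \<phi>' q + transit I q) \<theta>'" for \<theta>'
    by (rule load_cong) (use assms in auto)
  then show "fits_in I \<phi> X p \<theta> = fits_in I \<phi>' X p \<theta>" by (simp add: fits_in_def)
qed

text \<open>Changing the schedule at \<open>q\<close> affects neither \<open>q\<close>'s own tests
  nor those of products before \<open>q\<close>, as these look only at still earlier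
  products.\<close>

lemma greedy_at_update:
  assumes "pos p < pos q \<or> p = q" "p \<noteq> q \<Longrightarrow> greedy_at I pos \<phi> p"
    "p = q \<Longrightarrow> fits_out I \<phi> (before I pos q) q \<theta> \<and> fits_in I \<phi> (before I pos q) q \<theta> \<and>
      (\<forall>\<theta>'<\<theta>. \<not> (fits_out I \<phi> (before I pos q) q \<theta>' \<and> fits_in I \<phi> (before I pos q) q \<theta>'))"
  shows "greedy_at I pos (\<phi>(q := \<theta>)) p"
proof -
  have "(\<phi>(q := \<theta>)) x = \<phi> x" if "x \<in> before I pos p" for x
    using that assms(1) by (auto simp: before_def)
  note fits_cong[where \<phi> = "\<phi>(q := \<theta>)" and \<phi>' = \<phi> and X = "before I pos p", OF this]
  then show ?thesis unfolding greedy_at_def using assms(2,3) by (auto simp: greedy_at_def)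
qed

lemma load_empty [simp]: "load s {} f \<theta> = 0"
  by (simp add: load_def)

lemma load_insert:
  "finite X \<Longrightarrow> p \<notin> X \<Longrightarrow> load s (insert p X) f \<theta> = (if f p = \<theta> then load s X f \<theta> + s p else load s X f \<theta>)"
proof -
  assume *: "finite X" "p \<notin> X"
  have "{q \<in> insert p X. f q = \<theta>} = (if f p = \<theta> then insert p {q \<in> X. f q = \<theta>} else {q \<in> X. f q = \<theta>})"
    by auto
  then show ?thesis using * by (simp add: load_def)
qed

text \<open>Each product occupies one departure slot and one arrival slot, so it spoils at most two
  starting times of \<open>p\<close>. Among \<open>2 * nP I + 1\<close> starting times one meets no
  load at all. The bound is independent of the transit times, which keeps the search
  polynomial.\<close>

lemma fits_existing_slot:
  assumes valid: "valid_inst I" and p: "p \<in> products I"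
  obtains \<theta> where "\<theta> \<le> 2 * nP I" "fits_out I \<phi> (before I pos p) p \<theta>" "fits_in I \<phi> (before I pos p) p \<theta>"
proof -
  \<comment> \<open>If \<open>q\<close> arrives too early to meet \<open>p\<close>, the truncated
    difference is \<open>0\<close> and merely excludes one harmless candidate.\<close>
  define Z where "Z = \<phi> ` products I \<union> (\<lambda>q. \<phi> q + transit I q - transit I p) ` products I"
  have "card Z \<le> card (\<phi> ` products I) + card ((\<lambda>q. \<phi> q + transit I q - transit I p) ` products I)"
    unfolding Z_def by (rule card_Un_le)
  also have "\<dots> \<le> card (products I) + card (products I)"
    by (intro add_mono card_image_le) auto
  finally have "card Z \<le> 2 * nP I" by (simp add: products_def)
  moreover have "finite Z" by (simp add: Z_def)
  ultimately have "\<not> {..2 * nP I} \<subseteq> Z" using card_mono[of Z "{..2 * nP I}"] by auto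
  then obtain \<theta> where \<theta>: "\<theta> \<le> 2 * nP I" "\<theta> \<notin> Z" by auto
  have "{q \<in> {q \<in> before I pos p. src I q = src I p}. \<phi> q = \<theta>} = {}"
    using \<theta>(2) by (auto simp: Z_def before_def)
  then have "load (psize I) {q \<in> before I pos p. src I q = src I p} \<phi> \<theta> = 0"
    unfolding load_def by (simp only: sum.empty)
  moreover have "{q \<in> {q \<in> before I pos p. snk I q = snk I p}. \<phi> q + transit I q = \<theta> + transit I p} = {}"
    using \<theta>(2) by (auto simp: Z_def before_def image_iff)
  then have "load (psize I) {q \<in> before I pos p. snk I q = snk I p} (\<lambda>q. \<phi> q + transit I q)
      (\<theta> + transit I p) = 0"
    unfolding load_def by (simp only: sum.empty)
  ultimately show ?thesis
    using that[OF \<theta>(1)] valid_instD[OF valid p] by (simp add: fits_out_def fits_in_def)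
qed

section \<open>Greedy scheduling by probing time slots\<close>

definition loads_prog :: "bool \<Rightarrow> com" where
  "loads_prog r =
    Seq (RAssign ''x'' (RConst 0)) (Seq (RAssign ''y'' (RConst 0)) (For ''j'' (Var ''i'')
      (Seq (Assign ''q'' (IRead ''ord'' (Var ''j'')))
      (Seq (If (BAnd (IEq (IRead (src_name r) (Var ''q'')) (IRead (src_name r) (Var ''p'')))
                     (IEq (IRead ''phi'' (Var ''q'')) (Var ''th'')))
              (RAssign ''x'' (RAdd (RVar ''x'') (RRead ''size'' (Var ''q'')))) Skip)
           (If (BAnd (IEq (IRead (snk_name r) (Var ''q'')) (IRead (snk_name r) (Var ''p'')))
                     (IEq (IAdd (IRead ''phi'' (Var ''q'')) (IRead ''tau'' (Var ''q'')))
                          (IAdd (Var ''th'') (IRead ''tau'' (Var ''p'')))))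
              (RAssign ''y'' (RAdd (RVar ''y'') (RRead ''size'' (Var ''q'')))) Skip)))))"

definition fits_exp :: "bool \<Rightarrow> bexp" where
  "fits_exp r = BAnd
    (fits_cap (RAdd (RVar ''x'') (RRead ''size'' (Var ''p'')))
      (RRead (out_name r) (IRead (src_name r) (Var ''p''))))
    (fits_cap (RAdd (RVar ''y'') (RRead ''size'' (Var ''p'')))
      (RRead (in_name r) (IRead (snk_name r) (Var ''p''))))"

text \<open>Both loads are recomputed from the earlier products for every slot probed. Linear work
  per slot and linearly many slots per product give a cubic bound, and no table indexed by time is
  kept.\<close>

definition greedy_prog :: "bool \<Rightarrow> com" where
  "greedy_prog r = For ''i'' (Var ''m'')
    (Seq (Assign ''p'' (IRead ''ord'' (Var ''i'')))
    (Seq (Assign ''th'' (IConst 0))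
    (Seq (loads_prog r)
    (Seq (While (BNot (fits_exp r)) (Seq (Assign ''th'' (IAdd (Var ''th'') (IConst 1))) (loads_prog r)))
      (IWrite ''phi'' (Var ''p'') (Var ''th''))))))"

text \<open>\<open>phi\<close> is tied to \<open>\<phi>\<close> only at the products before
  \<open>p\<close>; the other values of \<open>\<phi>\<close> remain free and are fixed as the
  products are placed.\<close>

definition searching :: "bool \<Rightarrow> inst \<Rightarrow> (nat \<Rightarrow> nat) \<Rightarrow> (nat \<Rightarrow> nat) \<Rightarrow> nat \<Rightarrow> nat \<Rightarrow> state \<Rightarrow> bool" where
  "searching r I pos \<phi> p \<theta> s \<longleftrightarrow> reads r I s \<and> ordered I pos s \<and> imem s ''i'' 0 = int (pos p) \<and>
    imem s ''p'' 0 = int p \<and> imem s ''th'' 0 = int \<theta> \<and>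
    (\<forall>q\<in>before I pos p. imem s ''phi'' (int q) = int (\<phi> q))"

definition loads_are :: "inst \<Rightarrow> (nat \<Rightarrow> nat) \<Rightarrow> nat set \<Rightarrow> nat \<Rightarrow> nat \<Rightarrow> state \<Rightarrow> bool" where
  "loads_are I \<phi> X p \<theta> s \<longleftrightarrow>
    rmem s ''x'' 0 = load (psize I) {q \<in> X. src I q = src I p} \<phi> \<theta> \<and>
    rmem s ''y'' 0 = load (psize I) {q \<in> X. snk I q = snk I p} (\<lambda>q. \<phi> q + transit I q) (\<theta> + transit I p)"

lemma wp_loads:
  assumes s: "searching r I pos \<phi> p \<theta> s" and p: "p < nP I"
  shows "wp (loads_prog r) (\<lambda>t s'. t \<le> 7 * nP I + 4 \<and> searching r I pos \<phi> p \<theta> s' \<and>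
    loads_are I \<phi> (before I pos p) p \<theta> s') s"
proof -
  have ord: "ordered I pos s" using s by (simp add: searching_def)
  then have pos: "pos p < nP I" using p by (simp add: ordered_def)
  define Inv where "Inv j s' \<longleftrightarrow> j \<le> pos p \<and> searching r I pos \<phi> p \<theta> s' \<and>
    loads_are I \<phi> (processed I pos j) p \<theta> s'" for j s'
  let ?s = "rwrite ''y'' 0 0 (rwrite ''x'' 0 0 s)"
  have step: "wp (Seq (Assign ''q'' (IRead ''ord'' (Var ''j'')))
      (Seq (If (BAnd (IEq (IRead (src_name r) (Var ''q'')) (IRead (src_name r) (Var ''p'')))
                     (IEq (IRead ''phi'' (Var ''q'')) (Var ''th'')))
              (RAssign ''x'' (RAdd (RVar ''x'') (RRead ''size'' (Var ''q'')))) Skip)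
           (If (BAnd (IEq (IRead (snk_name r) (Var ''q'')) (IRead (snk_name r) (Var ''p'')))
                     (IEq (IAdd (IRead ''phi'' (Var ''q'')) (IRead ''tau'' (Var ''q'')))
                          (IAdd (Var ''th'') (IRead ''tau'' (Var ''p'')))))
              (RAssign ''y'' (RAdd (RVar ''y'') (RRead ''size'' (Var ''q'')))) Skip)))
      (\<lambda>t s''. t \<le> 5 \<and> imem s'' ''j'' 0 = int j \<and> Inv (Suc j) (iwrite ''j'' 0 (int (Suc j)) s'')) s'"
    if j: "j < pos p" "imem s' ''j'' 0 = int j" "Inv j s'" for j s'
  proof -
    have sr: "searching r I pos \<phi> p \<theta> s'" and ld: "loads_are I \<phi> (processed I pos j) p \<theta> s'"
      using j by (auto simp: Inv_def)
    have rd: "reads r I s'" and or: "ordered I pos s'" using sr by (auto simp: searching_def)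
    obtain q where q: "q < nP I" "pos q = j" "imem s' ''ord'' (int j) = int q"
      using orderedE[OF or, of j] j(1) pos by auto
    then have qp: "q \<in> products I" "q \<in> before I pos p" using j by (auto simp: products_def before_def)
    have proc: "processed I pos (Suc j) = insert q (processed I pos j)" "q \<notin> processed I pos j"
      using processed_Suc[OF ordered_inj[OF ord] qp(1)] q by (auto simp: processed_def)
    have vals: "imem s' ''phi'' (int q) = int (\<phi> q)" "imem s' ''p'' 0 = int p" "imem s' ''th'' 0 = int \<theta>"
      using sr qp by (auto simp: searching_def)
    note rds = readsD(2,3,4,5)[OF rd q(1)] readsD(2,3,4,5)[OF rd p]
    have out: "load (psize I) {x. (x = q \<or> x \<in> processed I pos j) \<and> P x} f \<theta>' =
      (if P q \<and> f q = \<theta>' then load (psize I) {x \<in> processed I pos j. P x} f \<theta>' + psize I q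
       else load (psize I) {x \<in> processed I pos j. P x} f \<theta>')" for P f \<theta>'
    proof -
      have "{x. (x = q \<or> x \<in> processed I pos j) \<and> P x} =
        (if P q then insert q {x \<in> processed I pos j. P x} else {x \<in> processed I pos j. P x})" by auto
      then show ?thesis using proc(2) by (simp add: load_insert)
    qed
    have "(int (\<phi> q) + int (transit I q) = int \<theta> + int (transit I p)) =
      (\<phi> q + transit I q = \<theta> + transit I p)" by linarith
    note simps = j(2) q(3) vals rds this
    \<comment> \<open>One equation for each combination of the two conditional additions.\<close>
    have srw: "searching r I pos \<phi> p \<theta> (iwrite ''j'' 0 v (iwrite ''q'' 0 u s'))"
      "searching r I pos \<phi> p \<theta> (iwrite ''j'' 0 v (rwrite ''x'' 0 a (iwrite ''q'' 0 u s')))"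
      "searching r I pos \<phi> p \<theta> (iwrite ''j'' 0 v (rwrite ''y'' 0 a (iwrite ''q'' 0 u s')))"
      "searching r I pos \<phi> p \<theta> (iwrite ''j'' 0 v (rwrite ''y'' 0 b (rwrite ''x'' 0 a (iwrite ''q'' 0 u s'))))"
      for u v a b using sr by (auto simp: searching_def)
    show ?thesis
      using ld j(1) proc(2) by (simp add: simps Inv_def srw loads_are_def proc(1) out)
  qed
  have "Inv 0 (iwrite ''j'' 0 0 ?s)"
    using s by (simp add: Inv_def searching_def loads_are_def)
  then have "wp (For ''j'' (Var ''i'')
      (Seq (Assign ''q'' (IRead ''ord'' (Var ''j'')))
      (Seq (If (BAnd (IEq (IRead (src_name r) (Var ''q'')) (IRead (src_name r) (Var ''p'')))
                     (IEq (IRead ''phi'' (Var ''q'')) (Var ''th'')))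
              (RAssign ''x'' (RAdd (RVar ''x'') (RRead ''size'' (Var ''q'')))) Skip)
           (If (BAnd (IEq (IRead (snk_name r) (Var ''q'')) (IRead (snk_name r) (Var ''p'')))
                     (IEq (IAdd (IRead ''phi'' (Var ''q'')) (IRead ''tau'' (Var ''q'')))
                          (IAdd (Var ''th'') (IRead ''tau'' (Var ''p'')))))
              (RAssign ''y'' (RAdd (RVar ''y'') (RRead ''size'' (Var ''q'')))) Skip))))
     (\<lambda>t s'. t \<le> pos p * (5 + 2) + 2 \<and> imem s' ''j'' 0 = int (pos p) \<and> Inv (pos p) s') ?s"
    by (rule wp_For[OF _ _ step]) (auto simp: Inv_def searching_def)
  then show ?thesis unfolding loads_prog_def wp_Seq wp_RWrite ival.simps rval.simps of_int_0
    by (rule wp_mono) (use pos in \<open>auto simp: Inv_def before_eq_processed\<close>)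
qed

lemma bval_fits_exp:
  assumes "valid_inst I" "p < nP I" "searching r I pos \<phi> p \<theta> s" "loads_are I \<phi> (before I pos p) p \<theta> s"
  shows "bval (fits_exp r) s \<longleftrightarrow> fits_out I \<phi> (before I pos p) p \<theta> \<and> fits_in I \<phi> (before I pos p) p \<theta>"
proof -
  have rd: "reads r I s" and vp: "imem s ''p'' 0 = int p" using assms by (auto simp: searching_def)
  have p: "p \<in> products I" using assms by (simp add: products_def)
  have w: "src I p < nW I" "snk I p < nW I" using valid_instD[OF assms(1) p] by (auto simp: warehouses_def)
  have c: "0 \<le> carry_out I (src I p)" "0 \<le> carry_in I (snk I p)"
    using assms(1) w by (auto simp: valid_inst_def warehouses_def)
  note rds = readsD(2,3,5)[OF rd assms(2)] readsD(6)[OF rd w(1)] readsD(7)[OF rd w(2)]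
  show ?thesis unfolding fits_exp_def bval.simps
    using assms(4) vp rds by (simp add: bval_fits_cap[OF c(1)] bval_fits_cap[OF c(2)] loads_are_def fits_out_def fits_in_def)
qed

lemma wp_greedy:
  assumes valid: "valid_inst I" and s: "reads r I s" "ordered I pos s"
  shows "wp (greedy_prog r) (\<lambda>t s'. t \<le> 50 * (nP I + 1) ^ 3 \<and> reads r I s' \<and>
    (\<exists>\<phi>. greedy I pos \<phi> \<and> (\<forall>p<nP I. imem s' ''phi'' (int p) = int (\<phi> p)))) s"
proof -
  define m where "m = nP I"
  define Inv where "Inv i s' \<longleftrightarrow> reads r I s' \<and> ordered I pos s' \<and>
    (\<exists>\<phi>. \<forall>p\<in>processed I pos i. greedy_at I pos \<phi> p \<and> imem s' ''phi'' (int p) = int (\<phi> p))" for i s'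
  define B where "B = (7 * m + 4) + (2 * m * (7 * m + 6) + 1) + 3"
  have inj: "inj_on pos (products I)" using ordered_inj s(2) .
  have step: "wp (Seq (Assign ''p'' (IRead ''ord'' (Var ''i'')))
    (Seq (Assign ''th'' (IConst 0))
    (Seq (loads_prog r)
    (Seq (While (BNot (fits_exp r)) (Seq (Assign ''th'' (IAdd (Var ''th'') (IConst 1))) (loads_prog r)))
      (IWrite ''phi'' (Var ''p'') (Var ''th''))))))
    (\<lambda>t s''. t \<le> B \<and> imem s'' ''i'' 0 = int i \<and> Inv (Suc i) (iwrite ''i'' 0 (int (Suc i)) s'')) s'"
    if i: "i < nP I" "imem s' ''i'' 0 = int i" "Inv i s'" for i s'
  proof -
    obtain \<phi> where \<phi>: "\<And>p. p \<in> processed I pos i \<Longrightarrow> greedy_at I pos \<phi> p"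
      "\<And>p. p \<in> processed I pos i \<Longrightarrow> imem s' ''phi'' (int p) = int (\<phi> p)"
      using i(3) by (auto simp: Inv_def)
    have rd: "reads r I s'" and or: "ordered I pos s'" using i(3) by (auto simp: Inv_def)
    obtain p where p: "p < nP I" "pos p = i" "imem s' ''ord'' (int i) = int p"
      using orderedE[OF or i(1)] .
    then have pp: "p \<in> products I" by (simp add: products_def)
    obtain \<Theta> where \<Theta>: "\<Theta> \<le> 2 * nP I" "fits_out I \<phi> (before I pos p) p \<Theta>" "fits_in I \<phi> (before I pos p) p \<Theta>"
      using fits_existing_slot[OF valid pp] .
    define fits where "fits \<theta> \<longleftrightarrow> fits_out I \<phi> (before I pos p) p \<theta> \<and> fits_in I \<phi> (before I pos p) p \<theta>" for \<theta>
    \<comment> \<open>\<open>\<Theta>\<close> is some slot that fits, unknown to the program. It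
      limits the search: \<open>j = \<Theta> - \<theta>\<close> bounds the rounds left, and the
      guard fails at \<open>\<Theta>\<close> at the latest.\<close>
    define W where "W j s'' \<longleftrightarrow> (\<exists>\<theta>. \<theta> + j = \<Theta> \<and> searching r I pos \<phi> p \<theta> s'' \<and>
      loads_are I \<phi> (before I pos p) p \<theta> s'' \<and> (\<forall>\<theta>'<\<theta>. \<not> fits \<theta>'))" for j s''
    let ?s = "iwrite ''th'' 0 0 (iwrite ''p'' 0 (int p) s')"
    have start: "searching r I pos \<phi> p 0 ?s"
      using rd or i p \<phi>(2) by (auto simp: searching_def before_eq_processed)
    have body: "\<exists>j'. j = Suc j' \<and> wp (Seq (Assign ''th'' (IAdd (Var ''th'') (IConst 1))) (loads_prog r))
        (\<lambda>t s''. t \<le> 7 * m + 5 \<and> W j' s'') s1"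
      if W: "W j s1" and nf: "bval (BNot (fits_exp r)) s1" for j s1
    proof -
      obtain \<theta> where \<theta>: "\<theta> + j = \<Theta>" "searching r I pos \<phi> p \<theta> s1"
        "loads_are I \<phi> (before I pos p) p \<theta> s1" "\<forall>\<theta>'<\<theta>. \<not> fits \<theta>'" using W by (auto simp: W_def)
      have nf': "\<not> fits \<theta>" using bval_fits_exp[OF valid p(1) \<theta>(2,3)] nf by (simp add: fits_def)
      then have "\<theta> \<noteq> \<Theta>" using \<Theta> by (auto simp: fits_def)
      then obtain j' where j': "j = Suc j'" using \<theta>(1) by (cases j) auto
      have s2: "searching r I pos \<phi> p (Suc \<theta>) (iwrite ''th'' 0 (int \<theta> + 1) s1)"
        using \<theta>(2) by (simp add: searching_def)
      have th: "imem s1 ''th'' 0 = int \<theta>" using \<theta>(2) by (simp add: searching_def)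
      have "wp (Seq (Assign ''th'' (IAdd (Var ''th'') (IConst 1))) (loads_prog r))
        (\<lambda>t s''. t \<le> 7 * m + 5 \<and> W j' s'') s1"
        unfolding wp_Seq wp_IWrite ival.simps th
        by (rule wp_mono[OF wp_loads[OF s2 p(1)]])
          (use \<theta> nf' j' in \<open>auto simp: W_def m_def less_Suc_eq intro!: exI[of _ "Suc \<theta>"]\<close>)
      then show ?thesis using j' by blast
    qed
    have search: "wp (While (BNot (fits_exp r)) (Seq (Assign ''th'' (IAdd (Var ''th'') (IConst 1))) (loads_prog r)))
        (\<lambda>t s''. t \<le> \<Theta> * (7 * m + 5 + 1) + 1 \<and> (\<exists>j. W j s'') \<and> \<not> bval (BNot (fits_exp r)) s'') s1"
      if "searching r I pos \<phi> p 0 s1" "loads_are I \<phi> (before I pos p) p 0 s1" for s1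
      by (rule wp_While_count[of W, OF _ body]) (use that in \<open>auto simp: W_def\<close>)
    have fin: "Inv (Suc i) (iwrite ''i'' 0 v (iwrite ''phi'' x' \<theta>' s2)) \<and> imem s2 ''i'' 0 = int i"
      if fin: "W j s2" "\<not> bval (BNot (fits_exp r)) s2" "x' = imem s2 ''p'' 0" "\<theta>' = imem s2 ''th'' 0"
      for j s2 v x' \<theta>'
    proof -
      obtain \<theta> where \<theta>: "searching r I pos \<phi> p \<theta> s2"
        "loads_are I \<phi> (before I pos p) p \<theta> s2" "\<forall>\<theta>'<\<theta>. \<not> fits \<theta>'" using fin(1) by (auto simp: W_def)
      have f: "fits \<theta>" using bval_fits_exp[OF valid p(1) \<theta>(1,2)] fin(2) by (simp add: fits_def)
      have proc: "processed I pos (Suc i) = insert p (processed I pos i)"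
        using processed_Suc[OF inj pp] p by simp
      let ?s2 = "iwrite ''i'' 0 v (iwrite ''phi'' (int p) (int \<theta>) s2)"
      have "greedy_at I pos (\<phi>(p := \<theta>)) x \<and> imem ?s2 ''phi'' (int x) = int ((\<phi>(p := \<theta>)) x)"
        if x: "x \<in> processed I pos (Suc i)" for x
      proof
        show "greedy_at I pos (\<phi>(p := \<theta>)) x"
          by (rule greedy_at_update) (use x proc p \<phi>(1) f \<theta>(3) in \<open>auto simp: fits_def processed_def\<close>)
        show "imem ?s2 ''phi'' (int x) = int ((\<phi>(p := \<theta>)) x)"
          using x proc \<theta>(1) p by (auto simp: searching_def before_eq_processed)
      qed
      then have "Inv (Suc i) ?s2" using \<theta>(1) unfolding Inv_def
        by (intro conjI exI[of _ "\<phi>(p := \<theta>)"]) (simp_all add: searching_def)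
      moreover have "x' = int p" "\<theta>' = int \<theta>" "imem s2 ''i'' 0 = int i"
        using fin \<theta>(1) p by (auto simp: searching_def)
      ultimately show ?thesis by simp
    qed
    have eq: "imem s' ''ord'' (imem s' ''i'' 0) = int p" using i p by simp
    show ?thesis unfolding wp_Seq wp_IWrite ival.simps eq
    proof (rule wp_mono[OF wp_loads[OF start p(1)]], rule wp_mono[OF search], blast, blast)
      fix t1 s1 t2 s2
      assume 1: "t1 \<le> 7 * nP I + 4 \<and> searching r I pos \<phi> p 0 s1 \<and> loads_are I \<phi> (before I pos p) p 0 s1"
        and 2: "t2 \<le> \<Theta> * (7 * m + 5 + 1) + 1 \<and> (\<exists>j. W j s2) \<and> \<not> bval (BNot (fits_exp r)) s2"
      obtain j where j: "W j s2" using 2 by blast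
      have "1 + (1 + (t1 + (t2 + 1))) \<le> (7 * m + 4) + (\<Theta> * (7 * m + 6) + 1) + 3"
        using 1 2 by (simp add: m_def algebra_simps)
      moreover have "\<Theta> * (7 * m + 6) \<le> 2 * m * (7 * m + 6)"
        using \<Theta>(1) unfolding m_def by (rule mult_right_mono) simp
      ultimately have "1 + (1 + (t1 + (t2 + 1))) \<le> B" unfolding B_def by linarith
      then show "1 + (1 + (t1 + (t2 + 1))) \<le> B \<and>
        imem (iwrite ''phi'' (imem s2 ''p'' 0) (imem s2 ''th'' 0) s2) ''i'' 0 = int i \<and>
        Inv (Suc i) (iwrite ''i'' 0 (int (Suc i)) (iwrite ''phi'' (imem s2 ''p'' 0) (imem s2 ''th'' 0) s2))"
        using fin[OF j _ refl refl] 2 by simp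
    qed
  qed
  have "wp (greedy_prog r) (\<lambda>t s'. t \<le> nP I * (B + 2) + 2 \<and> imem s' ''i'' 0 = int (nP I) \<and> Inv (nP I) s') s"
    unfolding greedy_prog_def
    by (rule wp_For[OF _ _ step]) (use s in \<open>auto simp: Inv_def readsD(1)\<close>)
  then show ?thesis
  proof (rule wp_mono)
    fix t s' assume a: "t \<le> nP I * (B + 2) + 2 \<and> imem s' ''i'' 0 = int (nP I) \<and> Inv (nP I) s'"
    then obtain \<phi> where \<phi>: "\<And>p. p \<in> products I \<Longrightarrow> greedy_at I pos \<phi> p"
      "\<And>p. p \<in> products I \<Longrightarrow> imem s' ''phi'' (int p) = int (\<phi> p)"
      using processed_all[OF s(2)] by (auto simp: Inv_def)
    have "nP I * (B + 2) + 2 \<le> 50 * (nP I + 1) ^ 3"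
      by (simp add: B_def m_def power3_eq_cube algebra_simps)
    then show "t \<le> 50 * (nP I + 1) ^ 3 \<and> reads r I s' \<and>
      (\<exists>\<phi>. greedy I pos \<phi> \<and> (\<forall>p<nP I. imem s' ''phi'' (int p) = int (\<phi> p)))"
      using a \<phi> inj by (auto simp: Inv_def greedy_def products_def intro!: exI[of _ \<phi>])
  qed
qed

section \<open>Linear-time greedy scheduling for uniform sizes\<close>

definition next_fit_prog :: "bool \<Rightarrow> com" where
  "next_fit_prog r = For ''i'' (Var ''m'')
    (Seq (Assign ''p'' (IRead ''ord'' (Var ''i'')))
    (Seq (Assign ''q'' (IRead (src_name r) (Var ''p'')))
    (Seq (If (fits_cap (RAdd (RRead ''ld'' (Var ''q'')) (RRead ''size'' (Var ''p'')))
               (RRead (out_name r) (Var ''q'')))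
           Skip
           (Seq (IWrite ''cs'' (Var ''q'') (IAdd (IRead ''cs'' (Var ''q'')) (IConst 1)))
                (RWrite ''ld'' (Var ''q'') (RConst 0))))
    (Seq (RWrite ''ld'' (Var ''q'') (RAdd (RRead ''ld'' (Var ''q'')) (RRead ''size'' (Var ''p''))))
      (IWrite ''phi'' (Var ''p'') (IRead ''cs'' (Var ''q'')))))))"

text \<open>State of source \<open>w\<close>: current slot \<open>c\<close> with load
  \<open>l\<close>, every later slot empty, and every earlier one too full for a further product of
  size \<open>a\<close>. With equal sizes an earlier slot can never become usable again, so first
  fit and next fit coincide.\<close>

definition next_fit_at :: "inst \<Rightarrow> real \<Rightarrow> (nat \<Rightarrow> nat) \<Rightarrow> nat set \<Rightarrow> nat \<Rightarrow> nat \<Rightarrow> real \<Rightarrow> bool" where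
  "next_fit_at I a \<phi> X w c l \<longleftrightarrow>
    l = load (psize I) {q \<in> X. src I q = w} \<phi> c \<and> (\<forall>q\<in>X. src I q = w \<longrightarrow> \<phi> q \<le> c) \<and>
    (\<forall>\<theta><c. \<not> ereal (load (psize I) {q \<in> X. src I q = w} \<phi> \<theta> + a) \<le> carry_out I w)"

text \<open>Slot \<open>Suc c\<close> is opened only if \<open>c\<close> has no room for
  \<open>a\<close>. It is empty, and \<open>a\<close> alone respects the capacity, so it accepts the
  product; all slots below it are full.\<close>

lemma next_fit_at_insert:
  assumes X: "finite X" "p \<notin> X" and nf: "next_fit_at I a \<phi> X w c l"
    and size: "psize I p = a" "ereal a \<le> carry_out I w" and w: "src I p = w"
  defines "c' \<equiv> if ereal (l + a) \<le> carry_out I w then c else Suc c"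
    and "l' \<equiv> if ereal (l + a) \<le> carry_out I w then l + a else a"
  shows "next_fit_at I a (\<phi>(p := c')) (insert p X) w c' l'"
    "fits_out I \<phi> X p c'" "\<forall>\<theta><c'. \<not> fits_out I \<phi> X p \<theta>"
proof -
  define Y where "Y = {q \<in> X. src I q = w}"
  have Y: "finite Y" "p \<notin> Y" "{q \<in> insert p X. src I q = w} = insert p Y"
    using X w by (auto simp: Y_def)
  have nf': "l = load (psize I) Y \<phi> c" "\<And>q. q \<in> Y \<Longrightarrow> \<phi> q \<le> c"
    "\<And>\<theta>. \<theta> < c \<Longrightarrow> \<not> ereal (load (psize I) Y \<phi> \<theta> + a) \<le> carry_out I w"
    using nf by (auto simp: next_fit_at_def Y_def)
  have fits: "fits_out I \<phi> X p \<theta> \<longleftrightarrow> ereal (load (psize I) Y \<phi> \<theta> + a) \<le> carry_out I w" for \<theta>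
    using w size by (simp add: fits_out_def Y_def)
  have "{q \<in> Y. \<phi> q = Suc c} = {}" using nf'(2) by fastforce
  then have 0: "load (psize I) Y \<phi> (Suc c) = 0" unfolding load_def by (simp only: sum.empty)
  then show "fits_out I \<phi> X p c'" using nf'(1) size(2) by (simp add: fits c'_def)
  show full: "\<forall>\<theta><c'. \<not> fits_out I \<phi> X p \<theta>"
    using nf'(1,3) by (auto simp: fits c'_def less_Suc_eq)
  have ins: "load (psize I) (insert p Y) (\<phi>(p := c')) \<theta> =
    (if \<theta> = c' then load (psize I) Y \<phi> \<theta> + a else load (psize I) Y \<phi> \<theta>)" for \<theta>
  proof -
    have "load (psize I) Y (\<phi>(p := c')) \<theta>' = load (psize I) Y \<phi> \<theta>'" for \<theta>'
      using Y(2) by (intro load_cong) auto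
    then show ?thesis using Y(1,2) size by (simp add: load_insert)
  qed
  have "l' = load (psize I) (insert p Y) (\<phi>(p := c')) c'"
    using nf'(1) 0 unfolding ins by (simp add: l'_def c'_def)
  moreover have "(\<phi>(p := c')) q \<le> c'" if "q \<in> insert p Y" for q
    using that nf'(2)[of q] by (auto simp: c'_def)
  moreover have "\<not> ereal (load (psize I) (insert p Y) (\<phi>(p := c')) \<theta> + a) \<le> carry_out I w" if "\<theta> < c'" for \<theta>
    using full that by (simp add: ins fits)
  ultimately show "next_fit_at I a (\<phi>(p := c')) (insert p X) w c' l'"
    unfolding next_fit_at_def Y(3) using w by (auto simp: Y_def)
qed

lemma next_fit_at_other:
  assumes "p \<notin> X" "src I p \<noteq> w" "next_fit_at I a \<phi> X w c l"
  shows "next_fit_at I a (\<phi>(p := \<theta>)) (insert p X) w c l"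
proof -
  have eq: "{q \<in> insert p X. src I q = w} = {q \<in> X. src I q = w}" using assms by auto
  have "load (psize I) {q \<in> X. src I q = w} (\<phi>(p := \<theta>)) \<theta>' = load (psize I) {q \<in> X. src I q = w} \<phi> \<theta>'" for \<theta>'
    using assms by (intro load_cong) auto
  then show ?thesis using assms unfolding next_fit_at_def eq by auto
qed

text \<open>Zero in \<open>cs\<close> and \<open>ld\<close> is the correct start for every source:
  slot \<open>0\<close>, still empty. The initial memory provides it and sorting preserves
  it.\<close>

lemma wp_next_fit:
  assumes valid: "valid_inst I" and "no_carry_in I" "uniform_size I"
    and s: "reads r I s" "ordered I pos s"
    and zero: "imem s ''cs'' = (\<lambda>_. 0)" "rmem s ''ld'' = (\<lambda>_. 0)"
  shows "wp (next_fit_prog r) (\<lambda>t s'. t \<le> 9 * nP I + 2 \<and> reads r I s' \<and>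
    (\<exists>\<phi>. greedy I pos \<phi> \<and> (\<forall>p<nP I. imem s' ''phi'' (int p) = int (\<phi> p)))) s"
proof -
  obtain a where a: "\<And>p. p \<in> products I \<Longrightarrow> psize I p = a" using assms(3) by (auto simp: uniform_size_def)
  define Inv where "Inv i s' \<longleftrightarrow> reads r I s' \<and> ordered I pos s' \<and> (\<exists>\<phi> c.
    (\<forall>p\<in>processed I pos i. greedy_at I pos \<phi> p \<and> imem s' ''phi'' (int p) = int (\<phi> p)) \<and>
    (\<forall>w. imem s' ''cs'' (int w) = int (c w) \<and>
      next_fit_at I a \<phi> (processed I pos i) w (c w) (rmem s' ''ld'' (int w))))" for i s'
  have inj: "inj_on pos (products I)" using ordered_inj s(2) .
  have step: "wp (Seq (Assign ''p'' (IRead ''ord'' (Var ''i'')))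
    (Seq (Assign ''q'' (IRead (src_name r) (Var ''p'')))
    (Seq (If (fits_cap (RAdd (RRead ''ld'' (Var ''q'')) (RRead ''size'' (Var ''p'')))
               (RRead (out_name r) (Var ''q'')))
           Skip
           (Seq (IWrite ''cs'' (Var ''q'') (IAdd (IRead ''cs'' (Var ''q'')) (IConst 1)))
                (RWrite ''ld'' (Var ''q'') (RConst 0))))
    (Seq (RWrite ''ld'' (Var ''q'') (RAdd (RRead ''ld'' (Var ''q'')) (RRead ''size'' (Var ''p''))))
      (IWrite ''phi'' (Var ''p'') (IRead ''cs'' (Var ''q'')))))))
    (\<lambda>t s''. t \<le> 7 \<and> imem s'' ''i'' 0 = int i \<and> Inv (Suc i) (iwrite ''i'' 0 (int (Suc i)) s'')) s'"
    if i: "i < nP I" "imem s' ''i'' 0 = int i" "Inv i s'" for i s'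
  proof -
    obtain \<phi> c where \<phi>: "\<And>p. p \<in> processed I pos i \<Longrightarrow> greedy_at I pos \<phi> p"
      "\<And>p. p \<in> processed I pos i \<Longrightarrow> imem s' ''phi'' (int p) = int (\<phi> p)"
      and c: "\<And>w. imem s' ''cs'' (int w) = int (c w)"
        "\<And>w. next_fit_at I a \<phi> (processed I pos i) w (c w) (rmem s' ''ld'' (int w))"
      using i(3) unfolding Inv_def by blast
    have rd: "reads r I s'" and or: "ordered I pos s'" using i(3) by (auto simp: Inv_def)
    obtain p where p: "p < nP I" "pos p = i" "imem s' ''ord'' (int i) = int p"
      using orderedE[OF or i(1)] .
    then have pp: "p \<in> products I" by (simp add: products_def)
    define w where "w = src I p"
    have w: "w < nW I" "0 \<le> carry_out I w" "ereal a \<le> carry_out I w" "src I p = w"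
      using valid_instD[OF valid pp] valid a[OF pp] unfolding w_def by (auto simp: valid_inst_def warehouses_def)
    define l where "l = rmem s' ''ld'' (int w)"
    define ok where "ok \<longleftrightarrow> ereal (l + a) \<le> carry_out I w"
    define c' where "c' = (if ok then c w else Suc (c w))"
    define l' where "l' = (if ok then l + a else a)"
    have proc: "processed I pos (Suc i) = insert p (processed I pos i)" "p \<notin> processed I pos i"
      using processed_Suc[OF inj pp] p by (auto simp: processed_def)
    have bef: "before I pos p = processed I pos i" using p by (simp add: before_eq_processed)
    note ins = next_fit_at_insert[OF finite_processed proc(2) c(2) a[OF pp] w(3,4), folded l_def,
        folded ok_def, folded c'_def l'_def]
    have Inx': "Inv (Suc i) s''" if st: "reads r I s''" "ordered I pos s''"
      and phi: "imem s'' ''phi'' = (imem s' ''phi'')(int p := int c')"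
      and cs: "imem s'' ''cs'' = (imem s' ''cs'')(int w := int c')"
      and ld: "rmem s'' ''ld'' = (rmem s' ''ld'')(int w := l')" for s''
    proof -
      have "greedy_at I pos (\<phi>(p := c')) x \<and> imem s'' ''phi'' (int x) = int ((\<phi>(p := c')) x)"
        if x: "x \<in> processed I pos (Suc i)" for x
      proof
        show "greedy_at I pos (\<phi>(p := c')) x"
          by (rule greedy_at_update)
            (use x proc p \<phi>(1) ins fits_in_if_no_carry_in[OF valid assms(2) pp] in \<open>auto simp: bef processed_def\<close>)
        show "imem s'' ''phi'' (int x) = int ((\<phi>(p := c')) x)" using x proc \<phi>(2) by (auto simp: phi)
      qed
      moreover have "imem s'' ''cs'' (int w') = int ((c(w := c')) w') \<and>
        next_fit_at I a (\<phi>(p := c')) (processed I pos (Suc i)) w' ((c(w := c')) w') (rmem s'' ''ld'' (int w'))" for w'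
        using ins(1) c next_fit_at_other[OF proc(2) _ c(2), of w'] w(4) by (auto simp: cs ld proc(1))
      ultimately show ?thesis using st unfolding Inv_def by blast
    qed
    note rds = readsD(2,5)[OF rd p(1)] readsD(6)[OF rd w(1)]
    let ?s = "iwrite ''q'' 0 (int w) (iwrite ''p'' 0 (int p) s')"
    have bv: "bval (fits_cap (RAdd (RRead ''ld'' (Var ''q'')) (RRead ''size'' (Var ''p'')))
               (RRead (out_name r) (Var ''q''))) ?s \<longleftrightarrow> ok"
      by (subst bval_fits_cap[OF w(2)]) (simp_all add: rds ok_def l_def a[OF pp])
    have e: "ival (IRead ''ord'' (Var ''i'')) s' = int p"
      "ival (IRead (src_name r) (Var ''p'')) (iwrite ''p'' 0 (int p) s') = int w"
      using i p rds by (simp_all add: w_def)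
    show ?thesis
    proof (cases ok)
      case True
      then show ?thesis unfolding wp_Seq wp_IWrite e wp_If ival.simps(1)
        using rd or by (simp add: bv i(2) rds a[OF pp] c(1) fun_upd_idem c'_def l'_def l_def Inx')
    next
      case False
      then have eq: "int c' = int (c w) + 1" "l' = a" by (simp_all add: c'_def l'_def)
      then show ?thesis using False unfolding wp_Seq wp_IWrite e wp_If ival.simps(1)
        using rd or eq by (simp add: bv i(2) rds a[OF pp] c(1) Inx')
    qed
  qed
  have init: "Inv 0 (iwrite ''i'' 0 0 s)"
    unfolding Inv_def using s zero by (auto simp: next_fit_at_def intro!: exI[of _ "\<lambda>_. 0"])
  have "wp (next_fit_prog r) (\<lambda>t s'. t \<le> nP I * (7 + 2) + 2 \<and> imem s' ''i'' 0 = int (nP I) \<and> Inv (nP I) s') s"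
    unfolding next_fit_prog_def
    by (rule wp_For[OF init _ step]) (auto simp: Inv_def readsD(1))
  then show ?thesis
  proof (rule wp_mono)
    fix t s' assume b: "t \<le> nP I * (7 + 2) + 2 \<and> imem s' ''i'' 0 = int (nP I) \<and> Inv (nP I) s'"
    then obtain \<phi> where \<phi>: "\<And>p. p \<in> products I \<Longrightarrow> greedy_at I pos \<phi> p"
      "\<And>p. p \<in> products I \<Longrightarrow> imem s' ''phi'' (int p) = int (\<phi> p)"
      using processed_all[OF s(2)] by (auto simp: Inv_def)
    then show "t \<le> 9 * nP I + 2 \<and> reads r I s' \<and>
      (\<exists>\<phi>. greedy I pos \<phi> \<and> (\<forall>p<nP I. imem s' ''phi'' (int p) = int (\<phi> p)))"
      using b inj by (auto simp: Inv_def greedy_def products_def intro!: exI[of _ \<phi>])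
  qed
qed

section \<open>Reflecting the computed schedule in time\<close>

definition reverse_prog :: com where
  "reverse_prog =
    Seq (Assign ''th'' (IConst 0))
    (Seq (For ''i'' (Var ''m'')
        (If (ILess (Var ''th'') (IAdd (IRead ''phi'' (Var ''i'')) (IRead ''tau'' (Var ''i''))))
          (Assign ''th'' (IAdd (IRead ''phi'' (Var ''i'')) (IRead ''tau'' (Var ''i'')))) Skip))
      (For ''i'' (Var ''m'')
        (IWrite ''phi'' (Var ''i'') (ISub (ISub (Var ''th'') (IRead ''tau'' (Var ''i''))) (IRead ''phi'' (Var ''i''))))))"

lemma wp_reverse:
  assumes rd: "reads r I s" and phi: "\<forall>p<nP I. imem s ''phi'' (int p) = int (\<phi> p)"
  shows "wp reverse_prog (\<lambda>t s'. t \<le> 7 * nP I + 5 \<and>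
    (\<forall>p<nP I. imem s' ''phi'' (int p) = int (completion_time I \<phi> - transit I p - \<phi> p))) s"
proof -
  define T where "T = completion_time I \<phi>"
  \<comment> \<open>The completion time restricted to the first \<open>i\<close> products; including
    \<open>0\<close> matches \<open>completion_time\<close> and the initial value of
    \<open>th\<close>.\<close>
  define mx where "mx i = Max (insert 0 ((\<lambda>p. \<phi> p + transit I p) ` {..<i}))" for i
  have mx_Suc: "mx (Suc i) = max (\<phi> i + transit I i) (mx i)" for i
    unfolding mx_def lessThan_Suc image_insert by (subst insert_commute) (simp add: Max_insert)
  have T: "mx (nP I) = T" by (simp add: mx_def T_def completion_time_def products_def)
  have le: "\<phi> p + transit I p \<le> T" if "p < nP I" for p
    unfolding T_def using that by (intro le_completion_time) (simp add: products_def)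
  define Inv where "Inv i s' \<longleftrightarrow> reads r I s' \<and> (\<forall>p<nP I. imem s' ''phi'' (int p) = int (\<phi> p)) \<and>
    imem s' ''th'' 0 = int (mx i)" for i s'
  define Inx' where "Inx' i s' \<longleftrightarrow> reads r I s' \<and> imem s' ''th'' 0 = int T \<and>
    (\<forall>p<nP I. imem s' ''phi'' (int p) = (if p < i then int (T - transit I p - \<phi> p) else int (\<phi> p)))" for i s'
  have step: "wp (If (ILess (Var ''th'') (IAdd (IRead ''phi'' (Var ''i'')) (IRead ''tau'' (Var ''i''))))
      (Assign ''th'' (IAdd (IRead ''phi'' (Var ''i'')) (IRead ''tau'' (Var ''i'')))) Skip)
    (\<lambda>t s''. t \<le> 2 \<and> imem s'' ''i'' 0 = int i \<and> Inv (Suc i) (iwrite ''i'' 0 (int (Suc i)) s'')) s'"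
    if "i < nP I" "imem s' ''i'' 0 = int i" "Inv i s'" for i s'
  proof -
    have rd: "reads r I s'" using that by (simp add: Inv_def)
    show ?thesis using that readsD(4)[OF rd that(1)] by (auto simp: Inv_def mx_Suc max_def)
  qed
  have step': "wp (IWrite ''phi'' (Var ''i'') (ISub (ISub (Var ''th'') (IRead ''tau'' (Var ''i''))) (IRead ''phi'' (Var ''i''))))
    (\<lambda>t s''. t \<le> 1 \<and> imem s'' ''i'' 0 = int i \<and> Inx' (Suc i) (iwrite ''i'' 0 (int (Suc i)) s'')) s'"
    if "i < nP I" "imem s' ''i'' 0 = int i" "Inx' i s'" for i s'
  proof -
    have rd: "reads r I s'" using that by (simp add: Inx'_def)
    have "int T - int (transit I i) - int (\<phi> i) = int (T - transit I i - \<phi> i)" using le[OF that(1)] by simp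
    then show ?thesis using that readsD(4)[OF rd that(1)] by (auto simp: Inx'_def less_Suc_eq)
  qed
  have first: "wp (For ''i'' (Var ''m'')
      (If (ILess (Var ''th'') (IAdd (IRead ''phi'' (Var ''i'')) (IRead ''tau'' (Var ''i''))))
        (Assign ''th'' (IAdd (IRead ''phi'' (Var ''i'')) (IRead ''tau'' (Var ''i'')))) Skip))
    (\<lambda>t s'. t \<le> nP I * (2 + 2) + 2 \<and> imem s' ''i'' 0 = int (nP I) \<and> Inv (nP I) s') (iwrite ''th'' 0 0 s)"
    by (rule wp_For[OF _ _ step]) (use rd phi in \<open>auto simp: Inv_def readsD(1) mx_def\<close>)
  show ?thesis unfolding reverse_prog_def wp_Seq wp_IWrite ival.simps
  proof (rule wp_mono[OF first])
    fix t1 s1 assume 1: "t1 \<le> nP I * (2 + 2) + 2 \<and> imem s1 ''i'' 0 = int (nP I) \<and> Inv (nP I) s1"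
    have "wp (For ''i'' (Var ''m'') (IWrite ''phi'' (Var ''i'')
        (ISub (ISub (Var ''th'') (IRead ''tau'' (Var ''i''))) (IRead ''phi'' (Var ''i'')))))
      (\<lambda>t s'. t \<le> nP I * (1 + 2) + 2 \<and> imem s' ''i'' 0 = int (nP I) \<and> Inx' (nP I) s') s1"
      by (rule wp_For[OF _ _ step']) (use 1 T in \<open>auto simp: Inv_def Inx'_def readsD(1)\<close>)
    then show "wp (For ''i'' (Var ''m'') (IWrite ''phi'' (Var ''i'')
        (ISub (ISub (Var ''th'') (IRead ''tau'' (Var ''i''))) (IRead ''phi'' (Var ''i'')))))
      (\<lambda>t2 s'. 1 + (t1 + t2) \<le> 7 * nP I + 5 \<and>
        (\<forall>p<nP I. imem s' ''phi'' (int p) = int (completion_time I \<phi> - transit I p - \<phi> p))) s1"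
      by (rule wp_mono) (use 1 in \<open>auto simp: Inx'_def T_def\<close>)
  qed
qed

section \<open>Approximation ratios and running times\<close>

text \<open>Equal multisets give only that \<open>f\<close> maps the positions onto the products. A
  right inverse \<open>pos\<close> is chosen; it is injective, hence by finiteness a
  permutation.\<close>

lemma position_function:
  assumes "segment f 0 (int m) = segment (\<lambda>i. i) 0 (int m)"
  obtains pos where "\<And>p. p < m \<Longrightarrow> pos p < m \<and> f (int (pos p)) = int p" "pos ` {..<m} = {..<m}"
proof -
  have "set_mset (segment f 0 (int m)) = set_mset (segment (\<lambda>i. i) 0 (int m))" using assms by simp
  then have img: "f ` {0..<int m} = {0..<int m}" by (simp add: segment_def)
  have "\<exists>i<m. f (int i) = int p" if "p < m" for p
  proof -
    have "int p \<in> f ` {0..<int m}" using img that by simp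
    then obtain j where "0 \<le> j" "j < int m" "f j = int p" by auto
    then show ?thesis by (intro exI[of _ "nat j"]) auto
  qed
  then obtain pos where pos: "\<And>p. p < m \<Longrightarrow> pos p < m \<and> f (int (pos p)) = int p" by metis
  have "inj_on pos {..<m}" using pos by (metis inj_onI lessThan_iff of_nat_eq_iff)
  then have "pos ` {..<m} = {..<m}" using pos by (intro endo_inj_surj) auto
  then show ?thesis using that pos by blast
qed

definition solve_prog :: "bool \<Rightarrow> (iexp \<Rightarrow> iexp \<Rightarrow> bexp) \<Rightarrow> com \<Rightarrow> com" where
  "solve_prog r cmp alg = Seq (sort_prog cmp) (Seq alg (if r then reverse_prog else Skip))"

text \<open>The common core of all five claims. The analysis takes place on \<open>J\<close>, the
  instance as the program sees it, and the result is carried back to \<open>I\<close> by reversal if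
  \<open>r\<close> is set. Sort key, scheduling program, ratio and the bound \<open>K\<close> on the
  passes are parameters.\<close>

lemma solve_prog_correct:
  fixes I r
  defines "J \<equiv> if r then swap_inst I else I"
  assumes valid: "valid_inst I" and nocap: "no_cap I" and \<alpha>: "0 \<le> \<alpha>"
    and srt: "sorting cmp key (input_state I) (nP I)" and K: "nP I \<le> 2 ^ K"
    and key: "\<And>p. p < nP I \<Longrightarrow> key (int p) = k p"
    and alg: "\<And>s pos. \<lbrakk>reads r J s; ordered J pos s; imem s ''cs'' = (\<lambda>_. 0); rmem s ''ld'' = (\<lambda>_. 0)\<rbrakk> \<Longrightarrow>
      wp alg (\<lambda>t s'. t \<le> B \<and> reads r J s' \<and>
        (\<exists>\<phi>. greedy J pos \<phi> \<and> (\<forall>p<nP J. imem s' ''phi'' (int p) = int (\<phi> p)))) s"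
    and ratio: "\<And>pos \<phi> \<psi> T p. \<lbrakk>greedy J pos \<phi>; decreasing J k pos; feasible J \<psi>;
      completion_time J \<psi> = T; p \<in> products J\<rbrakk> \<Longrightarrow> real (\<phi> p + transit J p) \<le> \<alpha> * real T"
  shows "\<exists>t \<psi>. outputs (solve_prog r cmp alg) I t \<psi> \<and>
    t \<le> (K + 1) * (30 * nP I + 20) + B + (7 * nP I + 6) \<and>
    feasible I \<psi> \<and> real (completion_time I \<psi>) \<le> \<alpha> * real (min_completion_time I)"
proof -
  have J: "nP J = nP I" "valid_inst J" "no_cap J" "products J = products I"
    using valid nocap by (simp_all add: J_def)
  define s0 where "s0 = input_state I"
  have rd0: "reads r J s0" unfolding J_def s0_def by (rule reads_input_state)
  define Good where "Good s' \<longleftrightarrow> (\<exists>\<psi>. (\<forall>p\<in>products I. imem s' ''phi'' (int p) = int (\<psi> p)) \<and>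
    feasible I \<psi> \<and> real (completion_time I \<psi>) \<le> \<alpha> * real (min_completion_time I))" for s' :: state
  have "wp (solve_prog r cmp alg) (\<lambda>t s'. t \<le> (K + 1) * (30 * nP I + 20) + B + (7 * nP I + 6) \<and> Good s') s0"
    unfolding solve_prog_def wp_Seq
  proof (rule wp_mono[OF sorting.wp_sort[OF srt K, folded s0_def]])
    fix t1 s1 assume 1: "t1 \<le> (K + 1) * (30 * nP I + 20) \<and> frame sort_vars s0 s1 \<and>
      sorting.descending key (imem s1 ''ord'') 0 (int (nP I)) \<and>
      segment (imem s1 ''ord'') 0 (int (nP I)) = segment (\<lambda>i. i) 0 (int (nP I))"
    then obtain pos where pos: "\<And>p. p < nP I \<Longrightarrow> pos p < nP I \<and> imem s1 ''ord'' (int (pos p)) = int p"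
        "pos ` {..<nP I} = {..<nP I}"
      using position_function by metis
    then have ord: "ordered J pos s1" by (simp add: ordered_def J)
    have rd: "reads r J s1" using reads_frame[OF _ rd0] 1 by blast
    have dec: "decreasing J k pos"
      unfolding decreasing_def
    proof (intro ballI impI)
      fix p q assume pq: "p \<in> products J" "q \<in> products J" "pos p < pos q"
      then have "p < nP I" "q < nP I" by (auto simp: J(1) products_def)
      then have "key (imem s1 ''ord'' (int (pos q))) \<le> key (imem s1 ''ord'' (int (pos p)))"
        using conjunct1[OF conjunct2[OF conjunct2[OF 1]], unfolded sorting.descending_def[OF srt],
            rule_format, of "int (pos p)" "int (pos q)"] pos(1) pq(3) by simp
      then show "k q \<le> k p" using pos key \<open>p < nP I\<close> \<open>q < nP I\<close> by simp
    qed
    have zero: "imem s1 ''cs'' = (\<lambda>_. 0)" "rmem s1 ''ld'' = (\<lambda>_. 0)"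
      using 1 by (auto simp: frame_def sort_vars_def s0_def input_state_def)
    show "wp alg (\<lambda>t2. wp (if r then reverse_prog else Skip)
      (\<lambda>t3 s'. t1 + (t2 + t3) \<le> (K + 1) * (30 * nP I + 20) + B + (7 * nP I + 6) \<and> Good s')) s1"
    proof (rule wp_mono[OF alg[OF rd ord zero]])
      fix t2 s2 assume 2: "t2 \<le> B \<and> reads r J s2 \<and>
        (\<exists>\<phi>. greedy J pos \<phi> \<and> (\<forall>p<nP J. imem s2 ''phi'' (int p) = int (\<phi> p)))"
      then obtain \<phi> where \<phi>: "greedy J pos \<phi>" "\<forall>p<nP J. imem s2 ''phi'' (int p) = int (\<phi> p)" by blast
      have good: "feasible J \<phi> \<and> real (completion_time J \<phi>) \<le> \<alpha> * real (min_completion_time J)"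
        by (rule greedy_completion_time[OF J(2,3) \<phi>(1) \<alpha>]) (rule ratio[OF \<phi>(1) dec])
      show "wp (if r then reverse_prog else Skip)
        (\<lambda>t3 s'. t1 + (t2 + t3) \<le> (K + 1) * (30 * nP I + 20) + B + (7 * nP I + 6) \<and> Good s') s2"
      proof (cases r)
        case False
        then show ?thesis using 1 2 \<phi>(2) good by (auto simp: Good_def J_def products_def intro!: exI[of _ \<phi>])
      next
        case True
        have "wp reverse_prog (\<lambda>t s'. t \<le> 7 * nP J + 5 \<and>
          (\<forall>p<nP J. imem s' ''phi'' (int p) = int (completion_time J \<phi> - transit J p - \<phi> p))) s2"
          using wp_reverse 2 \<phi>(2) by blast
        then show ?thesis unfolding if_P[OF True]
        proof (rule wp_mono)
          fix t3 :: nat and s3 :: state assume 3: "t3 \<le> 7 * nP J + 5 \<and>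
            (\<forall>p<nP J. imem s3 ''phi'' (int p) = int (completion_time J \<phi> - transit J p - \<phi> p))"
          have JI: "J = swap_inst I" using True by (simp add: J_def)
          note rev = reversal_ratio[OF valid nocap \<alpha>, of \<phi>, folded JI]
          have "Good s3" unfolding Good_def
            using rev good 3 by (intro exI[of _ "\<lambda>p. completion_time I \<phi> - transit I p - \<phi> p"])
              (auto simp: JI products_def)
          then show "t1 + (t2 + t3) \<le> (K + 1) * (30 * nP I + 20) + B + (7 * nP I + 6) \<and> Good s3"
            using 1 2 3 by (simp add: J)
        qed
      qed
    qed
  qed
  then show ?thesis unfolding wp_def outputs_def Good_def s0_def by blast
qed

definition transit_less :: "iexp \<Rightarrow> iexp \<Rightarrow> bexp" where
  "transit_less a b = ILess (IRead ''tau'' a) (IRead ''tau'' b)"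

definition size_less :: "iexp \<Rightarrow> iexp \<Rightarrow> bexp" where
  "size_less a b = RLess (RRead ''size'' a) (RRead ''size'' b)"

lemma sorting_by_transit:
  "sorting transit_less (\<lambda>i. real_of_int (imem (input_state I) ''tau'' i)) (input_state I) (nP I)"
proof
  show "imem (input_state I) ''m'' 0 = int (nP I)" by (simp add: input_state_def input_array_def)
  fix s x y assume "frame sort_vars (input_state I) s"
  then have "imem s ''tau'' = imem (input_state I) ''tau''" by (auto simp: frame_def sort_vars_def)
  then show "bval (transit_less x y) s \<longleftrightarrow> real_of_int (imem (input_state I) ''tau'' (ival x s))
    < real_of_int (imem (input_state I) ''tau'' (ival y s))" by (simp add: transit_less_def)
qed

lemma sorting_by_size: "sorting size_less (rmem (input_state I) ''size'') (input_state I) (nP I)"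
proof
  show "imem (input_state I) ''m'' 0 = int (nP I)" by (simp add: input_state_def input_array_def)
  fix s x y assume "frame sort_vars (input_state I) s"
  then have "rmem s = rmem (input_state I)" by (simp add: frame_def)
  then show "bval (size_less x y) s \<longleftrightarrow> rmem (input_state I) ''size'' (ival x s)
    < rmem (input_state I) ''size'' (ival y s)" by (simp add: size_less_def)
qed

lemma key_input:
  assumes "p < nP I"
  shows "real_of_int (imem (input_state I) ''tau'' (int p)) = real (transit I p)"
    "rmem (input_state I) ''size'' (int p) = psize I p"
  using assms by (auto simp: input_state_def input_array_def)

lemma approximableI:
  assumes "\<And>I. \<lbrakk>valid_inst I; Q I\<rbrakk> \<Longrightarrow> \<exists>t \<psi>. outputs c I t \<psi> \<and>
    t \<le> (nP I + 1) * (30 * nP I + 20) + 50 * (nP I + 1) ^ 3 + (7 * nP I + 6) \<and>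
    feasible I \<psi> \<and> real (completion_time I \<psi>) \<le> \<alpha> * real (min_completion_time I)"
  shows "approximable \<alpha> Q"
  unfolding approximable_def
\<comment> \<open>The witness is \<open>107 * (x + 1) ^ 3\<close>, where
  \<open>107 = 50 + 50 + 7\<close> bounds sorting, scheduling and reversal in turn.\<close>
proof (intro exI[of _ c] exI[of _ "[:107:] * [:1, 1:] ^ 3"] allI impI)
  fix I assume "valid_inst I" "Q I"
  then obtain t \<psi> where \<psi>: "outputs c I t \<psi>" "feasible I \<psi>"
      "real (completion_time I \<psi>) \<le> \<alpha> * real (min_completion_time I)"
    and t: "t \<le> (nP I + 1) * (30 * nP I + 20) + 50 * (nP I + 1) ^ 3 + (7 * nP I + 6)"
    using assms by blast
  note t
  also have "(nP I + 1) * (30 * nP I + 20) + 50 * (nP I + 1) ^ 3 + (7 * nP I + 6) \<le> 107 * (nP I + 1) ^ 3"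
    by (simp add: power3_eq_cube algebra_simps)
  also have "\<dots> \<le> 107 * (input_length I + 1) ^ 3"
    by (intro mult_left_mono power_mono) (auto simp: input_length_def)
  also have "\<dots> = poly ([:107:] * [:1, 1:] ^ 3) (input_length I)" by (simp add: poly_power)
  finally show "\<exists>t \<phi>. outputs c I t \<phi> \<and> t \<le> poly ([:107:] * [:1, 1:] ^ 3) (input_length I) \<and>
    feasible I \<phi> \<and> real (completion_time I \<phi>) \<le> \<alpha> * real (min_completion_time I)"
    using \<psi> by blast
qed

text \<open>Allows sorting to be charged with \<open>nP I\<close> passes wherever a polynomial bound
  suffices.\<close>

lemma le_two_power: "(m::nat) \<le> 2 ^ m"
  using less_exp[of m] by simp

lemma approximable_by_transit:
  assumes "\<And>I. Q I \<Longrightarrow> no_cap I \<and> no_carry_in (if r then swap_inst I else I)"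
  shows "approximable (7 / 4) Q"
proof (rule approximableI)
  fix I assume I: "valid_inst I" "Q I"
  define J where "J = (if r then swap_inst I else I)"
  have J: "valid_inst J" "no_carry_in J" "nP J = nP I" "transit J = transit I"
    using I assms[of I] by (auto simp: J_def)
  show "\<exists>t \<psi>. outputs (solve_prog r transit_less (greedy_prog r)) I t \<psi> \<and>
    t \<le> (nP I + 1) * (30 * nP I + 20) + 50 * (nP I + 1) ^ 3 + (7 * nP I + 6) \<and>
    feasible I \<psi> \<and> real (completion_time I \<psi>) \<le> 7 / 4 * real (min_completion_time I)"
    by (rule solve_prog_correct[where r = r, OF I(1) _ _ sorting_by_transit le_two_power key_input(1), folded J_def])
      (use I assms[of I] J wp_greedy[OF J(1)] greedy_ratio_no_carry_in[OF J(1)] in auto)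
qed

lemma approximable_by_size:
  assumes "\<And>I. Q I \<Longrightarrow> no_cap I" "0 \<le> \<alpha>"
    and "\<And>I \<phi> \<psi> pos T p. \<lbrakk>Q I; valid_inst (if r then swap_inst I else I);
        greedy (if r then swap_inst I else I) pos \<phi>; feasible (if r then swap_inst I else I) \<psi>;
        completion_time (if r then swap_inst I else I) \<psi> = T; p \<in> products (if r then swap_inst I else I);
        decreasing (if r then swap_inst I else I) (psize (if r then swap_inst I else I)) pos\<rbrakk>
      \<Longrightarrow> real (\<phi> p + transit (if r then swap_inst I else I) p) \<le> \<alpha> * real T"
  shows "approximable \<alpha> Q"
proof (rule approximableI)
  fix I assume I: "valid_inst I" "Q I"
  define J where "J = (if r then swap_inst I else I)"
  have J: "valid_inst J" "nP J = nP I" "psize J = psize I"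
    using I by (auto simp: J_def)
  show "\<exists>t \<psi>. outputs (solve_prog r size_less (greedy_prog r)) I t \<psi> \<and>
    t \<le> (nP I + 1) * (30 * nP I + 20) + 50 * (nP I + 1) ^ 3 + (7 * nP I + 6) \<and>
    feasible I \<psi> \<and> real (completion_time I \<psi>) \<le> \<alpha> * real (min_completion_time I)"
    by (rule solve_prog_correct[where r = r, OF I(1) _ _ sorting_by_size le_two_power key_input(2), folded J_def])
      (use I assms(1,2) J wp_greedy[OF J(1)] assms(3)[OF I(2), folded J_def] in auto)
qed

text \<open>\<open>K\<close> is the logarithm rounded up. The estimate is confined to positive
  \<open>m\<close>, since the logarithm of \<open>0\<close> is only a default value.\<close>

lemma log_exponent:
  obtains K where "m \<le> 2 ^ K" "m = 0 \<longrightarrow> K = 0" "0 < m \<longrightarrow> real K \<le> log 2 (real m) + 1"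
proof (cases "m = 0")
  case True
  then show ?thesis using that[of 0] by simp
next
  case False
  define K where "K = nat \<lceil>log 2 (real m)\<rceil>"
  have nn: "0 \<le> log 2 (real m)" using False by simp
  have "real m = 2 powr log 2 (real m)" using False by simp
  also have "\<dots> \<le> 2 powr real K" unfolding K_def by (intro powr_mono) (auto simp: real_nat_ceiling_ge)
  also have "\<dots> = real (2 ^ K)" by (simp add: powr_realpow)
  finally have "m \<le> 2 ^ K" using of_nat_le_iff by blast
  moreover have "real K \<le> log 2 (real m) + 1" unfolding K_def using nn by linarith
  ultimately show ?thesis using that False by blast
qed

lemma optimal_by_transit:
  assumes "\<And>I. Q I \<Longrightarrow> no_cap I \<and> no_carry_in (if r then swap_inst I else I) \<and> uniform_size I"
  shows "optimally_solvable_in_time (\<lambda>n m. n + m * log 2 m) Q"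
  unfolding optimally_solvable_in_time_def
proof (intro exI[of _ "solve_prog r transit_less (next_fit_prog r)"] exI[of _ "400 :: real"] allI impI)
  fix I assume I: "valid_inst I" "Q I"
  define J where "J = (if r then swap_inst I else I)"
  have J: "valid_inst J" "no_carry_in J" "nP J = nP I" "transit J = transit I" "uniform_size J"
    using I assms[of I] by (auto simp: J_def)
  define m where "m = nP I"
  obtain K where K: "m \<le> 2 ^ K" "m = 0 \<longrightarrow> K = 0" "0 < m \<longrightarrow> real K \<le> log 2 (real m) + 1"
    using log_exponent .
  \<comment> \<open>Optimality is treated as ratio \<open>1\<close>; equality follows because no
    feasible schedule beats the minimum.\<close>
  have opt: "real (\<phi> p + transit J p) \<le> 1 * real T"
    if "greedy J pos \<phi>" "decreasing J (\<lambda>p. real (transit I p)) pos" "feasible J \<psi>"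
      "completion_time J \<psi> = T" "p \<in> products J" for pos \<phi> \<psi> T p
    using greedy_optimal[OF J(1), of pos \<phi> \<psi> T p] that J by simp
  have "\<exists>t \<psi>. outputs (solve_prog r transit_less (next_fit_prog r)) I t \<psi> \<and>
    t \<le> (K + 1) * (30 * nP I + 20) + (9 * nP I + 2) + (7 * nP I + 6) \<and>
    feasible I \<psi> \<and> real (completion_time I \<psi>) \<le> 1 * real (min_completion_time I)"
    by (rule solve_prog_correct[where r = r, OF I(1) _ _ sorting_by_transit K(1)[unfolded m_def] key_input(1), folded J_def])
      (use I assms[of I] J wp_next_fit[OF J(1,2,5)] opt in auto)
  then obtain t \<psi> where \<psi>: "outputs (solve_prog r transit_less (next_fit_prog r)) I t \<psi>" "feasible I \<psi>"
      "completion_time I \<psi> \<le> min_completion_time I"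
    and t: "t \<le> (K + 1) * (30 * m + 20) + (9 * m + 2) + (7 * m + 6)"
    unfolding m_def by auto
  have "real t \<le> 400 * (1 + (real (nW I) + real m * log 2 (real m)))"
  proof (cases "m \<le> 1")
    \<comment> \<open>Here \<open>m * log 2 m\<close> vanishes, and the summand \<open>1\<close> of
      the time bound pays for the constant number of steps.\<close>
    case True
    then have "K \<le> 1" and z: "real m * log 2 (real m) = 0" using K by (cases "m = 0"; simp add: le_Suc_eq)+
    then have "(K + 1) * (30 * m + 20) \<le> 2 * 50" using True by (intro mult_mono) auto
    then have "t \<le> 200" using t True by linarith
    then show ?thesis unfolding z by simp
  next
    case False
    \<comment> \<open>From \<open>m \<ge> 2\<close> follow \<open>L \<ge> 1\<close>,
      \<open>K + 1 \<le> L + 2 \<le> 3 * L\<close> and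
      \<open>30 * m + 20 \<le> 40 * m\<close>.\<close>
    define L where "L = log 2 (real m)"
    have L: "1 \<le> L" "real K \<le> L + 1" using False K by (auto simp: L_def)
    have mL: "real m \<le> real m * L" using L(1) by (simp add: mult_le_cancel_left1)
    have "real t \<le> real ((K + 1) * (30 * m + 20) + (9 * m + 2) + (7 * m + 6))"
      using t by (simp only: of_nat_le_iff)
    also have "\<dots> = (real K + 1) * (30 * real m + 20) + (9 * real m + 2) + (7 * real m + 6)"
      by (simp add: algebra_simps)
    also have "\<dots> \<le> (3 * L) * (40 * real m) + (9 * real m + 2) + (7 * real m + 6)"
      using L False by (intro add_mono mult_mono) auto
    also have "\<dots> = 120 * (real m * L) + 16 * real m + 8" by simp
    also have "\<dots> \<le> 400 * (real m * L) + 400" using mL of_nat_0_le_iff[of m] by linarith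
    also have "\<dots> \<le> 400 * (1 + (real (nW I) + real m * L))" by simp
    finally show ?thesis by (simp add: L_def)
  qed
  then show "\<exists>t \<phi>. outputs (solve_prog r transit_less (next_fit_prog r)) I t \<phi> \<and>
    real t \<le> 400 * (1 + (real (nW I) + real (nP I) * log 2 (real (nP I)))) \<and>
    feasible I \<phi> \<and> completion_time I \<phi> = min_completion_time I"
    using \<psi> min_completion_time_le[OF \<psi>(2)] unfolding m_def by (metis antisym)
qed

theorem theorem12:
  shows
    "(optimally_solvable_in_time (\<lambda>n m. n + m * log 2 m)
        (\<lambda>I. no_cap I \<and> no_carry_in I \<and> uniform_size I) \<and>
      optimally_solvable_in_time (\<lambda>n m. n + m * log 2 m)
        (\<lambda>I. no_cap I \<and> no_carry_out I \<and> uniform_size I)) \<and>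
     (approximable (3/2) (\<lambda>I. no_cap I \<and> no_carry_in I \<and> uniform_transit I) \<and>
      approximable (3/2) (\<lambda>I. no_cap I \<and> no_carry_out I \<and> uniform_transit I)) \<and>
     (approximable (7/4) (\<lambda>I. no_cap I \<and> no_carry_in I) \<and>
      approximable (7/4) (\<lambda>I. no_cap I \<and> no_carry_out I)) \<and>
     approximable 4 (\<lambda>I. no_cap I \<and> uniform_size I) \<and>
     approximable 6 no_cap"
proof (intro conjI)
  show "optimally_solvable_in_time (\<lambda>n m. n + m * log 2 m) (\<lambda>I. no_cap I \<and> no_carry_in I \<and> uniform_size I)"
    by (rule optimal_by_transit[where r = False]) simp
  show "optimally_solvable_in_time (\<lambda>n m. n + m * log 2 m) (\<lambda>I. no_cap I \<and> no_carry_out I \<and> uniform_size I)"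
    by (rule optimal_by_transit[where r = True]) simp
  show "approximable (3/2) (\<lambda>I. no_cap I \<and> no_carry_in I \<and> uniform_transit I)"
    by (rule approximable_by_size[where r = False]) (use greedy_ratio_uniform_transit in auto)
  show "approximable (3/2) (\<lambda>I. no_cap I \<and> no_carry_out I \<and> uniform_transit I)"
    by (rule approximable_by_size[where r = True])
      (use greedy_ratio_uniform_transit[where I = "swap_inst I" for I] in auto)
  show "approximable (7/4) (\<lambda>I. no_cap I \<and> no_carry_in I)"
    by (rule approximable_by_transit[where r = False]) simp
  show "approximable (7/4) (\<lambda>I. no_cap I \<and> no_carry_out I)"
    by (rule approximable_by_transit[where r = True]) simp
  show "approximable 4 (\<lambda>I. no_cap I \<and> uniform_size I)"
    \<comment> \<open>The program is the one for the general case; only the count of blocked slots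
      improves.\<close>
    by (rule approximable_by_size[where r = False]) (use greedy_ratio_uniform_size in auto)
  show "approximable 6 no_cap"
    by (rule approximable_by_size[where r = False]) (use greedy_ratio_general in auto)
qed

end
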